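(* Let $n,d\ge1$ and let $\mathcal B_\alpha$, $\alpha\in\{\mathrm D,\mathrm N,\mathrm R\}$, be the bilinear forms of the second-order system defined in the context. For $\alpha=\mathrm N,\mathrm R$ there exists a constant $C>0$ such that for all $\boldsymbol v=(\varphi_0,\dots,\varphi_{n-1})\in(H^2(\Omega))^n$, $$\mathcal B_\alpha(\boldsymbol v,\boldsymbol v)\ge C\sum_{k=0}^{n-1}\Big(\|\nabla\varphi_k\|_{H(\mathrm{div};\Omega)}^2+\|\varphi_k\|_{H^1(\Omega)}^2\Big),$$ and, for the Dirichlet boundary, there exists a constant $C>0$ such that for all such $\boldsymbol v$, $$\Big(\mathcal B_{\mathrm D}^{1/2}(\boldsymbol v,\boldsymbol v)+\sum_{k=0}^{n-1}\|\nabla\varphi_k\|_{L^2(\partial\Omega)}\Big)\mathcal B_{\mathrm D}^{1/2}(\boldsymbol v,\boldsymbol v)\ge C\sum_{k=0}^{n-1}\Big(\|\nabla\varphi_k\|_{H(\mathrm{div};\Omega)}^2+\|\varphi_k\|_{H^1(\Omega)}^2\Big).$$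
   Context: $\Omega=[0,1]^d$, $\boldsymbol n$ is the outer unit normal of $\partial\Omega$, $\lambda,\mu>0$ are fixed constants. $\|\boldsymbol q\|_{H(\mathrm{div};\Omega)}=(\|\boldsymbol q\|_{L^2(\Omega)}^2+\|\mathrm{div}\,\boldsymbol q\|_{L^2(\Omega)}^2)^{1/2}$. Write $\boldsymbol w=(\rho_0,\dots,\rho_{n-1})$ for a second argument. $\mathcal P^*\boldsymbol v=(\Delta\varphi_0-\varphi_1,\dots,\Delta\varphi_{n-2}-\varphi_{n-1},\ \Delta\varphi_{n-1})$. On $\partial\Omega$: $S^*_{\mathrm D}\boldsymbol v=(\varphi_0,\dots,\varphi_{n-1})$, $S^*_{\mathrm N}\boldsymbol v=(\partial_{\boldsymbol n}\varphi_0,\dots,\partial_{\boldsymbol n}\varphi_{n-1})$, $S^*_{\mathrm R}=S^*_{\mathrm D}+S^*_{\mathrm N}$ (traces). For $\alpha=\mathrm D,\mathrm R$: $\mathcal B_\alpha(\boldsymbol v,\boldsymbol w)=(\mathcal P^*\boldsymbol v,\mathcal P^*\boldsymbol w)_{L^2(\Omega)}+\lambda(S^*_\alpha\boldsymbol v,S^*_\alpha\boldsymbol w)_{L^2(\partial\Omega)}$. For $\alpha=\mathrm N$: $\mathcal B_{\mathrm N}(\boldsymbol v,\boldsymbol w)=(\mathcal P^*\boldsymbol v,\mathcal P^*\boldsymbol w)_{L^2(\Omega)}+\lambda(S^*_{\mathrm N}\boldsymbol v,S^*_{\mathrm N}\boldsymbol w)_{L^2(\partial\Omega)}+\mu\int_\Omega\varphi_0\,\mathrm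 dx\int_\Omega\rho_0\,\mathrm dx$. $\mathcal B_{\mathrm D}^{1/2}(\boldsymbol v,\boldsymbol v)$ denotes $\sqrt{\mathcal B_{\mathrm D}(\boldsymbol v,\boldsymbol v)}$. *)

theory Defs
  imports "HOL-Analysis.Analysis"
begin

subsection \<open>The cube, its boundary measure and its normal\<close>

text \<open>A function on the cube is a total function on \<open>real ^ 'd\<close> whose values off the cube are
  irrelevant; elements of \<open>L\<^sup>2\<close> and of the Sobolev spaces are given by representatives.\<close>

abbreviation Omega :: "(real ^ 'd) set" where
  "Omega \<equiv> cbox 0 1"

abbreviation Omega_measure :: "(real ^ 'd) measure" where
  "Omega_measure \<equiv> lebesgue_on Omega"

text \<open>The \<open>(d-1)\<close>-dimensional Lebesgue measure on the face \<open>{x \<in> Omega. x $ i = s}\<close>, \<open>s \<in> {0,1}\<close>: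
  the product of the Lebesgue measures on \<open>[0,1]\<close> over all coordinates other than \<open>i\<close>. For
  \<open>d = 1\<close> this is a unit point mass.\<close>

definition face_measure :: "'d::finite \<Rightarrow> real \<Rightarrow> (real ^ 'd) measure" where
  "face_measure i s =
     distr (PiM (UNIV - {i}) (\<lambda>_. restrict_space lborel {0..1})) borel
       (\<lambda>y. \<chi> j. if j = i then s else y j)"

definition boundary_measure :: "(real ^ 'd) measure" where
  "boundary_measure =
     measure_of UNIV (sets borel)
       (\<lambda>A. \<Sum>i\<in>UNIV. \<Sum>s\<in>{0, 1}. emeasure (face_measure i s) A)"

text \<open>This is the outer unit normal on the relative interior of each face; the remaining points
  of the boundary form a null set of \<open>boundary_measure\<close>.\<close>

definition outer_normal :: "real ^ 'd \<Rightarrow> real ^ 'd" where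
  "outer_normal x = (\<chi> i. if x $ i = 1 then 1 else if x $ i = 0 then -1 else 0)"

subsection \<open>Square integrable functions\<close>

definition square_integrable :: "'a measure \<Rightarrow> ('a \<Rightarrow> 'b::euclidean_space) \<Rightarrow> bool" where
  "square_integrable M f \<longleftrightarrow>
     f \<in> borel_measurable M \<and> integrable M (\<lambda>x. (norm (f x))\<^sup>2)"

definition L2_norm :: "'a measure \<Rightarrow> ('a \<Rightarrow> 'b::euclidean_space) \<Rightarrow> real" where
  "L2_norm M f = sqrt (\<integral>x. (norm (f x))\<^sup>2 \<partial>M)"

definition L2_inner_tuple ::
  "'a measure \<Rightarrow> nat \<Rightarrow> (nat \<Rightarrow> 'a \<Rightarrow> real) \<Rightarrow> (nat \<Rightarrow> 'a \<Rightarrow> real) \<Rightarrow> real" where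
  "L2_inner_tuple M n f g = (\<Sum>k<n. \<integral>x. f k x * g k x \<partial>M)"

subsection \<open>Smooth functions\<close>

definition partial_deriv :: "'d \<Rightarrow> (real ^ 'd \<Rightarrow> real) \<Rightarrow> real ^ 'd \<Rightarrow> real" where
  "partial_deriv i f x = frechet_derivative f (at x) (axis i 1)"

primrec C_k :: "nat \<Rightarrow> (real ^ 'd \<Rightarrow> real) \<Rightarrow> bool" where
  "C_k 0 f \<longleftrightarrow> continuous_on UNIV f"
| "C_k (Suc m) f \<longleftrightarrow>
     (\<forall>x. f differentiable (at x)) \<and> (\<forall>i. C_k m (partial_deriv i f))"

definition smooth :: "(real ^ 'd \<Rightarrow> real) \<Rightarrow> bool" where
  "smooth f \<longleftrightarrow> (\<forall>m. C_k m f)"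

definition test_function :: "(real ^ 'd \<Rightarrow> real) \<Rightarrow> bool" where
  "test_function \<psi> \<longleftrightarrow>
     smooth \<psi> \<and> (\<exists>K. compact K \<and> K \<subseteq> interior Omega \<and> (\<forall>x. x \<notin> K \<longrightarrow> \<psi> x = 0))"

subsection \<open>Weak derivatives and Sobolev spaces\<close>

text \<open>Only square integrable weak derivatives of square integrable functions are considered. They
  are unique almost everywhere; the functions below pick a representative.\<close>

definition has_weak_partial ::
  "'d \<Rightarrow> (real ^ 'd \<Rightarrow> real) \<Rightarrow> (real ^ 'd \<Rightarrow> real) \<Rightarrow> bool" where
  "has_weak_partial i u g \<longleftrightarrow>
     square_integrable Omega_measure u \<and> square_integrable Omega_measure g \<and>
     (\<forall>\<psi>. test_function \<psi> \<longrightarrow>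
        (\<integral>x. u x * partial_deriv i \<psi> x \<partial>Omega_measure) = - (\<integral>x. g x * \<psi> x \<partial>Omega_measure))"

definition weak_partial :: "'d \<Rightarrow> (real ^ 'd \<Rightarrow> real) \<Rightarrow> real ^ 'd \<Rightarrow> real" where
  "weak_partial i u = (SOME g. has_weak_partial i u g)"

definition weak_grad :: "(real ^ 'd \<Rightarrow> real) \<Rightarrow> real ^ 'd \<Rightarrow> real ^ 'd" where
  "weak_grad u x = (\<chi> i. weak_partial i u x)"

definition weak_laplacian :: "(real ^ 'd \<Rightarrow> real) \<Rightarrow> real ^ 'd \<Rightarrow> real" where
  "weak_laplacian u x = (\<Sum>i\<in>UNIV. weak_partial i (weak_partial i u) x)"

definition has_weak_div :: "(real ^ 'd \<Rightarrow> real ^ 'd) \<Rightarrow> (real ^ 'd \<Rightarrow> real) \<Rightarrow> bool" where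
  "has_weak_div q g \<longleftrightarrow>
     square_integrable Omega_measure q \<and> square_integrable Omega_measure g \<and>
     (\<forall>\<psi>. test_function \<psi> \<longrightarrow>
        (\<integral>x. q x \<bullet> (\<chi> i. partial_deriv i \<psi> x) \<partial>Omega_measure)
          = - (\<integral>x. g x * \<psi> x \<partial>Omega_measure))"

definition weak_div :: "(real ^ 'd \<Rightarrow> real ^ 'd) \<Rightarrow> real ^ 'd \<Rightarrow> real" where
  "weak_div q = (SOME g. has_weak_div q g)"

definition H1 :: "(real ^ 'd \<Rightarrow> real) set" where
  "H1 = {u. square_integrable Omega_measure u \<and> (\<forall>i. \<exists>g. has_weak_partial i u g)}"

definition H2 :: "(real ^ 'd \<Rightarrow> real) set" where
  "H2 = {u. u \<in> H1 \<and> (\<forall>i. weak_partial i u \<in> H1)}"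

definition H1_norm :: "(real ^ 'd \<Rightarrow> real) \<Rightarrow> real" where
  "H1_norm u = sqrt ((L2_norm Omega_measure u)\<^sup>2 + (L2_norm Omega_measure (weak_grad u))\<^sup>2)"

definition Hdiv_norm :: "(real ^ 'd \<Rightarrow> real ^ 'd) \<Rightarrow> real" where
  "Hdiv_norm q = sqrt ((L2_norm Omega_measure q)\<^sup>2 + (L2_norm Omega_measure (weak_div q))\<^sup>2)"

subsection \<open>Traces\<close>

text \<open>The trace operator is the continuous extension to \<open>H\<^sup>1\<close>, with values in \<open>L\<^sup>2\<close> of the boundary,
  of the restriction map on functions smooth up to the boundary. It is defined almost everywhere;
  \<open>boundary_trace\<close> picks a representative.\<close>

definition has_trace :: "(real ^ 'd \<Rightarrow> real) \<Rightarrow> (real ^ 'd \<Rightarrow> real) \<Rightarrow> bool" where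
  "has_trace u g \<longleftrightarrow>
     u \<in> H1 \<and> square_integrable boundary_measure g \<and>
     (\<exists>U :: nat \<Rightarrow> real ^ 'd \<Rightarrow> real.
        (\<forall>m. smooth (U m)) \<and>
        (\<lambda>m. H1_norm (\<lambda>x. U m x - u x)) \<longlonglongrightarrow> 0 \<and>
        (\<lambda>m. L2_norm boundary_measure (\<lambda>x. U m x - g x)) \<longlonglongrightarrow> 0)"

definition boundary_trace :: "(real ^ 'd \<Rightarrow> real) \<Rightarrow> real ^ 'd \<Rightarrow> real" where
  "boundary_trace u = (SOME g. has_trace u g)"

definition grad_trace :: "(real ^ 'd \<Rightarrow> real) \<Rightarrow> real ^ 'd \<Rightarrow> real ^ 'd" where
  "grad_trace u x = (\<chi> i. boundary_trace (weak_partial i u) x)"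

definition normal_deriv :: "(real ^ 'd \<Rightarrow> real) \<Rightarrow> real ^ 'd \<Rightarrow> real" where
  "normal_deriv u x = grad_trace u x \<bullet> outer_normal x"

subsection \<open>The second-order system\<close>

text \<open>A tuple of \<open>n\<close> functions is a sequence of which only the entries with index below \<open>n\<close> are
  used.\<close>

datatype boundary_type = Dirichlet | Neumann | Robin

definition P_star ::
  "nat \<Rightarrow> (nat \<Rightarrow> real ^ 'd \<Rightarrow> real) \<Rightarrow> nat \<Rightarrow> real ^ 'd \<Rightarrow> real" where
  "P_star n v k x =
     (if Suc k < n then weak_laplacian (v k) x - v (Suc k) x else weak_laplacian (v k) x)"

fun S_star ::
  "boundary_type \<Rightarrow> (nat \<Rightarrow> real ^ 'd \<Rightarrow> real) \<Rightarrow> nat \<Rightarrow> real ^ 'd \<Rightarrow> real" where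
  "S_star Dirichlet v k x = boundary_trace (v k) x"
| "S_star Neumann v k x = normal_deriv (v k) x"
| "S_star Robin v k x = boundary_trace (v k) x + normal_deriv (v k) x"

definition bilinear_form ::
  "real \<Rightarrow> real \<Rightarrow> nat \<Rightarrow> boundary_type \<Rightarrow>
   (nat \<Rightarrow> real ^ 'd \<Rightarrow> real) \<Rightarrow> (nat \<Rightarrow> real ^ 'd \<Rightarrow> real) \<Rightarrow> real" where
  "bilinear_form lam mu n \<alpha> v w =
     L2_inner_tuple Omega_measure n (P_star n v) (P_star n w)
     + lam * L2_inner_tuple boundary_measure n (S_star \<alpha> v) (S_star \<alpha> w)
     + (if \<alpha> = Neumann
        then mu * (\<integral>x. v 0 x \<partial>Omega_measure) * (\<integral>x. w 0 x \<partial>Omega_measure) else 0)"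

end

theory Submission
  imports Defs "HOL-Real_Asymp.Real_Asymp"
begin

text \<open>Green's formula \<open>\<parallel>\<nabla>u\<parallel>\<^sup>2 = (\<partial>\<^sub>n u, u) - (\<Delta>u, u)\<close>, the first pairing over the boundary, combined with the trace
  inequality and a Poincare or Friedrichs inequality bounds \<open>\<parallel>u\<parallel>\<close> in \<open>H\<^sup>1\<close> by \<open>\<Delta>u\<close> and the boundary
  data (and by the mean of \<open>u\<close> in the Neumann case). Since \<open>\<Delta>\<phi>\<^sub>k\<close> is the sum of the \<open>k\<close>-th component of
  the operator and \<open>\<phi>\<^sub>k\<^sub>+\<^sub>1\<close>, these bounds are chained from \<open>k = n - 1\<close> down to \<open>0\<close>; in the
  Neumann case, integrating the same relation over the cube controls the means.

  All facts about \<open>H\<^sup>1\<close> are limits of identities for smooth functions, where they reduce to the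
  divergence theorem on the cube. The density behind this, like the Poincare inequality, comes from
  the products of cosines, which are the Neumann eigenfunctions of the cube.\<close>

subsection \<open>Square integrable functions\<close>

text \<open>Weak derivatives are tested only against functions with compact support in the open
  cube, while traces are limits from functions smooth up to the boundary. The gap between the two is
  the main obstacle. It is crossed by functions such as \<open>sin_tensor\<close>, which vanish
  linearly at the faces orthogonal to one axis: multiplied by a cut-off they become test functions,
  and the cut-off can be removed in the limit because its derivative grows only like the inverse
  distance to the faces. Hence the eigenfunction property of the cosine products also holds against
  weak derivatives.

  No compactness argument enters, so all constants are explicit. The Poincare inequality is the
  spectral gap of the cube: non-zero eigenvalues are at least 1 (in fact pi^2).

  The Dirichlet form contains no normal derivative. The boundary pairing in Green's formula can
  therefore only be split by Cauchy-Schwarz into the gradient trace times a trace that is controlled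
  by the square root of the form; this is where the product in the Dirichlet estimate comes
  from.\<close>

lemma square_integrable_measurable: "square_integrable M f \<Longrightarrow> f \<in> borel_measurable M"
  by (simp add: square_integrable_def)

lemma square_integrable_integrable: "square_integrable M f \<Longrightarrow> integrable M (\<lambda>x. (norm (f x))\<^sup>2)"
  by (simp add: square_integrable_def)

lemma square_integrable_inner:
  assumes "square_integrable M f" "square_integrable M g"
  shows "integrable M (\<lambda>x. f x \<bullet> g x)"
proof (rule Bochner_Integration.integrable_bound)
  show "integrable M (\<lambda>x. (norm (f x))\<^sup>2 + (norm (g x))\<^sup>2)"
    using assms by (intro Bochner_Integration.integrable_add square_integrable_integrable)
  have [measurable]: "f \<in> borel_measurable M" "g \<in> borel_measurable M"
    using assms by (auto simp: square_integrable_def)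
  show "(\<lambda>x. f x \<bullet> g x) \<in> borel_measurable M"
    by measurable
  have "\<bar>f x \<bullet> g x\<bar> \<le> (norm (f x))\<^sup>2 + (norm (g x))\<^sup>2" for x
    using Cauchy_Schwarz_ineq2[of "f x" "g x"] sum_squares_bound[of "norm (f x)" "norm (g x)"]
      zero_le_power2[of "norm (f x)"] zero_le_power2[of "norm (g x)"]
    by linarith
  then show "AE x in M. norm (f x \<bullet> g x) \<le> norm ((norm (f x))\<^sup>2 + (norm (g x))\<^sup>2)"
    by (intro AE_I2) (simp add: order.trans)
qed

lemma square_integrable_mult:
  fixes f g :: "'a \<Rightarrow> real"
  assumes "square_integrable M f" "square_integrable M g"
  shows "integrable M (\<lambda>x. f x * g x)"
  using square_integrable_inner[OF assms] by simp

lemma square_integrable_add: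
  assumes "square_integrable M f" "square_integrable M g"
  shows "square_integrable M (\<lambda>x. f x + g x)"
proof -
  have "(norm (f x + g x))\<^sup>2 = (norm (f x))\<^sup>2 + (2 * (f x \<bullet> g x) + (norm (g x))\<^sup>2)" for x
    by (simp add: power2_norm_eq_inner inner_add inner_commute)
  then show ?thesis
    using assms square_integrable_inner[OF assms]
    by (auto simp: square_integrable_def intro!: borel_measurable_add)
qed

lemma square_integrable_scaleR:
  "square_integrable M f \<Longrightarrow> square_integrable M (\<lambda>x. c *\<^sub>R f x)"
  by (auto simp: square_integrable_def power_mult_distrib intro!: borel_measurable_scaleR)

lemma square_integrable_diff:
  assumes "square_integrable M f" "square_integrable M g"
  shows "square_integrable M (\<lambda>x. f x - g x)"
  using square_integrable_add[OF assms(1) square_integrable_scaleR[OF assms(2), of "-1"]] by simp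

lemma square_integrable_zero: "square_integrable M (\<lambda>x. 0)"
  by (simp add: square_integrable_def)

lemma square_integrable_sum:
  "(\<And>i. i \<in> I \<Longrightarrow> square_integrable M (f i)) \<Longrightarrow> square_integrable M (\<lambda>x. \<Sum>i\<in>I. f i x)"
  by (induction I rule: infinite_finite_induct) (auto simp: square_integrable_zero square_integrable_add)

lemma square_integrable_bound:
  assumes "square_integrable M f" and g[measurable]: "g \<in> borel_measurable M"
    and le: "AE x in M. norm (g x) \<le> K * norm (f x)"
  shows "square_integrable M g"
proof -
  have "integrable M (\<lambda>x. K\<^sup>2 * (norm (f x))\<^sup>2)"
    using assms(1) by (simp add: square_integrable_def)
  then have "integrable M (\<lambda>x. (norm (g x))\<^sup>2)"
  proof (rule Bochner_Integration.integrable_bound)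
    show "AE x in M. norm ((norm (g x))\<^sup>2) \<le> norm (K\<^sup>2 * (norm (f x))\<^sup>2)"
      using le
    proof eventually_elim
      case (elim x)
      then have "(norm (g x))\<^sup>2 \<le> (K * norm (f x))\<^sup>2"
        by (intro power_mono) auto
      then show ?case
        by (simp add: power_mult_distrib)
    qed
  qed measurable
  then show ?thesis
    by (simp add: square_integrable_def)
qed

lemma (in finite_measure) square_integrable_const: "square_integrable M (\<lambda>x. c)"
  by (simp add: square_integrable_def)

lemma (in finite_measure) square_integrable_bounded:
  assumes "g \<in> borel_measurable M" "AE x in M. norm (g x) \<le> K"
  shows "square_integrable M g"
  using square_integrable_bound[OF square_integrable_const[of "1::real"] assms(1), of K] assms(2) by simp

lemma (in finite_measure) square_integrable_imp_integrable_L1: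
  assumes "square_integrable M f"
  shows "integrable M f"
proof (rule Bochner_Integration.integrable_bound)
  show "integrable M (\<lambda>x. 1 + (norm (f x))\<^sup>2)"
    using assms by (simp add: square_integrable_def)
  have "norm (f x) \<le> norm (1 + (norm (f x))\<^sup>2)" for x
    using sum_squares_bound[of 1 "norm (f x)"] by simp (smt (verit) norm_ge_zero)
  then show "AE x in M. norm (f x) \<le> norm (1 + (norm (f x))\<^sup>2)"
    by simp
qed (use assms in \<open>simp add: square_integrable_def\<close>)

lemma square_integrable_vec:
  fixes f :: "'a \<Rightarrow> real ^ 'd"
  shows "square_integrable M f \<longleftrightarrow> (\<forall>i. square_integrable M (\<lambda>x. f x $ i))"
proof
  assume *: "square_integrable M f"
  then have [measurable]: "f \<in> borel_measurable M"
    by (simp add: square_integrable_def)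
  have [measurable]: "(\<lambda>x. f x $ i) \<in> borel_measurable M" for i
    by (rule borel_measurable_continuous_on[of "\<lambda>y. y $ i"]) (auto intro!: continuous_intros)
  show "\<forall>i. square_integrable M (\<lambda>x. f x $ i)"
    by (intro allI square_integrable_bound[OF *, where K = 1]) (auto simp: component_le_norm_cart)
next
  assume *: "\<forall>i. square_integrable M (\<lambda>x. f x $ i)"
  have "f \<in> borel_measurable M"
    using * by (subst borel_measurable_euclidean_space) (auto simp: square_integrable_def Basis_vec_def inner_axis)
  moreover have "integrable M (\<lambda>x. (norm (f x))\<^sup>2)"
    unfolding power2_norm_eq_inner inner_vec_def
    using * by (auto simp: square_integrable_def power2_eq_square)
  ultimately show "square_integrable M f"
    by (simp add: square_integrable_def)
qed

section \<open>Norm inequalities in L2\<close>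

lemma L2_norm_nonneg: "0 \<le> L2_norm M f"
  by (simp add: L2_norm_def)

lemma L2_norm_power2: "(L2_norm M f)\<^sup>2 = (\<integral>x. (norm (f x))\<^sup>2 \<partial>M)"
  by (simp add: L2_norm_def)

lemma L2_norm_vec_power2:
  fixes f :: "'a \<Rightarrow> real ^ 'd"
  assumes "square_integrable M f"
  shows "(L2_norm M f)\<^sup>2 = (\<Sum>i\<in>UNIV. (L2_norm M (\<lambda>x. f x $ i))\<^sup>2)"
proof -
  have "\<forall>i. integrable M (\<lambda>x. (f x $ i)\<^sup>2)"
    using assms by (simp add: square_integrable_vec) (simp add: square_integrable_def)
  then show ?thesis
    by (simp add: L2_norm_power2 power2_norm_eq_inner[of "f _"] inner_vec_def
      flip: power2_eq_square)
qed

lemma L2_norm_cong_AE: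
  assumes "f \<in> borel_measurable M" "g \<in> borel_measurable M" "AE x in M. f x = g x"
  shows "L2_norm M f = L2_norm M g"
  unfolding L2_norm_def using assms by (intro arg_cong[where f = sqrt] integral_cong_AE) auto

lemma L2_norm_minus_commute: "L2_norm M (\<lambda>x. f x - g x) = L2_norm M (\<lambda>x. g x - f x)"
  by (simp add: L2_norm_def norm_minus_commute)

text \<open>Discriminant criterion. With \<open>a\<close> a squared norm it yields Cauchy-Schwarz;
  with \<open>a = 1 / real (Suc m)\<close> it shows that the residual of a near-minimiser is almost
  orthogonal to every admissible direction.\<close>

lemma quadratic_nonneg_imp:
  fixes a b c :: real
  assumes "\<And>t. 0 \<le> a - 2 * t * b + t\<^sup>2 * c" "0 \<le> c"
  shows "b\<^sup>2 \<le> a * c"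
proof (cases "c = 0")
  case True
  \<comment> \<open>With \<open>c = 0\<close> the hypothesis is linear in \<open>t\<close>; for
    \<open>b \<noteq> 0\<close> this choice of \<open>t\<close> would give the value
    \<open>-1\<close>.\<close>
  then have "0 \<le> a - 2 * ((a + 1) / (2 * b)) * b" using assms(1)[of "(a + 1) / (2 * b)"] by simp
  then have "b = 0"
    by (cases "b = 0") (auto simp: field_simps)
  then show ?thesis using True by simp
next
  case False
  then have "0 \<le> c * (a - 2 * (b / c) * b + (b / c)\<^sup>2 * c)"
    using assms(1)[of "b / c"] assms(2) by simp
  also have "\<dots> = a * c - b\<^sup>2"
    using False by (simp add: field_simps power2_eq_square)
  finally show ?thesis by simp
qed

lemma L2_norm_diff_scaleR:
  assumes "square_integrable M f" "square_integrable M g"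
  shows "(L2_norm M (\<lambda>x. f x - t *\<^sub>R g x))\<^sup>2
    = (L2_norm M f)\<^sup>2 - 2 * t * (\<integral>x. f x \<bullet> g x \<partial>M) + t\<^sup>2 * (L2_norm M g)\<^sup>2"
proof -
  have "(L2_norm M (\<lambda>x. f x - t *\<^sub>R g x))\<^sup>2
      = (\<integral>x. (norm (f x))\<^sup>2 - (2 * t) * (f x \<bullet> g x) + t\<^sup>2 * (norm (g x))\<^sup>2 \<partial>M)"
    unfolding L2_norm_power2 power2_norm_eq_inner
    by (intro Bochner_Integration.integral_cong) (auto simp: inner_diff inner_commute power2_eq_square algebra_simps)
  also have "\<dots> = (\<integral>x. (norm (f x))\<^sup>2 \<partial>M) - 2 * t * (\<integral>x. f x \<bullet> g x \<partial>M)
      + t\<^sup>2 * (\<integral>x. (norm (g x))\<^sup>2 \<partial>M)"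
    using square_integrable_inner[OF assms] assms
    by (simp add: square_integrable_def)
  finally show ?thesis by (simp add: L2_norm_power2)
qed

lemma L2_Cauchy_Schwarz:
  assumes "square_integrable M f" "square_integrable M g"
  shows "\<bar>\<integral>x. f x \<bullet> g x \<partial>M\<bar> \<le> L2_norm M f * L2_norm M g"
proof -
  have "(\<integral>x. f x \<bullet> g x \<partial>M)\<^sup>2 \<le> (L2_norm M f)\<^sup>2 * (L2_norm M g)\<^sup>2"
    using L2_norm_diff_scaleR[OF assms] by (intro quadratic_nonneg_imp) (metis zero_le_power2)+
  then show ?thesis
    by - (rule power2_le_imp_le; simp add: power_mult_distrib L2_norm_nonneg)
qed

lemma L2_Cauchy_Schwarz_real:
  fixes f g :: "'a \<Rightarrow> real"
  assumes "square_integrable M f" "square_integrable M g"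
  shows "\<bar>\<integral>x. f x * g x \<partial>M\<bar> \<le> L2_norm M f * L2_norm M g"
  using L2_Cauchy_Schwarz[OF assms] by (simp add: mult.commute)

lemma L2_norm_triangle:
  assumes "square_integrable M f" "square_integrable M g"
  shows "L2_norm M (\<lambda>x. f x + g x) \<le> L2_norm M f + L2_norm M g"
proof (rule power2_le_imp_le)
  have "(L2_norm M (\<lambda>x. f x + g x))\<^sup>2
      = (L2_norm M f)\<^sup>2 + 2 * (\<integral>x. f x \<bullet> g x \<partial>M) + (L2_norm M g)\<^sup>2"
    using L2_norm_diff_scaleR[OF assms, of "-1"] by simp
  also have "\<dots> \<le> (L2_norm M f + L2_norm M g)\<^sup>2"
    using L2_Cauchy_Schwarz[OF assms] by (simp add: power2_sum)
  finally show "(L2_norm M (\<lambda>x. f x + g x))\<^sup>2 \<le> (L2_norm M f + L2_norm M g)\<^sup>2" .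
qed (simp add: L2_norm_nonneg)

lemma L2_norm_triangle_diff:
  assumes "square_integrable M f" "square_integrable M g" "square_integrable M h"
  shows "L2_norm M (\<lambda>x. f x - h x) \<le> L2_norm M (\<lambda>x. f x - g x) + L2_norm M (\<lambda>x. g x - h x)"
  using L2_norm_triangle[OF square_integrable_diff[OF assms(1,2)] square_integrable_diff[OF assms(2,3)]]
  by simp

lemma L2_norm_le_add_diff:
  assumes "square_integrable M f" "square_integrable M g"
  shows "L2_norm M f \<le> L2_norm M (\<lambda>x. f x - g x) + L2_norm M g"
  using L2_norm_triangle[OF square_integrable_diff[OF assms] assms(2)] by simp

lemma L2_norm_mono:
  assumes "square_integrable M f" "square_integrable M g" "AE x in M. norm (f x) \<le> K * norm (g x)" "0 \<le> K"
  shows "L2_norm M f \<le> K * L2_norm M g"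
proof -
  have "(\<integral>x. (norm (f x))\<^sup>2 \<partial>M) \<le> (\<integral>x. K\<^sup>2 * (norm (g x))\<^sup>2 \<partial>M)"
  proof (rule integral_mono_AE)
    show "AE x in M. (norm (f x))\<^sup>2 \<le> K\<^sup>2 * (norm (g x))\<^sup>2"
      using assms(3) by eventually_elim (metis norm_ge_zero power_mono power_mult_distrib)
  qed (use assms in \<open>auto simp: square_integrable_def\<close>)
  then have "L2_norm M f \<le> sqrt (K\<^sup>2 * (\<integral>x. (norm (g x))\<^sup>2 \<partial>M))"
    by (simp add: L2_norm_def)
  then show ?thesis
    using assms(4) by (simp add: L2_norm_def real_sqrt_mult)
qed

section \<open>Strong and weak limits in L2\<close>

lemma L2_tendsto_inner:
  assumes si: "\<And>m. square_integrable M (F m)" "\<And>m. square_integrable M (G m)"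
      "square_integrable M f" "square_integrable M g"
    and F: "(\<lambda>m. L2_norm M (\<lambda>x. F m x - f x)) \<longlonglongrightarrow> 0"
    and G: "(\<lambda>m. L2_norm M (\<lambda>x. G m x - g x)) \<longlonglongrightarrow> 0"
  shows "(\<lambda>m. \<integral>x. F m x \<bullet> G m x \<partial>M) \<longlonglongrightarrow> (\<integral>x. f x \<bullet> g x \<partial>M)"
proof (rule LIM_zero_cancel, rule tendsto_rabs_zero_cancel, rule tendsto_sandwich[OF _ _ tendsto_const])
  let ?a = "\<lambda>m. L2_norm M (\<lambda>x. F m x - f x)" and ?b = "\<lambda>m. L2_norm M (\<lambda>x. G m x - g x)"
  have "(\<lambda>m. ?a m * ?b m + ?a m * L2_norm M g + L2_norm M f * ?b m) \<longlonglongrightarrow> 0 * 0 + 0 * L2_norm M g + L2_norm M f * 0"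
    by (intro tendsto_intros F G)
  then show "(\<lambda>m. ?a m * ?b m + ?a m * L2_norm M g + L2_norm M f * ?b m) \<longlonglongrightarrow> 0"
    by simp
  have "\<bar>(\<integral>x. F m x \<bullet> G m x \<partial>M) - (\<integral>x. f x \<bullet> g x \<partial>M)\<bar>
      \<le> ?a m * ?b m + ?a m * L2_norm M g + L2_norm M f * ?b m" for m
  proof -
    note d = square_integrable_diff[OF si(1)[of m] si(3)] square_integrable_diff[OF si(2)[of m] si(4)]
    note i = square_integrable_inner[OF d] square_integrable_inner[OF d(1) si(4)] square_integrable_inner[OF si(3) d(2)]
    have "(\<integral>x. F m x \<bullet> G m x \<partial>M) - (\<integral>x. f x \<bullet> g x \<partial>M) = (\<integral>x. F m x \<bullet> G m x - f x \<bullet> g x \<partial>M)"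
      by (simp add: Bochner_Integration.integral_diff square_integrable_inner si)
    also have "\<dots> = (\<integral>x. (F m x - f x) \<bullet> (G m x - g x) + (F m x - f x) \<bullet> g x + f x \<bullet> (G m x - g x) \<partial>M)"
      by (intro Bochner_Integration.integral_cong) (auto simp: inner_diff)
    also have "\<dots> = (\<integral>x. (F m x - f x) \<bullet> (G m x - g x) \<partial>M) + (\<integral>x. (F m x - f x) \<bullet> g x \<partial>M)
        + (\<integral>x. f x \<bullet> (G m x - g x) \<partial>M)"
      using i by simp
    finally show ?thesis
      using L2_Cauchy_Schwarz[OF d] L2_Cauchy_Schwarz[OF d(1) si(4)] L2_Cauchy_Schwarz[OF si(3) d(2)]
      by linarith
  qed
  then show "\<forall>\<^sub>F m in sequentially. \<bar>(\<integral>x. F m x \<bullet> G m x \<partial>M) - (\<integral>x. f x \<bullet> g x \<partial>M)\<bar>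
      \<le> ?a m * ?b m + ?a m * L2_norm M g + L2_norm M f * ?b m"
    by simp
qed simp

lemma L2_tendsto_mult:
  fixes f g :: "'a \<Rightarrow> real"
  assumes "\<And>m. square_integrable M (F m)" "\<And>m. square_integrable M (G m)"
      "square_integrable M f" "square_integrable M g"
    and "(\<lambda>m. L2_norm M (\<lambda>x. F m x - f x)) \<longlonglongrightarrow> 0"
    and "(\<lambda>m. L2_norm M (\<lambda>x. G m x - g x)) \<longlonglongrightarrow> 0"
  shows "(\<lambda>m. \<integral>x. F m x * G m x \<partial>M) \<longlonglongrightarrow> (\<integral>x. f x * g x \<partial>M)"
  using L2_tendsto_inner[OF assms] by (simp add: mult.commute)

lemma L2_tendsto_norm:
  assumes "\<And>m. square_integrable M (F m)" "square_integrable M f"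
    and "(\<lambda>m. L2_norm M (\<lambda>x. F m x - f x)) \<longlonglongrightarrow> 0"
  shows "(\<lambda>m. L2_norm M (F m)) \<longlonglongrightarrow> L2_norm M f"
  unfolding L2_norm_def power2_norm_eq_inner
  by (intro tendsto_real_sqrt L2_tendsto_inner assms)

text \<open>Boundedness allows weak convergence to be checked on a dense set: the part of
  \<open>f\<close> missed by \<open>g\<close> contributes at most \<open>B\<close> times the
  distance of \<open>f\<close> and \<open>g\<close>.\<close>

lemma L2_bounded_weak_limit:
  assumes r: "\<And>m. square_integrable M (r m)" "\<And>m. L2_norm M (r m) \<le> B" and f: "square_integrable M f"
    and approx: "\<And>e. e > 0 \<Longrightarrow> \<exists>g. square_integrable M g \<and> L2_norm M (\<lambda>x. f x - g x) < e
      \<and> (\<lambda>m. \<integral>x. r m x \<bullet> g x \<partial>M) \<longlonglongrightarrow> 0"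
  shows "(\<lambda>m. \<integral>x. r m x \<bullet> f x \<partial>M) \<longlonglongrightarrow> 0"
proof (rule LIMSEQ_I)
  fix e :: real assume e: "0 < e"
  have B: "0 \<le> B"
    using r(2)[of 0] L2_norm_nonneg[of M "r 0"] by simp
  \<comment> \<open>Chosen so that \<open>B * d \<le> e / 2\<close>; the summand 1 keeps the
    denominator positive when \<open>B = 0\<close>.\<close>
  define d where "d = e / (2 * (B + 1))"
  have "d > 0"
    using e B by (simp add: d_def)
  from approx[OF this] obtain g where g: "square_integrable M g" "L2_norm M (\<lambda>x. f x - g x) < d"
    "(\<lambda>m. \<integral>x. r m x \<bullet> g x \<partial>M) \<longlonglongrightarrow> 0" by blast
  obtain N where N: "\<And>m. m \<ge> N \<Longrightarrow> norm ((\<integral>x. r m x \<bullet> g x \<partial>M) - 0) < e / 2"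
    using LIMSEQ_D[OF g(3), of "e / 2"] e by auto
  have "norm ((\<integral>x. r m x \<bullet> f x \<partial>M) - 0) < e" if "m \<ge> N" for m
  proof -
    note d = square_integrable_diff[OF f g(1)]
    have "(\<integral>x. r m x \<bullet> f x \<partial>M) = (\<integral>x. r m x \<bullet> (f x - g x) + r m x \<bullet> g x \<partial>M)"
      by (simp add: inner_diff)
    also have "\<dots> = (\<integral>x. r m x \<bullet> (f x - g x) \<partial>M) + (\<integral>x. r m x \<bullet> g x \<partial>M)"
      by (intro Bochner_Integration.integral_add square_integrable_inner r d g)
    finally have eq: "(\<integral>x. r m x \<bullet> f x \<partial>M) = (\<integral>x. r m x \<bullet> (f x - g x) \<partial>M) + (\<integral>x. r m x \<bullet> g x \<partial>M)" .
    have "\<bar>\<integral>x. r m x \<bullet> (f x - g x) \<partial>M\<bar> \<le> L2_norm M (r m) * L2_norm M (\<lambda>x. f x - g x)"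
      by (intro L2_Cauchy_Schwarz r d)
    also have "\<dots> \<le> B * d"
      using r(2) g(2) B by (intro mult_mono L2_norm_nonneg) auto
    also have "\<dots> \<le> e / 2"
      using B e by (simp add: d_def field_simps)
    finally show ?thesis
      using N[OF that] eq by simp
  qed
  then show "\<exists>N. \<forall>m\<ge>N. norm ((\<integral>x. r m x \<bullet> f x \<partial>M) - 0) < e"
    by blast
qed

text \<open>This replaces the orthogonal projection onto the closure of \<open>V\<close>: no completeness is needed.\<close>

lemma L2_minimizing_sequence:
  assumes F: "square_integrable M F" and V: "\<And>\<phi>. \<phi> \<in> V \<Longrightarrow> square_integrable M \<phi>" "V \<noteq> {}"
    and add: "\<And>\<phi> \<psi> t. \<phi> \<in> V \<Longrightarrow> \<psi> \<in> V \<Longrightarrow> (\<lambda>x. \<phi> x + t *\<^sub>R \<psi> x) \<in> V"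
  obtains w B where "\<And>m. w m \<in> V" "\<And>m. L2_norm M (\<lambda>x. F x - w m x) \<le> B"
    "\<And>\<phi>. \<phi> \<in> V \<Longrightarrow> (\<lambda>m. \<integral>x. (F x - w m x) \<bullet> \<phi> x \<partial>M) \<longlonglongrightarrow> 0"
    "(\<lambda>m. \<integral>x. (F x - w m x) \<bullet> w m x \<partial>M) \<longlonglongrightarrow> 0"
proof -
  define E where "E \<phi> = (L2_norm M (\<lambda>x. F x - \<phi> x))\<^sup>2" for \<phi>
  define \<delta> where "\<delta> = Inf (E ` V)"
  have bdd: "bdd_below (E ` V)"
    by (rule bdd_belowI2[where m = 0]) (simp add: E_def)
  have lower: "\<delta> \<le> E \<phi>" if "\<phi> \<in> V" for \<phi>
    unfolding \<delta>_def using that bdd by (intro cInf_lower) auto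
  have "\<exists>\<phi>\<in>V. E \<phi> < \<delta> + 1 / real (Suc m)" for m
  proof -
    have "Inf (E ` V) < \<delta> + 1 / real (Suc m)"
      by (simp add: \<delta>_def)
    then show ?thesis
      using V(2) bdd by (subst (asm) cInf_less_iff) auto
  qed
  then obtain w where w: "\<And>m. w m \<in> V" "\<And>m. E (w m) < \<delta> + 1 / real (Suc m)"
    by metis
  note r = square_integrable_diff[OF F V(1)[OF w(1)]]
  \<comment> \<open>Moving from \<open>w m\<close> inside \<open>V\<close> lowers the energy by less
    than \<open>1 / real (Suc m)\<close>. The resulting quadratic in \<open>t\<close> is
    non-negative, and its discriminant bounds the pairing.\<close>
  have small: "(\<integral>x. (F x - w m x) \<bullet> \<phi> x \<partial>M)\<^sup>2 \<le> 1 / real (Suc m) * (L2_norm M \<phi>)\<^sup>2"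
    if "\<phi> \<in> V" for \<phi> m
  proof (rule quadratic_nonneg_imp)
    fix t :: real
    have "\<delta> \<le> E (\<lambda>x. w m x + t *\<^sub>R \<phi> x)"
      by (intro lower add w that)
    also have "\<dots> = E (w m) - 2 * t * (\<integral>x. (F x - w m x) \<bullet> \<phi> x \<partial>M) + t\<^sup>2 * (L2_norm M \<phi>)\<^sup>2"
      unfolding E_def using L2_norm_diff_scaleR[OF r V(1)[OF that], of m t]
      by (simp add: diff_diff_eq)
    finally show "0 \<le> 1 / real (Suc m) - 2 * t * (\<integral>x. (F x - w m x) \<bullet> \<phi> x \<partial>M) + t\<^sup>2 * (L2_norm M \<phi>)\<^sup>2"
      using w(2)[of m] by linarith
  qed simp
  have null: "(\<lambda>m. 1 / real (Suc m) * K) \<longlonglongrightarrow> 0" for K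
    using tendsto_mult[OF LIMSEQ_inverse_real_of_nat tendsto_const[of K]] by (simp add: divide_inverse)
  define B where "B = sqrt (\<delta> + 1)"
  have B: "L2_norm M (\<lambda>x. F x - w m x) \<le> B" for m
  proof -
    have "1 / real (Suc m) \<le> 1"
      by simp
    then have "E (w m) \<le> \<delta> + 1"
      using w(2)[of m] by linarith
    then show ?thesis
      unfolding B_def E_def by (rule real_le_rsqrt)
  qed
  have lim1: "(\<lambda>m. \<integral>x. (F x - w m x) \<bullet> \<phi> x \<partial>M) \<longlonglongrightarrow> 0" if "\<phi> \<in> V" for \<phi>
  proof -
    have "(\<lambda>m. (\<integral>x. (F x - w m x) \<bullet> \<phi> x \<partial>M)\<^sup>2) \<longlonglongrightarrow> 0"
      by (rule tendsto_sandwich[OF _ _ tendsto_const null[of "(L2_norm M \<phi>)\<^sup>2"]]) (use small[OF that] in auto)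
    then show ?thesis
      using tendsto_real_sqrt tendsto_rabs_zero_cancel by fastforce
  qed
  \<comment> \<open>A uniform bound on \<open>w m\<close> is what permits testing the residual
    against the varying function \<open>w m\<close> itself.\<close>
  have wB: "(L2_norm M (w m))\<^sup>2 \<le> (B + L2_norm M F)\<^sup>2" for m
    using L2_norm_le_add_diff[OF V(1)[OF w(1)[of m]] F] B[of m] L2_norm_minus_commute[of M F "w m"]
    by (intro power_mono L2_norm_nonneg) auto
  have "(\<lambda>m. (\<integral>x. (F x - w m x) \<bullet> w m x \<partial>M)\<^sup>2) \<longlonglongrightarrow> 0"
  proof (rule tendsto_sandwich[OF _ _ tendsto_const null[of "(B + L2_norm M F)\<^sup>2"]])
    have "(\<integral>x. (F x - w m x) \<bullet> w m x \<partial>M)\<^sup>2 \<le> 1 / real (Suc m) * (B + L2_norm M F)\<^sup>2" for m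
      by (rule order.trans[OF small[OF w(1)] mult_left_mono[OF wB]]) simp
    then show "\<forall>\<^sub>F m in sequentially. (\<integral>x. (F x - w m x) \<bullet> w m x \<partial>M)\<^sup>2 \<le> 1 / real (Suc m) * (B + L2_norm M F)\<^sup>2"
      by simp
  qed simp
  then have lim2: "(\<lambda>m. \<integral>x. (F x - w m x) \<bullet> w m x \<partial>M) \<longlonglongrightarrow> 0"
    using tendsto_real_sqrt tendsto_rabs_zero_cancel by fastforce
  show thesis
    using that[OF w(1) B lim1 lim2] .
qed

lemma L2_dominated_convergence:
  fixes f g :: "'a \<Rightarrow> real"
  assumes "\<And>m. F m \<in> borel_measurable M" "f \<in> borel_measurable M" "square_integrable M g"
    and lim: "AE x in M. (\<lambda>m. F m x) \<longlonglongrightarrow> f x"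
    and le: "\<And>m. AE x in M. \<bar>F m x - f x\<bar> \<le> \<bar>g x\<bar>"
  shows "(\<lambda>m. L2_norm M (\<lambda>x. F m x - f x)) \<longlonglongrightarrow> 0"
proof -
  have "(\<lambda>m. \<integral>x. (norm (F m x - f x))\<^sup>2 \<partial>M) \<longlonglongrightarrow> (\<integral>x. 0 \<partial>M)"
  proof (rule integral_dominated_convergence[where w = "\<lambda>x. (norm (g x))\<^sup>2"])
    show "integrable M (\<lambda>x. (norm (g x))\<^sup>2)"
      using assms by (simp add: square_integrable_def)
    show "AE x in M. (\<lambda>m. (norm (F m x - f x))\<^sup>2) \<longlonglongrightarrow> 0"
      using lim
    proof eventually_elim
      case (elim x)
      from tendsto_power[OF tendsto_norm[OF tendsto_diff[OF elim tendsto_const[of "f x"]]], of 2]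
      show ?case by simp
    qed
    show "AE x in M. norm ((norm (F m x - f x))\<^sup>2) \<le> (norm (g x))\<^sup>2" for m
      using le[of m] by eventually_elim (simp add: abs_le_square_iff)
  qed (use assms in auto)
  from tendsto_real_sqrt[OF this] show ?thesis
    by (simp add: L2_norm_def)
qed

lemma (in finite_measure) L2_norm_le_const:
  fixes f :: "'a \<Rightarrow> real"
  assumes "f \<in> borel_measurable M" "AE x in M. \<bar>f x\<bar> \<le> K" "0 \<le> K"
  shows "L2_norm M f \<le> K * sqrt (measure M (space M))"
  using L2_norm_mono[OF square_integrable_bounded[OF assms(1), of K] square_integrable_const[of "1::real"], of K] assms
  by (simp add: L2_norm_def)

lemma nn_integral_eq_L2_norm:
  assumes "square_integrable M f"
  shows "(\<integral>\<^sup>+x. ennreal ((norm (f x))\<^sup>2) \<partial>M) = ennreal ((L2_norm M f)\<^sup>2)"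
  unfolding L2_norm_power2 using assms
  by (intro nn_integral_eq_integral) (auto simp: square_integrable_def)

lemma L2_norm_power2_real:
  fixes f :: "'a \<Rightarrow> real"
  shows "(L2_norm M f)\<^sup>2 = (\<integral>x. f x * f x \<partial>M)"
  by (simp add: L2_norm_power2 power2_eq_square[of "f _"])

subsection \<open>Smooth functions\<close>

lemma partial_deriv_eq:
  "(f has_derivative f') (at x) \<Longrightarrow> partial_deriv i f x = f' (axis i 1)"
  by (metis frechet_derivative_at partial_deriv_def)

lemma partial_deriv_const: "partial_deriv i (\<lambda>x. c) = (\<lambda>x. 0)"
  by (rule ext, rule partial_deriv_eq) (rule has_derivative_const)

lemma partial_deriv_add:
  assumes "\<And>x. f differentiable (at x)" "\<And>x. g differentiable (at x)"
  shows "partial_deriv i (\<lambda>x. f x + g x) = (\<lambda>x. partial_deriv i f x + partial_deriv i g x)"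
proof
  fix x
  show "partial_deriv i (\<lambda>x. f x + g x) x = partial_deriv i f x + partial_deriv i g x"
    unfolding partial_deriv_def[of i f] partial_deriv_def[of i g]
    by (rule partial_deriv_eq) (use assms in \<open>auto intro!: derivative_eq_intros simp: frechet_derivative_works[symmetric]\<close>)
qed

lemma partial_deriv_mult:
  assumes "\<And>x. f differentiable (at x)" "\<And>x. g differentiable (at x)"
  shows "partial_deriv i (\<lambda>x. f x * g x) = (\<lambda>x. partial_deriv i f x * g x + f x * partial_deriv i g x)"
proof
  fix x
  have "((\<lambda>x. f x * g x) has_derivative
      (\<lambda>h. f x * frechet_derivative g (at x) h + frechet_derivative f (at x) h * g x)) (at x)"
    using assms by (intro has_derivative_mult) (simp_all add: frechet_derivative_works[symmetric])
  from partial_deriv_eq[OF this, of i]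
  show "partial_deriv i (\<lambda>x. f x * g x) x = partial_deriv i f x * g x + f x * partial_deriv i g x"
    unfolding partial_deriv_def by simp
qed

lemma C_k_differentiable: "C_k (Suc m) f \<Longrightarrow> f differentiable (at x)"
  by simp

lemma C_k_Suc_imp: "C_k (Suc m) f \<Longrightarrow> C_k m f"
proof (induction m arbitrary: f)
  case 0
  then show ?case
    by (auto intro!: continuous_at_imp_continuous_on differentiable_imp_continuous_within)
next
  case (Suc m)
  then have "C_k m (partial_deriv i f)" for i
    by (metis C_k.simps(2))
  then show ?case
    using Suc.prems by auto
qed

lemma C_k_const: "C_k m (\<lambda>x. c)"
  by (induction m arbitrary: c) (auto simp: partial_deriv_const)

lemma C_k_add: "C_k m f \<Longrightarrow> C_k m g \<Longrightarrow> C_k m (\<lambda>x. f x + g x)"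
  by (induction m arbitrary: f g) (auto simp: partial_deriv_add intro!: continuous_intros)

lemma C_k_mult: "C_k m f \<Longrightarrow> C_k m g \<Longrightarrow> C_k m (\<lambda>x. f x * g x)"
proof (induction m arbitrary: f g)
  case 0
  then show ?case
    by (auto intro!: continuous_intros)
next
  case (Suc m)
  then have d: "\<And>x. f differentiable (at x)" "\<And>x. g differentiable (at x)"
    by auto
  show ?case
    using Suc.prems(1,2)[THEN C_k_Suc_imp] Suc.prems Suc.IH
    by (auto simp: partial_deriv_mult[OF d] intro!: C_k_add differentiable_mult)
qed

lemma smooth_C_k: "smooth f \<Longrightarrow> C_k m f"
  by (simp add: smooth_def)

lemma smooth_differentiable: "smooth f \<Longrightarrow> f differentiable (at x)"
  by (rule C_k_differentiable[OF smooth_C_k])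

lemma smooth_continuous: "smooth f \<Longrightarrow> continuous_on S f"
  using smooth_C_k[of f 0] by (auto intro: continuous_on_subset)

lemma smooth_partial_deriv: "smooth f \<Longrightarrow> smooth (partial_deriv i f)"
  unfolding smooth_def by (metis C_k.simps(2))

lemma smooth_const: "smooth (\<lambda>x. c)"
  by (simp add: smooth_def C_k_const)

lemma smooth_add: "smooth f \<Longrightarrow> smooth g \<Longrightarrow> smooth (\<lambda>x. f x + g x)"
  by (simp add: smooth_def C_k_add)

lemma smooth_mult: "smooth f \<Longrightarrow> smooth g \<Longrightarrow> smooth (\<lambda>x. f x * g x)"
  by (simp add: smooth_def C_k_mult)

lemma smooth_diff: "smooth f \<Longrightarrow> smooth g \<Longrightarrow> smooth (\<lambda>x. f x - g x)"
  using smooth_add[OF _ smooth_mult[OF smooth_const[of "-1"]], of f g] by simp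

lemma smooth_prod: "(\<And>i. i \<in> I \<Longrightarrow> smooth (f i)) \<Longrightarrow> smooth (\<lambda>x. \<Prod>i\<in>I. f i x)"
  by (induction I rule: infinite_finite_induct) (auto simp: smooth_const smooth_mult)

lemma smooth_sum: "(\<And>i. i \<in> I \<Longrightarrow> smooth (f i)) \<Longrightarrow> smooth (\<lambda>x. \<Sum>i\<in>I. f i x)"
  by (induction I rule: infinite_finite_induct) (auto intro: smooth_const smooth_add)

lemma partial_deriv_smooth_mult:
  "smooth f \<Longrightarrow> smooth g \<Longrightarrow>
    partial_deriv i (\<lambda>x. f x * g x) x = partial_deriv i f x * g x + f x * partial_deriv i g x"
  by (simp add: partial_deriv_mult smooth_differentiable)

lemma partial_deriv_smooth_add:
  "smooth f \<Longrightarrow> smooth g \<Longrightarrow>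
    partial_deriv i (\<lambda>x. f x + g x) x = partial_deriv i f x + partial_deriv i g x"
  by (simp add: partial_deriv_add smooth_differentiable)

lemma partial_deriv_smooth_cmult:
  "smooth f \<Longrightarrow> partial_deriv i (\<lambda>x. c * f x) x = c * partial_deriv i f x"
  by (subst partial_deriv_smooth_mult) (auto simp: smooth_const partial_deriv_const)

lemma partial_deriv_smooth_diff:
  assumes "smooth f" "smooth g"
  shows "partial_deriv i (\<lambda>x. f x - g x) x = partial_deriv i f x - partial_deriv i g x"
proof -
  have "smooth (\<lambda>x. - 1 * g x)"
    using assms by (intro smooth_mult smooth_const)
  from partial_deriv_smooth_add[OF assms(1) this, of i x] partial_deriv_smooth_cmult[OF assms(2), of i "-1" x]
  show ?thesis
    by simp
qed

lemma partial_deriv_coordinate: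
  assumes "\<And>t. (h has_real_derivative h' t) (at t)"
  shows "partial_deriv i (\<lambda>x. h (x $ j)) = (\<lambda>x. if i = j then h' (x $ j) else 0)"
proof
  fix x
  have "((\<lambda>x. h (x $ j)) has_derivative (\<lambda>y. h' (x $ j) * y $ j)) (at x)"
    using has_derivative_compose[OF bounded_linear_imp_has_derivative[OF bounded_linear_vec_nth]
        assms[unfolded has_field_derivative_def, of "x $ j"]]
    by simp
  from partial_deriv_eq[OF this, of i]
  show "partial_deriv i (\<lambda>x. h (x $ j)) x = (if i = j then h' (x $ j) else 0)"
    by (simp add: axis_def)
qed

text \<open>Giving all derivatives as one family \<open>D\<close> reduces smoothness to an induction
  on the order, carried out for every \<open>D l\<close> at once. Each use below only has to guess a
  closed formula for the derivatives.\<close>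

lemma smooth_coordinate:
  assumes D: "\<And>l t. (D l has_real_derivative D (Suc l) t) (at t)"
  shows "smooth (\<lambda>x. D 0 (x $ j))"
proof -
  have "C_k m (\<lambda>x. D l (x $ j))" for l m
  proof (induction m arbitrary: l)
    case 0
    have "continuous_on UNIV (D l)"
      by (intro continuous_at_imp_continuous_on ballI DERIV_isCont[OF D])
    then have "continuous_on UNIV (\<lambda>x. D l (x $ j))"
      by (rule continuous_on_compose2) (auto intro!: continuous_intros)
    then show ?case by simp
  next
    case (Suc m)
    have "(\<lambda>x. D l (x $ j)) differentiable (at x)" for x
    proof -
      have "(D l has_derivative (*) (D (Suc l) (x $ j))) (at (x $ j))"
        using D by (simp add: has_field_derivative_def)
      from has_derivative_compose[OF bounded_linear_imp_has_derivative[OF bounded_linear_vec_nth] this]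
      show ?thesis
        unfolding differentiable_def by blast
    qed
    moreover have "C_k m (partial_deriv i (\<lambda>x. D l (x $ j)))" for i
      unfolding partial_deriv_coordinate[of "D l", OF D]
      using Suc C_k_const by (cases "i = j") auto
    ultimately show ?case by simp
  qed
  then show ?thesis
    by (simp add: smooth_def)
qed

section \<open>Trigonometric and coordinate functions\<close>

lemma smooth_cos: "smooth (\<lambda>x. cos (a * x $ j))"
proof -
  \<comment> \<open>Each derivative is a shift by a quarter period, so one formula covers all
    orders.\<close>
  define D where "D l t = a ^ l * cos (a * t + real l * (pi / 2))" for l t
  have "D (Suc l) t = a ^ Suc l * - sin (a * t + real l * (pi / 2))" for l t
    using cos_add[of "a * t + real l * (pi / 2)" "pi / 2"] by (simp add: D_def field_simps)
  then have "(D l has_real_derivative D (Suc l) t) (at t)" for l t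
    unfolding D_def by (auto intro!: derivative_eq_intros)
  from smooth_coordinate[of D, OF this] show ?thesis
    by (simp add: D_def)
qed

lemma smooth_sin: "smooth (\<lambda>x. sin (a * x $ j))"
proof -
  define D where "D l t = a ^ l * sin (a * t + real l * (pi / 2))" for l t
  have "D (Suc l) t = a ^ Suc l * cos (a * t + real l * (pi / 2))" for l t
    using sin_add[of "a * t + real l * (pi / 2)" "pi / 2"] by (simp add: D_def field_simps)
  then have "(D l has_real_derivative D (Suc l) t) (at t)" for l t
    unfolding D_def by (auto intro!: derivative_eq_intros)
  from smooth_coordinate[of D, OF this] show ?thesis
    by (simp add: D_def)
qed

lemma partial_deriv_cos:
  "partial_deriv i (\<lambda>x. cos (a * x $ j)) = (\<lambda>x. if i = j then - a * sin (a * x $ j) else 0)"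
  by (rule partial_deriv_coordinate) (auto intro!: derivative_eq_intros)

lemma partial_deriv_sin:
  "partial_deriv i (\<lambda>x. sin (a * x $ j)) = (\<lambda>x. if i = j then a * cos (a * x $ j) else 0)"
  by (rule partial_deriv_coordinate) (auto intro!: derivative_eq_intros)

lemma smooth_component: "smooth (\<lambda>x. x $ j)"
proof -
  define D :: "nat \<Rightarrow> real \<Rightarrow> real" where "D l t = (if l = 0 then t else if l = 1 then 1 else 0)" for l t
  have "(D l has_real_derivative D (Suc l) t) (at t)" for l t
    unfolding D_def by (cases "l = 0"; cases "l = 1") (auto intro!: derivative_eq_intros)
  from smooth_coordinate[of D, OF this] show ?thesis
    by (simp add: D_def)
qed

lemma partial_deriv_component: "partial_deriv i (\<lambda>x. x $ j) = (\<lambda>x. if i = j then 1 else 0)"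
  by (rule partial_deriv_coordinate[where h = "\<lambda>t. t"]) (auto intro!: derivative_eq_intros)

subsection \<open>Smooth cut-off functions of the cube\<close>

text \<open>The polynomial factor in \<open>1 / x\<close> makes this family of functions, flat at 0,
  closed under differentiation; \<open>p = 1\<close> is the classical smooth function
  \<open>exp (- (1 / x))\<close>.\<close>

definition exp_inv :: "real poly \<Rightarrow> real \<Rightarrow> real" where
  "exp_inv p x = (if 0 < x then poly p (1 / x) * exp (- (1 / x)) else 0)"

lemma exp_inv_tendsto_0: "(exp_inv p \<longlongrightarrow> 0) (at 0)"
proof -
  have "((\<lambda>y. poly p y * exp (- y)) \<longlongrightarrow> 0) at_top"
  proof (induction p rule: pCons_induct)
    case (pCons a p)
    have *: "((\<lambda>y::real. y ^ Suc k * exp (- y)) \<longlongrightarrow> 0) at_top" for k :: nat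
      using tendsto_power_div_exp_0[of "Suc k"] by (simp add: exp_minus divide_inverse)
    have **: "((\<lambda>y. coeff p k * (y ^ Suc k * exp (- y))) \<longlongrightarrow> 0) at_top" for k :: nat
      using tendsto_mult[OF tendsto_const *, of "coeff p k" k] by simp
    have "((\<lambda>y. a * exp (- y) + (\<Sum>k\<le>degree p. coeff p k * (y ^ Suc k * exp (- y)))) \<longlongrightarrow> a * 0 + (\<Sum>k\<le>degree p. 0)) at_top"
      by (intro tendsto_intros **) (auto intro!: filterlim_compose[OF exp_at_bot filterlim_uminus_at_bot_at_top])
    moreover have "poly (pCons a p) y * exp (- y) = a * exp (- y) + (\<Sum>k\<le>degree p. coeff p k * (y ^ Suc k * exp (- y)))" for y
      unfolding poly_pCons poly_altdef[of p] by (simp add: sum_distrib_left sum_distrib_right algebra_simps)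
    ultimately show ?case
      by simp
  qed simp
  then have "((\<lambda>x. poly p (1 / x) * exp (- (1 / x))) \<longlongrightarrow> 0) (at_right 0)"
    by (rule filterlim_compose) (simp add: filterlim_inverse_at_top_right[unfolded inverse_eq_divide])
  then have "(exp_inv p \<longlongrightarrow> 0) (at_right 0)"
    by (rule Lim_transform_eventually) (auto simp: exp_inv_def eventually_at_right_field intro!: exI[of _ 1])
  moreover have "(exp_inv p \<longlongrightarrow> 0) (at_left 0)"
    by (rule Lim_transform_eventually[OF tendsto_const]) (auto simp: exp_inv_def eventually_at_left_field intro!: exI[of _ "-1"])
  ultimately show ?thesis
    by (simp add: filterlim_split_at)
qed

text \<open>With \<open>y = 1 / x\<close> the product and chain rules give the factor
  \<open>(p - pderiv p) y * y^2\<close>; multiplication by \<open>[:0, 0, 1:]\<close> is the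
  \<open>y^2\<close> that comes from differentiating \<open>1 / x\<close>.\<close>

lemma exp_inv_deriv: "(exp_inv p has_real_derivative exp_inv ((p - pderiv p) * [:0, 0, 1:]) x) (at x)"
proof -
  consider "x < 0" | "0 < x" | "x = 0" by linarith
  then show ?thesis
  proof cases
    case 1
    then have "((\<lambda>x. 0) has_real_derivative exp_inv ((p - pderiv p) * [:0, 0, 1:]) x) (at x)"
      by (auto simp: exp_inv_def)
    then show ?thesis
      by (rule has_field_derivative_transform_within_open[of _ _ _ "{..<0}"]) (use 1 in \<open>auto simp: exp_inv_def\<close>)
  next
    case 2
    have "((\<lambda>x. poly p (1 / x) * exp (- (1 / x))) has_real_derivative exp_inv ((p - pderiv p) * [:0, 0, 1:]) x) (at x)"
      using 2 by (auto intro!: derivative_eq_intros DERIV_chain2[of "poly p"] poly_DERIV simp: exp_inv_def field_simps power2_eq_square)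
    then show ?thesis
      by (rule has_field_derivative_transform_within_open[of _ _ _ "{0<..}"]) (use 2 in \<open>auto simp: exp_inv_def\<close>)
  next
    case 3
    \<comment> \<open>The difference quotient at 0 belongs to the same family, with the polynomial
      multiplied by its variable.\<close>
    have "((\<lambda>y. exp_inv p y / y) \<longlongrightarrow> 0) (at 0)"
      by (rule Lim_transform_eventually[OF exp_inv_tendsto_0[of "p * [:0, 1:]"]]) (auto simp: exp_inv_def eventually_at_filter)
    then show ?thesis
      using 3 by (simp add: has_field_derivative_iff exp_inv_def)
  qed
qed

text \<open>It only tends to 1 at infinity, so the cut-offs built from it converge to 1 pointwise in
  the open cube instead of being equal to 1 on large compact sets.\<close>

definition smooth_step :: "real \<Rightarrow> real" where
  "smooth_step = exp_inv 1"

definition smooth_step_deriv :: "real \<Rightarrow> real" where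
  "smooth_step_deriv = exp_inv [:0, 0, 1:]"

lemma smooth_step_has_deriv: "(smooth_step has_real_derivative smooth_step_deriv x) (at x)"
  using exp_inv_deriv[of 1 x] by (simp add: smooth_step_def smooth_step_deriv_def)

lemma smooth_step_eq: "smooth_step x = (if 0 < x then exp (- (1 / x)) else 0)"
  by (simp add: smooth_step_def exp_inv_def)

lemma smooth_step_deriv_eq: "smooth_step_deriv x = (if 0 < x then exp (- (1 / x)) / x\<^sup>2 else 0)"
  by (simp add: smooth_step_deriv_def exp_inv_def power2_eq_square)

lemma smooth_step_bounds: "0 \<le> smooth_step x" "smooth_step x \<le> 1"
  by (auto simp: smooth_step_eq)

text \<open>For \<open>x = m * t - 1\<close> the factor \<open>x + 1\<close> is the scaled distance
  \<open>m * t\<close> to a face. With \<open>y = 1 / x\<close> the product is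
  \<open>(y + y^2) * exp (- y)\<close>, and the exponential series bounds it; the 3 is a crude
  value.\<close>

lemma smooth_step_deriv_bounds: "0 \<le> smooth_step_deriv x" "\<bar>x + 1\<bar> * smooth_step_deriv x \<le> 3"
proof -
  show "0 \<le> smooth_step_deriv x"
    by (simp add: smooth_step_deriv_eq)
  show "\<bar>x + 1\<bar> * smooth_step_deriv x \<le> 3"
  proof (cases "0 < x")
    case True
    define y where "y = 1 / x"
    have y: "0 < y"
      using True by (simp add: y_def)
    have "1 + y + y\<^sup>2 / 2 \<le> exp y"
      using exp_lower_Taylor_quadratic[of y] y by simp
    then have "y + y\<^sup>2 \<le> 3 * exp y"
      using y zero_le_power2[of y] by linarith
    then have "(y + y\<^sup>2) * exp (- y) \<le> 3 * exp y * exp (- y)"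
      by (intro mult_right_mono) auto
    then have "(y + y\<^sup>2) * exp (- y) \<le> 3"
      by (simp add: mult.assoc flip: exp_add)
    moreover have "\<bar>x + 1\<bar> * smooth_step_deriv x = (y + y\<^sup>2) * exp (- y)"
      using True by (simp add: smooth_step_deriv_eq y_def power2_eq_square field_simps)
    ultimately show ?thesis by simp
  qed (simp add: smooth_step_deriv_eq)
qed

lemma smooth_step_deriv_tendsto: "((\<lambda>x. (x + 1) * smooth_step_deriv x) \<longlongrightarrow> 0) at_top"
proof (rule tendsto_sandwich[OF _ _ tendsto_const])
  show "((\<lambda>x::real. 1 / x + (1 / x) * (1 / x)) \<longlongrightarrow> 0) at_top"
    by real_asymp
  have "(x + 1) * smooth_step_deriv x \<le> 1 / x + (1 / x) * (1 / x)" if "0 < x" for x :: real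
  proof -
    have "(x + 1) * exp (- (1 / x)) / x\<^sup>2 \<le> (x + 1) * 1 / x\<^sup>2"
      using that by (intro divide_right_mono mult_left_mono) auto
    then show ?thesis
      using that by (simp add: smooth_step_deriv_eq add_divide_distrib power2_eq_square)
  qed
  then show "\<forall>\<^sub>F x in at_top. (x + 1) * smooth_step_deriv x \<le> 1 / x + (1 / x) * (1 / x)"
    by (auto intro: eventually_mono[OF eventually_gt_at_top[of 0]])
  show "\<forall>\<^sub>F x in at_top. 0 \<le> (x + 1) * smooth_step_deriv x"
    using smooth_step_deriv_bounds(1) by (auto intro: eventually_mono[OF eventually_gt_at_top[of 0]])
qed

lemma smooth_step_tendsto: "(smooth_step \<longlongrightarrow> 1) at_top"
proof (rule Lim_transform_eventually)
  show "((\<lambda>x::real. exp (- (1 / x))) \<longlongrightarrow> 1) at_top"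
    by real_asymp
  show "\<forall>\<^sub>F x in at_top. exp (- (1 / x)) = smooth_step x"
    by (auto intro: eventually_mono[OF eventually_gt_at_top[of 0]] simp: smooth_step_eq)
qed

lemma smooth_smooth_step: "smooth (\<lambda>x. smooth_step (a * x $ j + b))"
proof -
  \<comment> \<open>Iterates the recursion of \<open>exp_inv_deriv\<close> on the polynomial factor;
    the powers of \<open>a\<close> in \<open>D\<close> come from the chain rule.\<close>
  define P where "P l = ((\<lambda>p. (p - pderiv p) * [:0, 0, 1:]) ^^ l) (1 :: real poly)" for l
  define D where "D l t = a ^ l * exp_inv (P l) (a * t + b)" for l t
  have "((\<lambda>t. exp_inv (P l) (a * t + b)) has_real_derivative a * exp_inv (P (Suc l)) (a * t + b)) (at t)" for l t
  proof -
    have "((\<lambda>t. a * t + b) has_real_derivative a) (at t)"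
      by (auto intro!: derivative_eq_intros)
    from DERIV_chain2[OF exp_inv_deriv this]
    show ?thesis
      by (simp add: P_def mult.commute)
  qed
  from DERIV_cmult[OF this]
  have "(D l has_real_derivative a ^ l * (a * exp_inv (P (Suc l)) (a * t + b))) (at t)" for l t
    unfolding D_def .
  then have "(D l has_real_derivative D (Suc l) t) (at t)" for l t
    unfolding D_def[of "Suc l"] by (simp only: power_Suc2 mult.assoc)
  from smooth_coordinate[of D, OF this] show ?thesis
    by (simp add: D_def P_def smooth_step_def)
qed

lemma partial_deriv_smooth_step:
  "partial_deriv i (\<lambda>x. smooth_step (a * x $ j + b)) =
    (\<lambda>x. if i = j then a * smooth_step_deriv (a * x $ j + b) else 0)"
proof (rule partial_deriv_coordinate)
  fix t
  have "((\<lambda>t. a * t + b) has_real_derivative a) (at t)"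
    by (auto intro!: derivative_eq_intros)
  from DERIV_chain2[OF smooth_step_has_deriv this]
  show "((\<lambda>t. smooth_step (a * t + b)) has_real_derivative a * smooth_step_deriv (a * t + b)) (at t)"
    by (simp add: mult.commute)
qed

text \<open>The two arguments are \<open>m * x_j - 1\<close> and \<open>m * (1 - x_j) - 1\<close>,
  so the product vanishes within distance \<open>1 / m\<close> of either face. They are written as
  \<open>a * x + b\<close> to match \<open>smooth_smooth_step\<close>.\<close>

definition cutoff1 :: "nat \<Rightarrow> 'd \<Rightarrow> real ^ 'd \<Rightarrow> real" where
  "cutoff1 m j x = smooth_step (real m * x $ j + - 1) * smooth_step (- real m * x $ j + (real m - 1))"

definition cutoff :: "nat \<Rightarrow> real ^ 'd \<Rightarrow> real" where
  "cutoff m x = (\<Prod>j\<in>UNIV. cutoff1 m j x)"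

lemma smooth_cutoff1: "smooth (cutoff1 m j)"
  unfolding cutoff1_def[abs_def] by (intro smooth_mult smooth_smooth_step)

lemma smooth_cutoff: "smooth (cutoff m)"
  unfolding cutoff_def[abs_def] by (intro smooth_prod smooth_cutoff1)

lemma cutoff1_bounds: "0 \<le> cutoff1 m j x" "cutoff1 m j x \<le> 1"
  unfolding cutoff1_def using smooth_step_bounds by (auto intro: mult_le_one)

lemma prod_cutoff1_bounds: "0 \<le> (\<Prod>j\<in>J. cutoff1 m j x)" "(\<Prod>j\<in>J. cutoff1 m j x) \<le> 1"
  by (auto intro!: prod_nonneg prod_le_1 simp: cutoff1_bounds)

lemma cutoff_bounds: "0 \<le> cutoff m x" "cutoff m x \<le> 1"
  unfolding cutoff_def by (rule prod_cutoff1_bounds)+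

lemma interior_Omega: "x \<in> interior Omega \<longleftrightarrow> (\<forall>j. 0 < x $ j \<and> x $ j < 1)"
  by (simp add: mem_box_cart)

lemma filterlim_affine_at_top:
  "0 < a \<Longrightarrow> filterlim (\<lambda>m. real m * a + b) at_top sequentially"
  by real_asymp

lemma cutoff1_tendsto:
  assumes "0 < x $ j" "x $ j < 1"
  shows "(\<lambda>m. cutoff1 m j x) \<longlonglongrightarrow> 1"
proof -
  have "(\<lambda>m. smooth_step (real m * x $ j + - 1) * smooth_step (real m * (1 - x $ j) + -1)) \<longlonglongrightarrow> 1 * 1"
    using assms by (intro tendsto_intros filterlim_compose[OF smooth_step_tendsto] filterlim_affine_at_top) auto
  then show ?thesis
    by (simp add: cutoff1_def algebra_simps)
qed

lemma cutoff_tendsto: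
  assumes "x \<in> interior Omega"
  shows "(\<lambda>m. cutoff m x) \<longlonglongrightarrow> 1"
proof -
  have "(\<lambda>m. \<Prod>j\<in>UNIV. cutoff1 m j x) \<longlonglongrightarrow> (\<Prod>j\<in>(UNIV::'a set). 1)"
    using assms unfolding interior_Omega by (intro tendsto_prod cutoff1_tendsto) auto
  then show ?thesis
    by (simp add: cutoff_def)
qed

text \<open>The margin \<open>1 / (m + 2)\<close> is smaller than the width \<open>1 / m\<close> of
  the layer in which the cut-off vanishes, and it keeps the box inside the open cube for every
  \<open>m\<close>. For \<open>m = 0\<close> the cut-off is identically 0.\<close>

lemma cutoff_eq_0:
  assumes "x \<notin> cbox (\<chi> j. 1 / (real m + 2)) (\<chi> j. 1 - 1 / (real m + 2))"
  shows "cutoff m x = 0"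
proof -
  obtain j where j: "x $ j < 1 / (real m + 2) \<or> 1 - 1 / (real m + 2) < x $ j"
    using assms by (force simp: mem_box_cart not_le)
  have "cutoff1 m j x = 0"
  proof (cases "m = 0")
    case False
    have "1 / (real m + 2) \<le> 1 / real m"
      using False by (simp add: field_simps)
    then have "x $ j < 1 / real m \<or> 1 - 1 / real m < x $ j"
      using j by linarith
    then have "real m * x $ j + - 1 \<le> 0 \<or> - real m * x $ j + (real m - 1) \<le> 0"
      using False by (auto simp: field_simps)
    then show ?thesis
      by (auto simp: cutoff1_def smooth_step_eq)
  qed (simp add: cutoff1_def smooth_step_eq)
  then show ?thesis
    by (auto simp: cutoff_def)
qed

lemma test_function_mult_cutoff:
  fixes f :: "real ^ 'd \<Rightarrow> real"
  assumes "smooth f"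
  shows "test_function (\<lambda>x. f x * cutoff m x)"
  unfolding test_function_def
proof (intro conjI exI allI impI)
  let ?K = "cbox (\<chi> j. 1 / (real m + 2)) (\<chi> j. 1 - 1 / (real m + 2)) :: (real ^ 'd) set"
  show "smooth (\<lambda>x. f x * cutoff m x)"
    by (intro smooth_mult assms smooth_cutoff)
  show "compact ?K" by simp
  show "?K \<subseteq> interior Omega"
  proof
    fix x assume "x \<in> ?K"
    then have "1 / (real m + 2) \<le> x $ j \<and> x $ j \<le> 1 - 1 / (real m + 2)" for j
      by (simp add: mem_box_cart(2))
    moreover have "0 < 1 / (real m + 2)"
      by simp
    ultimately show "x \<in> interior Omega"
      unfolding interior_Omega by (meson diff_less_eq le_less_trans less_add_same_cancel1 less_le_trans)
  qed
  show "f x * cutoff m x = 0" if "x \<notin> ?K" for x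
    using cutoff_eq_0[OF that] by simp
qed

lemma partial_deriv_cutoff:
  "partial_deriv i (cutoff m) x = partial_deriv i (cutoff1 m i) x * (\<Prod>j\<in>UNIV - {i}. cutoff1 m j x)"
proof -
  have *: "partial_deriv i (\<lambda>x. \<Prod>j\<in>J. cutoff1 m j x) x = 0" if "i \<notin> J" "finite J" for J
    using that(2,1)
  proof (induction J)
    case (insert j J)
    have "partial_deriv i (cutoff1 m j) x = 0"
      using insert.prems
      unfolding cutoff1_def[abs_def] partial_deriv_smooth_mult[OF smooth_smooth_step smooth_smooth_step]
        partial_deriv_smooth_step
      by auto
    then show ?case
      using insert by (simp add: partial_deriv_smooth_mult smooth_prod smooth_cutoff1)
  qed (simp add: partial_deriv_const)
  have eq: "cutoff m = (\<lambda>x. cutoff1 m i x * (\<Prod>j\<in>UNIV - {i}. cutoff1 m j x))"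
    by (rule ext) (simp add: cutoff_def prod.remove[of UNIV i])
  show ?thesis
    unfolding eq by (subst partial_deriv_smooth_mult) (auto simp: smooth_prod smooth_cutoff1 *)
qed

lemma partial_deriv_cutoff1:
  "partial_deriv i (cutoff1 m i) x =
    real m * smooth_step_deriv (real m * x $ i - 1) * smooth_step (- real m * x $ i + (real m - 1))
    - real m * smooth_step (real m * x $ i - 1) * smooth_step_deriv (real m * (1 - x $ i) - 1)"
  unfolding cutoff1_def[abs_def] partial_deriv_smooth_mult[OF smooth_smooth_step smooth_smooth_step]
    partial_deriv_smooth_step
  by (simp add: algebra_simps)

text \<open>The derivative of the cut-off blows up near the faces, but only like the inverse distance.\<close>

lemma distance_times_partial_deriv_cutoff:
  assumes x: "0 \<le> x $ i" "x $ i \<le> 1" and w: "\<bar>w\<bar> \<le> K * x $ i" "\<bar>w\<bar> \<le> K * (1 - x $ i)"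
  shows "\<bar>w * partial_deriv i (cutoff m) x\<bar>
    \<le> K * ((real m * x $ i) * smooth_step_deriv (real m * x $ i - 1)
        + (real m * (1 - x $ i)) * smooth_step_deriv (real m * (1 - x $ i) - 1))"
proof -
  let ?s = "smooth_step_deriv (real m * x $ i - 1)" and ?t = "smooth_step_deriv (real m * (1 - x $ i) - 1)"
  note b = smooth_step_bounds smooth_step_deriv_bounds(1)
  have "\<bar>partial_deriv i (cutoff1 m i) x\<bar> \<le> real m * ?s * 1 + real m * 1 * ?t"
    unfolding partial_deriv_cutoff1
    by (rule abs_triangle_ineq4[THEN order.trans])
      (auto simp: abs_mult b intro!: add_mono mult_mono mult_nonneg_nonneg mult_left_le)
  then have "\<bar>partial_deriv i (cutoff m) x\<bar> \<le> (real m * ?s * 1 + real m * 1 * ?t) * 1"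
    unfolding partial_deriv_cutoff abs_mult
    using prod_cutoff1_bounds[of m x "UNIV - {i}"] b by (intro mult_mono) auto
  then have "\<bar>w * partial_deriv i (cutoff m) x\<bar> \<le> \<bar>w\<bar> * (real m * ?s + real m * ?t)"
    unfolding abs_mult by (intro mult_left_mono) auto
  also have "\<dots> = \<bar>w\<bar> * (real m * ?s) + \<bar>w\<bar> * (real m * ?t)"
    by (simp add: algebra_simps)
  also have "\<dots> \<le> (K * x $ i) * (real m * ?s) + (K * (1 - x $ i)) * (real m * ?t)"
    using w b by (intro add_mono mult_right_mono) auto
  finally show ?thesis
    by (simp add: algebra_simps)
qed

text \<open>Supplies, uniformly in \<open>m\<close>, the dominating constant for
  \<open>weak_integration_by_parts\<close>; each of the two faces contributes the 3 of
  \<open>smooth_step_deriv_bounds\<close>.\<close>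

lemma distance_times_partial_deriv_cutoff_bound:
  assumes "0 \<le> x $ i" "x $ i \<le> 1" "\<bar>w\<bar> \<le> K * x $ i" "\<bar>w\<bar> \<le> K * (1 - x $ i)"
  shows "\<bar>w * partial_deriv i (cutoff m) x\<bar> \<le> 6 * K"
proof -
  have "0 \<le> K"
  proof -
    have "0 \<le> K * x $ i + K * (1 - x $ i)"
      using assms(3,4) by linarith
    then show ?thesis
      by (simp add: algebra_simps)
  qed
  have *: "(real m * t) * smooth_step_deriv (real m * t - 1) \<le> 3" if "0 \<le> t" for t
    using smooth_step_deriv_bounds(2)[of "real m * t - 1"] that by simp
  have "K * ((real m * x $ i) * smooth_step_deriv (real m * x $ i - 1)
        + (real m * (1 - x $ i)) * smooth_step_deriv (real m * (1 - x $ i) - 1)) \<le> K * (3 + 3)"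
    using assms \<open>0 \<le> K\<close> by (intro mult_left_mono add_mono *) auto
  with distance_times_partial_deriv_cutoff[OF assms, of m] show ?thesis
    by simp
qed

text \<open>The pointwise counterpart for dominated convergence: at fixed positive distance
  \<open>t\<close> from a face the scaled distance \<open>m * t\<close> tends to infinity, where
  \<open>smooth_step_deriv_tendsto\<close> applies.\<close>

lemma distance_times_partial_deriv_cutoff_tendsto:
  assumes x: "0 < x $ i" "x $ i < 1" and w: "\<bar>w\<bar> \<le> K * x $ i" "\<bar>w\<bar> \<le> K * (1 - x $ i)"
  shows "(\<lambda>m. w * partial_deriv i (cutoff m) x) \<longlonglongrightarrow> 0"
proof (rule tendsto_rabs_zero_cancel, rule tendsto_sandwich[OF _ _ tendsto_const])
  have *: "(\<lambda>m. (real m * t) * smooth_step_deriv (real m * t - 1)) \<longlonglongrightarrow> 0" if "0 < t" for t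
    using filterlim_compose[OF smooth_step_deriv_tendsto filterlim_affine_at_top[OF that, of "-1"]]
    by simp
  have "(\<lambda>m. K * ((real m * x $ i) * smooth_step_deriv (real m * x $ i - 1)
        + (real m * (1 - x $ i)) * smooth_step_deriv (real m * (1 - x $ i) - 1))) \<longlonglongrightarrow> K * (0 + 0)"
    using x by (intro tendsto_mult tendsto_const tendsto_add *) auto
  then show "(\<lambda>m. K * ((real m * x $ i) * smooth_step_deriv (real m * x $ i - 1)
        + (real m * (1 - x $ i)) * smooth_step_deriv (real m * (1 - x $ i) - 1))) \<longlonglongrightarrow> 0"
    by simp
  show "\<forall>\<^sub>F m in sequentially. \<bar>w * partial_deriv i (cutoff m) x\<bar>
      \<le> K * ((real m * x $ i) * smooth_step_deriv (real m * x $ i - 1)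
        + (real m * (1 - x $ i)) * smooth_step_deriv (real m * (1 - x $ i) - 1))"
    using x by (intro always_eventually allI distance_times_partial_deriv_cutoff w) auto
qed simp

subsection \<open>Product structure of the cube\<close>

abbreviation unit_measure :: "real measure" where
  "unit_measure \<equiv> restrict_space lborel {0..1}"

abbreviation coord_measure :: "'d set \<Rightarrow> ('d \<Rightarrow> real) measure" where
  "coord_measure J \<equiv> PiM J (\<lambda>_. unit_measure)"

lemma emeasure_unit_measure: "A \<subseteq> {0..1} \<Longrightarrow> emeasure unit_measure A = emeasure lborel A"
  by (intro emeasure_restrict_space) auto

lemma finite_measure_unit_measure: "finite_measure unit_measure"
  by (intro finite_measureI) (simp add: space_restrict_space emeasure_unit_measure)

interpretation unit: product_sigma_finite "\<lambda>_::'d::finite. unit_measure"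
  by (simp add: product_sigma_finite_def finite_measure.axioms(1)[OF finite_measure_unit_measure])

lemma space_coord_measure: "space (coord_measure J) = (\<Pi>\<^sub>E j\<in>J. {0..1})"
  by (simp add: space_PiM space_restrict_space)

lemma emeasure_space_coord_measure:
  "emeasure (coord_measure (J :: 'd::finite set)) (space (coord_measure J)) = 1"
  unfolding space_coord_measure
  by (subst unit.emeasure_PiM) (auto simp: emeasure_unit_measure sets_restrict_space)

lemma finite_measure_coord_measure: "finite_measure (coord_measure (J :: 'd::finite set))"
  by (intro finite_measureI) (simp add: emeasure_space_coord_measure)

lemma measurable_component_unit:
  "j \<in> J \<Longrightarrow> (\<lambda>y. y j) \<in> borel_measurable (coord_measure J)"
proof -
  assume j: "j \<in> J"
  have "(\<lambda>x::real. x) \<in> borel_measurable unit_measure"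
    by (intro measurable_restrict_space1) simp
  from measurable_compose[OF measurable_component_singleton[OF j, of "\<lambda>_. unit_measure"] this]
  show ?thesis by simp
qed

lemma borel_measurable_vec:
  fixes f :: "'a \<Rightarrow> real ^ 'd"
  shows "(\<And>i. (\<lambda>x. f x $ i) \<in> borel_measurable M) \<Longrightarrow> f \<in> borel_measurable M"
  by (subst borel_measurable_euclidean_space) (auto simp: Basis_vec_def inner_axis)

lemma measurable_vec_coord: "(\<lambda>y. \<chi> j. y j) \<in> borel_measurable (coord_measure (UNIV :: 'd::finite set))"
  by (rule borel_measurable_vec) (simp add: measurable_component_unit)

lemma measurable_face_coord:
  "(\<lambda>y. \<chi> j. if j = i then s else y j) \<in> borel_measurable (coord_measure (UNIV - {i :: 'd::finite}))"
proof (rule borel_measurable_vec)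
  show "(\<lambda>y. (\<chi> j. if j = i then s else y j) $ k) \<in> borel_measurable (coord_measure (UNIV - {i}))" for k
    by (cases "k = i") (simp_all add: measurable_component_unit)
qed

text \<open>Closed boxes generate the Borel sets and are stable under intersection, so it suffices
  to compare the measures on boxes. There both sides are the product of the edge lengths after
  clipping to the unit cube.\<close>

lemma distr_coord_measure:
  "distr (coord_measure (UNIV :: 'd::finite set)) borel (\<lambda>y. \<chi> j. y j)
    = density lborel (indicator (Omega :: (real ^ 'd) set))"
proof (rule measure_eqI_generator_eq)
  let ?E = "range (\<lambda>(a, b). {a..b::real ^ 'd})"
  show "Int_stable ?E"
    by (auto simp: Int_stable_def interval_cbox_cart Int_interval_cart)
  show "?E \<subseteq> Pow UNIV" by simp
  show "sets (distr (coord_measure UNIV) borel (\<lambda>y. \<chi> j. y j)) = sigma_sets UNIV ?E"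
    "sets (density lborel (indicator (Omega :: (real ^ 'd) set))) = sigma_sets UNIV ?E"
    by (simp_all add: borel_eq_atLeastAtMost)
  show "range (\<lambda>n. {- (\<Sum>i\<in>Basis. real n *\<^sub>R i) .. (\<Sum>i\<in>Basis. real n *\<^sub>R i)}) \<subseteq> ?E"
    by auto
  show "(\<Union>n. {- (\<Sum>i\<in>Basis. real n *\<^sub>R i) .. (\<Sum>i\<in>Basis. real n *\<^sub>R i)}) = (UNIV :: (real ^ 'd) set)"
  proof -
    have "\<exists>n. x \<in> {- (\<Sum>i\<in>Basis. real n *\<^sub>R i) .. (\<Sum>i\<in>Basis. real n *\<^sub>R i)}" for x :: "real ^ 'd"
    proof -
      obtain n where n: "norm x \<le> real n"
        using real_arch_simple by blast
      have "- real n \<le> x \<bullet> b \<and> x \<bullet> b \<le> real n" if "b \<in> Basis" for b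
        using Basis_le_norm[OF that, of x] n by linarith
      then show ?thesis
        by (intro exI[of _ n]) (auto simp: eucl_le[where 'a = "real ^ 'd"])
    qed
    then show ?thesis by blast
  qed
  show "emeasure (distr (coord_measure UNIV) borel (\<lambda>y. \<chi> j. y j))
      {- (\<Sum>i\<in>Basis. real n *\<^sub>R i) .. (\<Sum>i\<in>Basis. real n *\<^sub>R i :: real ^ 'd)} \<noteq> \<infinity>" for n
    by (subst emeasure_distr[OF measurable_vec_coord])
      (auto simp: finite_measure.emeasure_finite[OF finite_measure_coord_measure])
  fix X assume "X \<in> ?E"
  then obtain a b where X: "X = {a..b}" by auto
  have eq: "(\<lambda>y. \<chi> j. y j) -` X \<inter> space (coord_measure UNIV) = (\<Pi>\<^sub>E j\<in>UNIV. {max (a $ j) 0 .. min (b $ j) 1})"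
    by (auto simp: X space_coord_measure less_eq_vec_def PiE_def Pi_def)
  have "emeasure (distr (coord_measure UNIV) borel (\<lambda>y. \<chi> j. y j)) X
      = (\<Prod>j\<in>UNIV. emeasure unit_measure {max (a $ j) 0 .. min (b $ j) 1})"
    unfolding emeasure_distr[OF measurable_vec_coord, of X, unfolded X, simplified, folded X] eq
    by (subst unit.emeasure_PiM) (auto simp: sets_restrict_space intro!: image_eqI[of _ _ "{max _ 0 .. min _ 1}"])
  also have "\<dots> = (\<Prod>j\<in>UNIV. ennreal (if max (a $ j) 0 \<le> min (b $ j) 1 then min (b $ j) 1 - max (a $ j) 0 else 0))"
    by (intro prod.cong refl) (subst emeasure_unit_measure, auto simp: emeasure_lborel_Icc_eq)
  also have "\<dots> = emeasure lborel (cbox (\<chi> j. max (a $ j) 0) (\<chi> j. min (b $ j) 1))"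
  \<comment> \<open>If the box misses the cube in some coordinate, the clipped edge is reversed: one
    factor is 0 and the set is empty.\<close>
  proof (cases "\<forall>j. max (a $ j) 0 \<le> min (b $ j) 1")
    case True
    then show ?thesis
      by (subst emeasure_lborel_cbox_eq)
        (auto simp: Basis_vec_def inner_axis prod_ennreal prod.reindex inj_on_def axis_eq_axis
          prod.UNION_disjoint simp del: max.bounded_iff min.bounded_iff)
  next
    case False
    then obtain j where j: "\<not> max (a $ j) 0 \<le> min (b $ j) 1" by blast
    then have "cbox (\<chi> j. max (a $ j) 0) (\<chi> j. min (b $ j) 1) = {}"
      by (auto simp: mem_box_cart set_eq_iff intro!: exI[of _ j])
    moreover have "(\<Prod>j\<in>UNIV. ennreal (if max (a $ j) 0 \<le> min (b $ j) 1 then min (b $ j) 1 - max (a $ j) 0 else 0)) = 0"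
      using j by (intro prod_zero) (auto intro!: bexI[of _ j])
    ultimately show ?thesis by simp
  qed
  also have "cbox (\<chi> j. max (a $ j) 0) (\<chi> j. min (b $ j) 1) = Omega \<inter> X"
    by (auto simp: X interval_cbox_cart mem_box_cart)
  also have "emeasure lborel (Omega \<inter> X) = emeasure (density lborel (indicator Omega)) X"
    by (subst emeasure_density)
      (auto simp: X simp flip: indicator_inter_arith intro!: nn_integral_indicator[symmetric])
  finally show "emeasure (distr (coord_measure UNIV) borel (\<lambda>y. \<chi> j. y j)) X
      = emeasure (density lborel (indicator Omega)) X" .
qed

lemma finite_measure_Omega: "finite_measure (Omega_measure :: (real ^ 'd) measure)"
  by (intro finite_measureI) (simp add: emeasure_restrict_space emeasure_lborel_cbox_eq)

interpretation Omega: finite_measure "Omega_measure :: (real ^ 'd) measure"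
  by (rule finite_measure_Omega)

lemma borel_measurable_Omega:
  "f \<in> borel_measurable borel \<Longrightarrow> f \<in> borel_measurable Omega_measure"
  by (intro measurable_restrict_space1 measurable_completion) simp

lemma integral_Omega_coord:
  fixes f :: "real ^ 'd \<Rightarrow> real"
  assumes [measurable]: "f \<in> borel_measurable borel"
  shows "(\<integral>x. f x \<partial>Omega_measure) = (\<integral>y. f (\<chi> j. y j) \<partial>coord_measure UNIV)"
proof -
  have "(\<integral>x. f x \<partial>Omega_measure) = (\<integral>x. indicator Omega x *\<^sub>R f x \<partial>lebesgue)"
    by (intro integral_restrict_space) simp
  also have "\<dots> = (\<integral>x. indicator Omega x *\<^sub>R f x \<partial>lborel)"
    by (intro integral_completion) measurable
  also have "\<dots> = (\<integral>x. f x \<partial>density lborel (indicator (Omega :: (real ^ 'd) set)))"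
    using integral_density[of f lborel "indicator Omega"] by (simp add: ennreal_indicator)
  also have "\<dots> = (\<integral>y. f (\<chi> j. y j) \<partial>coord_measure UNIV)"
    unfolding distr_coord_measure[symmetric] by (rule integral_distr[OF measurable_vec_coord assms])
  finally show ?thesis .
qed

subsection \<open>The boundary measure\<close>

lemma sets_face_measure: "sets (face_measure i s) = sets borel"
  by (simp add: face_measure_def)

lemma space_face_measure: "space (face_measure i s) = UNIV"
  by (simp add: face_measure_def)

lemma measurable_face_measure: "borel_measurable (face_measure i s) = borel_measurable borel"
  by (intro measurable_cong_sets sets_face_measure refl)

lemma finite_measure_face: "finite_measure (face_measure i s)"
  unfolding face_measure_def
  by (intro finite_measure.finite_measure_distr finite_measure_coord_measure measurable_face_coord)

lemma sets_boundary_measure: "sets boundary_measure = sets borel"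
  unfolding boundary_measure_def by (simp add: sets.sigma_sets_eq[of borel, simplified])

lemma space_boundary_measure: "space boundary_measure = UNIV"
  unfolding boundary_measure_def by (simp add: space_measure_of_conv)

lemma measurable_boundary_measure: "borel_measurable boundary_measure = borel_measurable borel"
  by (intro measurable_cong_sets sets_boundary_measure refl)

text \<open>\<open>measure_of\<close> takes the prescribed values only if they are countably
  additive, which here is the interchange of a series with the finite sum over faces. Indexing faces
  by pairs leaves a single sum for later interchanges.\<close>

lemma emeasure_boundary_measure:
  assumes "A \<in> sets borel"
  shows "emeasure boundary_measure A = (\<Sum>(i, s)\<in>UNIV \<times> {0, 1}. emeasure (face_measure i s) A)"
proof -
  have "emeasure boundary_measure A = (\<Sum>i\<in>UNIV. \<Sum>s\<in>{0, 1}. emeasure (face_measure i s) A)"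
    unfolding boundary_measure_def
  proof (rule emeasure_measure_of_sigma)
    show "sigma_algebra UNIV (sets (borel :: (real ^ 'a) measure))"
      by (metis sets.sigma_algebra_axioms space_borel)
    show "countably_additive (sets borel) (\<lambda>A::(real ^ 'a) set. \<Sum>i\<in>UNIV. \<Sum>s\<in>{0, 1}. emeasure (face_measure i s) A)"
    proof (rule countably_additiveI)
      fix A :: "nat \<Rightarrow> (real ^ 'a) set"
      assume A: "range A \<subseteq> sets borel" "disjoint_family A" "\<Union> (range A) \<in> sets borel"
      have "(\<Sum>n. emeasure (face_measure i s) (A n)) = emeasure (face_measure i s) (\<Union> (range A))" for i s
        using A by (intro suminf_emeasure) (auto simp: sets_face_measure)
      then show "(\<Sum>n. \<Sum>i\<in>UNIV. \<Sum>s\<in>{0, 1}. emeasure (face_measure i s) (A n))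
          = (\<Sum>i\<in>UNIV. \<Sum>s\<in>{0, 1}. emeasure (face_measure i s) (\<Union> (range A)))"
        by (subst suminf_sum, simp, intro sum.cong refl, subst suminf_sum) auto
    qed
  qed (auto simp: positive_def assms)
  then show ?thesis
    by (simp only: sum.cartesian_product)
qed

lemma nn_integral_boundary_measure:
  assumes "f \<in> borel_measurable borel"
  shows "(\<integral>\<^sup>+x. f x \<partial>boundary_measure) = (\<Sum>(i, s)\<in>UNIV \<times> {0, 1}. \<integral>\<^sup>+x. f x \<partial>face_measure i s)"
  using assms
proof (induction rule: borel_measurable_induct)
  case (cong f g)
  then have "f = g" by auto
  with cong show ?case by simp
next
  case (set A)
  then show ?case
    by (simp add: sets_boundary_measure sets_face_measure emeasure_boundary_measure)
next
  case (mult u c)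
  then show ?case
    by (simp add: nn_integral_cmult measurable_boundary_measure measurable_face_measure
        sum_distrib_left case_prod_beta)
next
  case (add u v)
  then show ?case
    by (simp add: nn_integral_add measurable_boundary_measure measurable_face_measure
        sum.distrib case_prod_beta)
next
  case (seq U)
  have eq: "(\<integral>\<^sup>+x. (SUP i. U i) x \<partial>M) = (SUP i. \<integral>\<^sup>+x. U i x \<partial>M)" if "sets M = sets borel" for M
    unfolding SUP_apply
  proof (rule nn_integral_monotone_convergence_SUP)
    show "incseq U" by fact
    show "U i \<in> borel_measurable M" for i
      using \<open>U i \<in> borel_measurable borel\<close> measurable_cong_sets[OF that refl] by blast
  qed
  have "(\<integral>\<^sup>+x. (SUP i. U i) x \<partial>boundary_measure) = (SUP n. \<Sum>(i, s)\<in>UNIV \<times> {0, 1}. \<integral>\<^sup>+x. U n x \<partial>face_measure i s)"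
    by (subst eq[OF sets_boundary_measure]) (simp only: seq.IH)
  also have "\<dots> = (\<Sum>(i, s)\<in>UNIV \<times> {0, 1}. SUP n. \<integral>\<^sup>+x. U n x \<partial>face_measure i s)"
    unfolding case_prod_beta using seq
    by (intro ennreal_SUP_sum) (auto simp: incseq_def le_fun_def intro!: nn_integral_mono)
  also have "\<dots> = (\<Sum>(i, s)\<in>UNIV \<times> {0, 1}. \<integral>\<^sup>+x. (SUP i. U i) x \<partial>face_measure i s)"
    by (intro sum.cong refl) (clarify, subst eq[OF sets_face_measure], rule refl)
  finally show ?case .
qed

lemma finite_measure_boundary: "finite_measure boundary_measure"
  by (intro finite_measureI)
    (auto simp: emeasure_boundary_measure space_boundary_measure finite_measure.emeasure_finite[OF finite_measure_face])

interpretation boundary: finite_measure "boundary_measure :: (real ^ 'd) measure"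
  by (rule finite_measure_boundary)

lemma integrable_boundary_face:
  fixes f :: "real ^ 'd \<Rightarrow> real"
  assumes "integrable boundary_measure f" "s \<in> {0, 1}"
  shows "integrable (face_measure i s) f"
proof -
  have f[measurable]: "f \<in> borel_measurable borel"
    using assms(1) by (simp flip: measurable_boundary_measure)
  have "(\<integral>\<^sup>+x. norm (f x) \<partial>face_measure i s) \<le> (\<Sum>(i, s)\<in>UNIV \<times> {0, 1}. \<integral>\<^sup>+x. norm (f x) \<partial>face_measure i s)"
    using assms(2) member_le_sum[of "(i, s)" "UNIV \<times> {0, 1}" "\<lambda>(i, s). \<integral>\<^sup>+x. norm (f x) \<partial>face_measure i s"]
    by auto
  also have "\<dots> = (\<integral>\<^sup>+x. norm (f x) \<partial>boundary_measure)"
    by (subst nn_integral_boundary_measure) auto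
  also have "\<dots> < \<infinity>"
    using assms(1) by (simp add: integrable_iff_bounded)
  finally show ?thesis
    using f by (simp add: integrable_iff_bounded measurable_face_measure)
qed

text \<open>Positive and negative parts are treated separately; integrability makes every face
  contribution finite, so that \<open>enn2real\<close> distributes over the sum.\<close>

lemma integral_boundary_measure:
  fixes f :: "real ^ 'd \<Rightarrow> real"
  assumes "integrable boundary_measure f"
  shows "(\<integral>x. f x \<partial>boundary_measure) = (\<Sum>i\<in>UNIV. \<Sum>s\<in>{0, 1}. \<integral>x. f x \<partial>face_measure i s)"
proof -
  have f[measurable]: "f \<in> borel_measurable borel"
    using assms(1) by (simp flip: measurable_boundary_measure)
  have enn: "enn2real (\<integral>\<^sup>+x. ennreal (g x) \<partial>boundary_measure)
      = (\<Sum>(i, s)\<in>UNIV \<times> {0, 1}. enn2real (\<integral>\<^sup>+x. ennreal (g x) \<partial>face_measure i s))"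
    if g: "integrable boundary_measure g" for g :: "real ^ 'd \<Rightarrow> real"
  proof -
    have "g \<in> borel_measurable borel"
      using g by (simp flip: measurable_boundary_measure)
    moreover have "(\<integral>\<^sup>+x. ennreal (g x) \<partial>face_measure i s) < top" if "s \<in> {0, 1}" for i s
      using integrable_boundary_face[OF g that, of i] by (simp add: real_integrable_def less_top)
    ultimately show ?thesis
      unfolding case_prod_beta by (subst nn_integral_boundary_measure, simp, unfold case_prod_beta, subst enn2real_sum) auto
  qed
  have "(\<integral>x. f x \<partial>boundary_measure)
      = (\<Sum>(i, s)\<in>UNIV \<times> {0, 1}. enn2real (\<integral>\<^sup>+x. ennreal (f x) \<partial>face_measure i s))
      - (\<Sum>(i, s)\<in>UNIV \<times> {0, 1}. enn2real (\<integral>\<^sup>+x. ennreal (- f x) \<partial>face_measure i s))"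
    using enn[OF assms] enn[of "\<lambda>x. - f x"] assms by (simp add: real_lebesgue_integral_def)
  also have "\<dots> = (\<Sum>(i, s)\<in>UNIV \<times> {0, 1}. \<integral>x. f x \<partial>face_measure i s)"
    unfolding case_prod_beta sum_subtractf[symmetric]
    using integrable_boundary_face[OF assms]
    by (intro sum.cong refl) (auto simp: real_lebesgue_integral_def)
  finally show ?thesis
    by (simp only: sum.cartesian_product)
qed

lemma AE_boundary_measure:
  assumes "{x. P x} \<in> sets borel" "\<And>i s. s \<in> {0, 1} \<Longrightarrow> AE x in face_measure i s. P x"
  shows "AE x in boundary_measure. P x"
proof -
  have *: "{x. \<not> P x} \<in> sets borel"
    using assms(1) by (auto dest: sets.compl_sets simp: Collect_neg_eq Compl_eq_Diff_UNIV)
  have "emeasure (face_measure i s) {x. \<not> P x} = 0" if "s \<in> {0, 1}" for i s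
    using assms(2)[OF that, of i] * by (subst (asm) AE_iff_measurable[OF _ refl]) (auto simp: sets_face_measure space_face_measure)
  then have "emeasure boundary_measure {x. \<not> P x} = 0"
    by (subst emeasure_boundary_measure[OF *]) auto
  then show ?thesis
    using * by (subst AE_iff_measurable[OF _ refl]) (auto simp: sets_boundary_measure space_boundary_measure)
qed

lemma AE_face_Omega: "s \<in> {0, 1} \<Longrightarrow> AE x in face_measure i s. x \<in> Omega"
  unfolding face_measure_def
  by (subst AE_distr_iff[OF measurable_face_coord]) (auto simp: mem_box_cart space_coord_measure PiE_def Pi_def)

lemma AE_boundary_Omega: "AE x in boundary_measure. x \<in> Omega"
  by (rule AE_boundary_measure[OF _ AE_face_Omega]) auto

lemma AE_face_component: "AE x in face_measure i s. x $ i = s"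
  unfolding face_measure_def
  by (subst AE_distr_iff[OF measurable_face_coord]) auto

text \<open>The lower-dimensional edges of a face are null: one factor of the product is the set
  \<open>{0, 1}\<close> of length 0. Hence components of \<open>outer_normal\<close> tangential to a
  face vanish almost everywhere on it.\<close>

lemma AE_face_other_component:
  fixes i j :: "'d::finite"
  assumes "j \<noteq> i"
  shows "AE x in face_measure i s. x $ j \<noteq> 0 \<and> x $ j \<noteq> 1"
proof -
  let ?A = "\<Pi>\<^sub>E k\<in>UNIV - {i}. if k = j then {0, 1} else {0..1::real}"
  have "(if k = j then {0, 1} else {0..1::real}) \<in> sets unit_measure" for k
    by (auto simp: sets_restrict_space_iff)
  then have "?A \<in> sets (coord_measure (UNIV - {i}))"
    by (intro sets_PiM_I_finite) auto
  moreover have "emeasure (coord_measure (UNIV - {i})) ?A = 0"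
    using assms by (subst unit.emeasure_PiM)
      (auto simp: sets_restrict_space_iff emeasure_unit_measure intro!: prod_zero bexI[of _ j] emeasure_lborel_countable)
  ultimately have "AE y in coord_measure (UNIV - {i}). y \<notin> ?A"
    by (intro AE_not_in) auto
  then have "AE y in coord_measure (UNIV - {i}). y j \<noteq> 0 \<and> y j \<noteq> 1"
    using AE_space
    by eventually_elim (use assms in \<open>auto simp: space_coord_measure PiE_def Pi_def extensional_def split: if_splits\<close>)
  then show ?thesis
    unfolding face_measure_def using assms by (subst AE_distr_iff[OF measurable_face_coord]) auto
qed

subsection \<open>The divergence theorem\<close>

lemma continuous_on_Omega_bounded:
  fixes f :: "real ^ 'd \<Rightarrow> 'b::real_normed_vector"
  assumes "continuous_on UNIV f"
  obtains K where "K > 0" "\<And>x. x \<in> Omega \<Longrightarrow> norm (f x) \<le> K"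
proof -
  have "bounded (f ` Omega)"
    using assms by (intro compact_imp_bounded compact_continuous_image) (auto intro: continuous_on_subset)
  then show ?thesis
    using that by (auto simp: bounded_pos)
qed

lemma square_integrable_continuous_Omega:
  fixes f :: "real ^ 'd \<Rightarrow> 'b::euclidean_space"
  assumes "continuous_on UNIV f"
  shows "square_integrable Omega_measure f"
proof -
  obtain K where "\<And>x. x \<in> Omega \<Longrightarrow> norm (f x) \<le> K"
    using continuous_on_Omega_bounded[OF assms] by blast
  then show ?thesis
    using assms by (intro Omega.square_integrable_bounded[where K = K] borel_measurable_Omega
        borel_measurable_continuous_onI AE_I2) (auto simp: space_restrict_space)
qed

lemma square_integrable_continuous_boundary:
  fixes f :: "real ^ 'd \<Rightarrow> 'b::euclidean_space"
  assumes "continuous_on UNIV f"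
  shows "square_integrable boundary_measure f"
proof -
  obtain K where K: "\<And>x. x \<in> Omega \<Longrightarrow> norm (f x) \<le> K"
    using continuous_on_Omega_bounded[OF assms] by blast
  have "AE x in boundary_measure. norm (f x) \<le> K"
    using AE_boundary_Omega by eventually_elim (rule K)
  then show ?thesis
    using assms by (intro boundary.square_integrable_bounded[where K = K])
        (auto simp: measurable_boundary_measure intro!: borel_measurable_continuous_onI)
qed

text \<open>Fubini splits off the \<open>i\<close>-th coordinate, and the fundamental theorem of
  calculus along each line parallel to that axis leaves the values at its two end points.\<close>

lemma integral_partial_deriv_faces:
  fixes F :: "real ^ 'd \<Rightarrow> real"
  assumes diff: "\<And>x. F differentiable (at x)" and cont: "continuous_on UNIV (partial_deriv i F)"
  shows "(\<integral>x. partial_deriv i F x \<partial>Omega_measure)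
    = (\<integral>x. F x \<partial>face_measure i 1) - (\<integral>x. F x \<partial>face_measure i 0)"
proof -
  have contF: "continuous_on UNIV F"
    using diff by (auto intro!: continuous_at_imp_continuous_on differentiable_imp_continuous_within)
  have [measurable]: "partial_deriv i F \<in> borel_measurable borel" "F \<in> borel_measurable borel"
    using cont contF by (auto intro: borel_measurable_continuous_onI)
  obtain K where K: "\<And>x. x \<in> Omega \<Longrightarrow> norm (partial_deriv i F x) \<le> K"
    using continuous_on_Omega_bounded[OF cont] by blast
  obtain L where L: "\<And>x. x \<in> Omega \<Longrightarrow> norm (F x) \<le> L"
    using continuous_on_Omega_bounded[OF contF] by blast
  define p :: "('d \<Rightarrow> real) \<Rightarrow> real \<Rightarrow> real ^ 'd" where "p y t = (\<chi> j. if j = i then t else y j)" for y t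
  have face: "(\<integral>x. F x \<partial>face_measure i s) = (\<integral>y. F (p y s) \<partial>coord_measure (UNIV - {i}))" for s
    unfolding face_measure_def p_def by (intro integral_distr[OF measurable_face_coord]) simp
  have int: "integrable (coord_measure (UNIV - {i})) (\<lambda>y. F (p y s))" if "s \<in> {0, 1}" for s
  proof (rule finite_measure.integrable_const_bound[OF finite_measure_coord_measure, where B = L])
    show "AE y in coord_measure (UNIV - {i}). norm (F (p y s)) \<le> L"
      using that by (intro AE_I2 L) (auto simp: mem_box_cart p_def space_coord_measure PiE_def Pi_def)
    show "(\<lambda>y. F (p y s)) \<in> borel_measurable (coord_measure (UNIV - {i}))"
      unfolding p_def by (rule measurable_compose[OF measurable_face_coord]) simp
  qed
  have inner: "(\<integral>t. partial_deriv i F (p y t) \<partial>unit_measure) = F (p y 1) - F (p y 0)" for y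
  proof -
    have path: "((\<lambda>t. p y t) has_vector_derivative axis i 1) (at t)" for t
    proof -
      have eq: "p y = (\<lambda>t. p y 0 + t *\<^sub>R axis i 1)"
        by (rule ext) (simp add: p_def vec_eq_iff axis_def)
      have "((\<lambda>t. p y 0 + t *\<^sub>R axis i 1) has_vector_derivative axis i 1) (at t)"
        by (auto intro!: derivative_eq_intros)
      then show ?thesis
        unfolding eq[symmetric] .
    qed
    have "((\<lambda>t. F (p y t)) has_real_derivative partial_deriv i F (p y t)) (at t)" for t
    proof -
      have "(F has_derivative frechet_derivative F (at (p y t))) (at (p y t))"
        using diff frechet_derivative_works by blast
      from vector_derivative_diff_chain_within[of "p y" _ t UNIV F, OF path has_derivative_at_withinI[OF this]]
      show ?thesis
        by (simp add: o_def partial_deriv_def has_real_derivative_iff_has_vector_derivative)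
    qed
    moreover have "isCont (\<lambda>t. partial_deriv i F (p y t)) t" for t
    proof -
      have "isCont (p y) t"
        using path[of t] by (rule has_vector_derivative_continuous)
      moreover have "isCont (partial_deriv i F) (p y t)"
        using cont by (simp add: continuous_on_eq_continuous_at)
      ultimately show ?thesis
        by (rule isCont_o2)
    qed
    ultimately have "(\<integral>t. partial_deriv i F (p y t) * indicator {0..1} t \<partial>lborel) = F (p y 1) - F (p y 0)"
      by (intro integral_FTC_Icc_real) auto
    then show ?thesis
      by (subst integral_restrict_space) (auto simp: mult.commute)
  qed
  have "(\<integral>x. partial_deriv i F x \<partial>Omega_measure)
      = (\<integral>y. partial_deriv i F (\<chi> j. y j) \<partial>coord_measure (insert i (UNIV - {i})))"
    by (subst integral_Omega_coord) (auto simp: insert_absorb)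
  also have "\<dots> = (\<integral>y. (\<integral>t. partial_deriv i F (\<chi> j. (y(i := t)) j) \<partial>unit_measure) \<partial>coord_measure (UNIV - {i}))"
  proof (rule unit.product_integral_insert)
    show "integrable (coord_measure (insert i (UNIV - {i}))) (\<lambda>y. partial_deriv i F (\<chi> j. y j))"
    proof (rule finite_measure.integrable_const_bound[OF finite_measure_coord_measure, where B = K])
      show "AE y in coord_measure (insert i (UNIV - {i})). norm (partial_deriv i F (\<chi> j. y j)) \<le> K"
        by (intro AE_I2 K) (auto simp: mem_box_cart space_coord_measure PiE_def Pi_def)
      show "(\<lambda>y. partial_deriv i F (\<chi> j. y j)) \<in> borel_measurable (coord_measure (insert i (UNIV - {i})))"
        using measurable_compose[OF measurable_vec_coord, of "partial_deriv i F" borel]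
        by (simp add: insert_absorb)
    qed
  qed auto
  also have "\<dots> = (\<integral>y. F (p y 1) - F (p y 0) \<partial>coord_measure (UNIV - {i}))"
    by (simp add: fun_upd_def flip: p_def) (simp add: inner)
  finally show ?thesis
    using int by (simp add: face)
qed

text \<open>The \<open>i\<close>-th normal component is 1 and -1 on the two faces orthogonal to axis
  \<open>i\<close> and almost everywhere 0 on all other faces, so the boundary integral is the
  difference of two face integrals.\<close>

theorem divergence_theorem_cube:
  fixes F :: "real ^ 'd \<Rightarrow> real"
  assumes diff: "\<And>x. F differentiable (at x)" and cont: "continuous_on UNIV (partial_deriv i F)"
  shows "(\<integral>x. partial_deriv i F x \<partial>Omega_measure) = (\<integral>x. F x * outer_normal x $ i \<partial>boundary_measure)"
proof -
  have contF: "continuous_on UNIV F"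
    using diff by (auto intro!: continuous_at_imp_continuous_on differentiable_imp_continuous_within)
  then have F[measurable]: "F \<in> borel_measurable borel"
    by (auto intro: borel_measurable_continuous_onI)
  have n[measurable]: "(\<lambda>x. outer_normal x $ i) \<in> borel_measurable borel"
    unfolding outer_normal_def by simp
  have "square_integrable boundary_measure (\<lambda>x. F x * outer_normal x $ i)"
    by (rule square_integrable_bound[OF square_integrable_continuous_boundary[OF contF], where K = 1])
      (auto simp: measurable_boundary_measure outer_normal_def)
  then have int: "integrable boundary_measure (\<lambda>x. F x * outer_normal x $ i)"
    by (rule boundary.square_integrable_imp_integrable_L1)
  have other: "(\<integral>x. F x * outer_normal x $ i \<partial>face_measure j s) = 0" if "j \<noteq> i" for j s
    using AE_face_other_component[OF that[symmetric], of s]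
    by (intro integral_eq_zero_AE) (auto simp: outer_normal_def)
  have own: "(\<integral>x. F x * outer_normal x $ i \<partial>face_measure i s) = (if s = 1 then 1 else - 1) * (\<integral>x. F x \<partial>face_measure i s)"
    if "s \<in> {0, 1}" for s
  proof -
    have "(\<integral>x. F x * outer_normal x $ i \<partial>face_measure i s) = (\<integral>x. (if s = 1 then 1 else - 1) * F x \<partial>face_measure i s)"
    proof (rule integral_cong_AE)
      show "AE x in face_measure i s. F x * outer_normal x $ i = (if s = 1 then 1 else - 1) * F x"
        using AE_face_component[of i s] by eventually_elim (use that in \<open>auto simp: outer_normal_def\<close>)
    qed (auto simp: measurable_face_measure)
    then show ?thesis by simp
  qed
  have "(\<integral>x. F x * outer_normal x $ i \<partial>boundary_measure)
      = (\<Sum>j\<in>UNIV. \<Sum>s\<in>{0, 1}. \<integral>x. F x * outer_normal x $ i \<partial>face_measure j s)"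
    by (rule integral_boundary_measure[OF int])
  also have "\<dots> = (\<Sum>j\<in>UNIV. if j = i then (\<integral>x. F x \<partial>face_measure i 1) - (\<integral>x. F x \<partial>face_measure i 0) else 0)"
    by (intro sum.cong refl) (auto simp: own other)
  also have "\<dots> = (\<integral>x. partial_deriv i F x \<partial>Omega_measure)"
    by (simp add: integral_partial_deriv_faces[OF diff cont])
  finally show ?thesis ..
qed

lemma measure_Omega: "measure Omega_measure (Omega :: (real ^ 'd) set) = 1"
proof -
  have "(\<integral>x. 1 \<partial>(Omega_measure :: (real ^ 'd) measure)) = (\<integral>y. (1::real) \<partial>coord_measure (UNIV :: 'd set))"
    by (rule integral_Omega_coord[of "\<lambda>_. 1"]) simp
  then show ?thesis
    using emeasure_space_coord_measure[of "UNIV :: 'd set"] by (simp add: measure_def)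
qed

lemma AE_interior_Omega: "AE x in Omega_measure. x \<in> interior (Omega :: (real ^ 'd) set)"
proof -
  have "negligible (Omega - interior (Omega :: (real ^ 'd) set))"
    unfolding interior_cbox by (rule negligible_frontier_interval)
  then have "AE x in lebesgue. x \<notin> Omega - interior (Omega :: (real ^ 'd) set)"
    by (intro AE_not_in) (simp add: negligible_iff_null_sets)
  then show ?thesis
    by (subst AE_restrict_space_iff) auto
qed

lemma AE_boundary_not_interior: "AE x in boundary_measure. x \<notin> interior (Omega :: (real ^ 'd) set)"
proof (rule AE_boundary_measure)
  show "AE x in face_measure i s. x \<notin> interior (Omega :: (real ^ 'd) set)" if "s \<in> {0, 1}" for i s
    using AE_face_component[of i s] by eventually_elim (use that in \<open>auto simp: interior_Omega simp del: interior_cbox intro!: exI[of _ i]\<close>)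
qed simp

subsection \<open>Cosine polynomials\<close>

text \<open>Integer frequencies, rather than natural ones, keep the family closed under the product
  formula, which produces \<open>k j - l j\<close>.\<close>

definition cos_tensor :: "('d \<Rightarrow> int) \<Rightarrow> real ^ 'd \<Rightarrow> real" where
  "cos_tensor k x = (\<Prod>j\<in>UNIV. cos (pi * real_of_int (k j) * x $ j))"

text \<open>Up to the factor \<open>- pi * k i\<close> this is the \<open>i\<close>-th partial
  derivative of \<open>cos_tensor k\<close>. It vanishes on both faces orthogonal to axis
  \<open>i\<close>, which is the Neumann condition of \<open>cos_tensor k\<close> there.\<close>

definition sin_tensor :: "'d \<Rightarrow> ('d \<Rightarrow> int) \<Rightarrow> real ^ 'd \<Rightarrow> real" where
  "sin_tensor i k x = sin (pi * real_of_int (k i) * x $ i) * (\<Prod>j\<in>UNIV - {i}. cos (pi * real_of_int (k j) * x $ j))"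

text \<open>The linear span of the cosine tensors, presented so that its induction rule adds one
  multiple of a tensor at a time.\<close>

inductive_set cos_span :: "(real ^ 'd \<Rightarrow> real) set" where
  zero: "(\<lambda>x. 0) \<in> cos_span"
| step: "f \<in> cos_span \<Longrightarrow> (\<lambda>x. f x + c * cos_tensor k x) \<in> cos_span"

lemma smooth_cos_tensor: "smooth (cos_tensor k)"
  unfolding cos_tensor_def[abs_def] by (intro smooth_prod smooth_cos)

lemma smooth_sin_tensor: "smooth (sin_tensor i k)"
  unfolding sin_tensor_def[abs_def] by (intro smooth_mult smooth_sin smooth_prod smooth_cos)

lemma partial_deriv_cos_prod_other:
  assumes "finite J" "i \<notin> J"
  shows "partial_deriv i (\<lambda>x. \<Prod>j\<in>J. cos (pi * real_of_int (k j) * x $ j)) x = 0"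
  using assms
proof (induction J)
  case (insert j J)
  have "partial_deriv i (\<lambda>x. cos (pi * real_of_int (k j) * x $ j)) x = 0"
    using insert.prems by (subst partial_deriv_cos) auto
  then show ?case
    using insert by (simp add: partial_deriv_smooth_mult smooth_prod smooth_cos)
qed (simp add: partial_deriv_const)

lemma partial_deriv_cos_tensor:
  "partial_deriv i (cos_tensor k) x = - (pi * k i) * sin_tensor i k x"
proof -
  have eq: "cos_tensor k = (\<lambda>x. cos (pi * real_of_int (k i) * x $ i) * (\<Prod>j\<in>UNIV - {i}. cos (pi * real_of_int (k j) * x $ j)))"
    by (rule ext) (simp add: cos_tensor_def prod.remove[of UNIV i])
  show ?thesis
    unfolding eq sin_tensor_def
    by (subst partial_deriv_smooth_mult) (auto simp: smooth_prod smooth_cos partial_deriv_cos partial_deriv_cos_prod_other)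
qed

lemma partial_deriv_sin_tensor:
  "partial_deriv i (sin_tensor i k) x = pi * k i * cos_tensor k x"
proof -
  have eq: "cos_tensor k x = cos (pi * real_of_int (k i) * x $ i) * (\<Prod>j\<in>UNIV - {i}. cos (pi * real_of_int (k j) * x $ j))"
    by (simp add: cos_tensor_def prod.remove[of UNIV i])
  show ?thesis
    unfolding eq sin_tensor_def[abs_def]
    by (subst partial_deriv_smooth_mult) (auto simp: smooth_prod smooth_cos smooth_sin partial_deriv_sin partial_deriv_cos_prod_other)
qed

text \<open>The decay hypothesis of \<open>weak_integration_by_parts\<close>. Near the face at 0 it
  is \<open>|sin t| \<le> |t|\<close>; reflection of the coordinate changes the sine at most by a
  sign, because the frequency is an integer, and gives the other face.\<close>

lemma abs_sin_tensor_le: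
  assumes "x \<in> Omega"
  shows "\<bar>sin_tensor i k x\<bar> \<le> (pi * \<bar>k i\<bar>) * x $ i" "\<bar>sin_tensor i k x\<bar> \<le> (pi * \<bar>k i\<bar>) * (1 - x $ i)"
proof -
  have x: "0 \<le> x $ i" "x $ i \<le> 1"
    using assms by (auto simp: mem_box_cart)
  have *: "\<bar>sin_tensor i k x\<bar> \<le> \<bar>sin (pi * real_of_int (k i) * x $ i)\<bar>"
    unfolding sin_tensor_def abs_mult abs_prod
    by (intro mult_left_le prod_le_1) auto
  have "\<bar>sin (pi * real_of_int (k i) * x $ i)\<bar> \<le> \<bar>pi * real_of_int (k i) * x $ i\<bar>"
    by (rule abs_sin_x_le_abs_x)
  with * x show "\<bar>sin_tensor i k x\<bar> \<le> (pi * \<bar>k i\<bar>) * x $ i"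
    by (simp add: abs_mult)
  have "sin (pi * real_of_int (k i) * (1 - x $ i)) = - (cos (pi * real_of_int (k i)) * sin (pi * real_of_int (k i) * x $ i))"
    unfolding right_diff_distrib sin_diff mult_1_right by (simp add: sin_npi_int)
  moreover have "\<bar>cos (pi * real_of_int (k i))\<bar> = 1"
    by (metis sin_npi_int sin_zero_abs_cos_one)
  ultimately have "\<bar>sin (pi * real_of_int (k i) * x $ i)\<bar> = \<bar>sin (pi * real_of_int (k i) * (1 - x $ i))\<bar>"
    by (simp add: abs_mult)
  also have "\<dots> \<le> \<bar>pi * real_of_int (k i) * (1 - x $ i)\<bar>"
    by (rule abs_sin_x_le_abs_x)
  finally show "\<bar>sin_tensor i k x\<bar> \<le> (pi * \<bar>k i\<bar>) * (1 - x $ i)"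
    using * x by (simp add: abs_mult)
qed

lemma cos_span_tensor: "(\<lambda>x. c * cos_tensor k x) \<in> cos_span"
  using cos_span.step[OF cos_span.zero] by simp

lemma cos_span_add: "g \<in> cos_span \<Longrightarrow> f \<in> cos_span \<Longrightarrow> (\<lambda>x. f x + g x) \<in> cos_span"
proof (induction rule: cos_span.induct)
  case (step g c k)
  from cos_span.step[OF step.IH[OF step.prems], of c k] show ?case
    by (simp add: add.assoc)
qed simp

lemma cos_span_sum: "(\<And>i. i \<in> I \<Longrightarrow> f i \<in> cos_span) \<Longrightarrow> (\<lambda>x. \<Sum>i\<in>I. f i x) \<in> cos_span"
  by (induction I rule: infinite_finite_induct) (auto intro: cos_span_add cos_span.zero)

lemma cos_span_cmult: "f \<in> cos_span \<Longrightarrow> (\<lambda>x. c * f x) \<in> cos_span"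
proof (induction rule: cos_span.induct)
  case (step f c' k)
  from cos_span.step[OF step.IH, of "c * c'" k] show ?case
    by (simp add: distrib_left mult.assoc)
qed (simp add: cos_span.zero)

text \<open>The product-to-sum formula is applied in each coordinate and the product is expanded;
  \<open>X\<close> is the set of coordinates in which the sum of the frequencies is selected instead
  of the difference.\<close>

lemma cos_tensor_mult_in_span: "(\<lambda>x. cos_tensor k x * cos_tensor l x) \<in> cos_span"
proof -
  let ?m = "\<lambda>X j. if j \<in> X then k j + l j else k j - l j"
  have "cos_tensor k x * cos_tensor l x = (\<Sum>X\<in>Pow UNIV. (1 / 2) ^ CARD('a) * cos_tensor (?m X) x)" for x :: "real ^ 'a"
  proof -
    have "cos_tensor k x * cos_tensor l x
        = (\<Prod>j\<in>UNIV. (1 / 2) * (cos (pi * real_of_int (k j + l j) * x $ j) + cos (pi * real_of_int (k j - l j) * x $ j)))"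
      unfolding cos_tensor_def prod.distrib[symmetric]
      by (intro prod.cong refl) (simp add: cos_times_cos algebra_simps)
    also have "\<dots> = (1 / 2) ^ CARD('a) * (\<Sum>X\<in>Pow UNIV. (\<Prod>j\<in>X. cos (pi * real_of_int (k j + l j) * x $ j))
        * (\<Prod>j\<in>UNIV - X. cos (pi * real_of_int (k j - l j) * x $ j)))"
      by (simp only: prod.distrib prod_constant prod_add[OF finite])
    also have "\<dots> = (\<Sum>X\<in>Pow UNIV. (1 / 2) ^ CARD('a) * cos_tensor (?m X) x)"
      unfolding sum_distrib_left cos_tensor_def
    proof (intro sum.cong refl arg_cong2[where f = "(*)"])
      fix X :: "'a set"
      have "(\<Prod>j\<in>UNIV. cos (pi * real_of_int (?m X j) * x $ j))
          = (\<Prod>j\<in>UNIV - X. cos (pi * real_of_int (?m X j) * x $ j)) * (\<Prod>j\<in>X. cos (pi * real_of_int (?m X j) * x $ j))"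
        by (rule prod.subset_diff) auto
      also have "(\<Prod>j\<in>UNIV - X. cos (pi * real_of_int (?m X j) * x $ j)) = (\<Prod>j\<in>UNIV - X. cos (pi * real_of_int (k j - l j) * x $ j))"
        by (intro prod.cong) auto
      also have "(\<Prod>j\<in>X. cos (pi * real_of_int (?m X j) * x $ j)) = (\<Prod>j\<in>X. cos (pi * real_of_int (k j + l j) * x $ j))"
        by (intro prod.cong) auto
      finally show "(\<Prod>j\<in>X. cos (pi * real_of_int (k j + l j) * x $ j)) * (\<Prod>j\<in>UNIV - X. cos (pi * real_of_int (k j - l j) * x $ j))
          = (\<Prod>j\<in>UNIV. cos (pi * real_of_int (?m X j) * x $ j))"
        by (simp only: mult.commute)
    qed
    finally show ?thesis .
  qed
  then show ?thesis
    by (simp add: cos_span_sum cos_span_tensor)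
qed

lemma cos_span_mult_tensor: "f \<in> cos_span \<Longrightarrow> (\<lambda>x. f x * cos_tensor l x) \<in> cos_span"
proof (induction rule: cos_span.induct)
  case (step f c k)
  from cos_span_add[OF cos_span_cmult[OF cos_tensor_mult_in_span, of c k l] step.IH] show ?case
    by (simp add: distrib_right mult.assoc)
qed (simp add: cos_span.zero)

lemma cos_span_mult: "g \<in> cos_span \<Longrightarrow> f \<in> cos_span \<Longrightarrow> (\<lambda>x. f x * g x) \<in> cos_span"
proof (induction rule: cos_span.induct)
  case (step g c k)
  from cos_span_add[OF cos_span_cmult[OF cos_span_mult_tensor[OF step.prems], of c k] step.IH[OF step.prems]]
  show ?case
    by (simp add: distrib_left mult_ac)
qed (simp add: cos_span.zero)

lemma cos_span_smooth: "f \<in> cos_span \<Longrightarrow> smooth f"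
  by (induction rule: cos_span.induct) (auto intro!: smooth_const smooth_add smooth_mult[OF smooth_const smooth_cos_tensor])

lemma cos_span_const: "(\<lambda>x. c) \<in> cos_span"
  using cos_span_tensor[of c "\<lambda>_. 0"] by (simp add: cos_tensor_def)

text \<open>The hypotheses of the Stone-Weierstrass theorem. Points are separated by a tensor of
  frequency 1 in a coordinate where they differ, since \<open>cos (pi * t)\<close> is injective on
  \<open>[0, 1]\<close>.\<close>

lemma function_ring_cos_span: "function_ring_on cos_span (Omega :: (real ^ 'd) set)"
proof
  fix x y :: "real ^ 'd"
  assume xy: "x \<in> Omega" "y \<in> Omega" "x \<noteq> y"
  then obtain j where j: "x $ j \<noteq> y $ j"
    by (auto simp: vec_eq_iff)
  let ?k = "\<lambda>i. if i = j then 1 else 0 :: int"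
  have eq: "cos_tensor ?k z = cos (pi * z $ j)" for z :: "real ^ 'd"
  proof -
    have "cos_tensor ?k z = (\<Prod>i\<in>UNIV. if i = j then cos (pi * z $ j) else 1)"
      unfolding cos_tensor_def by (intro prod.cong) auto
    then show ?thesis by simp
  qed
  have "cos (pi * x $ j) \<noteq> cos (pi * y $ j)"
    using xy j cos_inj_pi[of "pi * x $ j" "pi * y $ j"] by (auto simp: mem_box_cart)
  then show "\<exists>f\<in>cos_span. f x \<noteq> f y"
    using cos_span_tensor[of 1 ?k] eq by (intro bexI[of _ "\<lambda>x. 1 * cos_tensor ?k x"]) auto
qed (auto intro: cos_span_add cos_span_mult cos_span_const smooth_continuous cos_span_smooth)

lemma continuous_approx_cos_span:
  fixes h :: "real ^ 'd \<Rightarrow> real"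
  assumes "continuous_on UNIV h" "0 < e"
  obtains p where "p \<in> cos_span" "L2_norm Omega_measure (\<lambda>x. h x - p x) < e"
proof -
  interpret function_ring_on cos_span "Omega :: (real ^ 'd) set"
    by (rule function_ring_cos_span)
  obtain p where p: "p \<in> cos_span" "\<And>x. x \<in> Omega \<Longrightarrow> \<bar>h x - p x\<bar> < e / 2"
    using Stone_Weierstrass_basic[of h "e / 2"] assms continuous_on_subset[OF assms(1)] by auto
  have "L2_norm Omega_measure (\<lambda>x. h x - p x) \<le> e / 2 * sqrt (measure Omega_measure (space (Omega_measure :: (real ^ 'd) measure)))"
  proof (rule Omega.L2_norm_le_const)
    show "(\<lambda>x. h x - p x) \<in> borel_measurable Omega_measure"
      by (intro borel_measurable_Omega borel_measurable_continuous_onI continuous_intros assms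
          smooth_continuous cos_span_smooth p)
    show "AE x in Omega_measure. \<bar>h x - p x\<bar> \<le> e / 2"
      using p(2) by (intro AE_I2 less_imp_le) (simp add: space_restrict_space)
  qed (use assms in simp)
  then show thesis
    using that[OF p(1)] assms(2) by (simp add: measure_Omega)
qed

subsection \<open>Density of test functions\<close>

text \<open>Measurability yields continuous functions that converge only almost everywhere. Clamping
  \<open>f\<close> at height \<open>B\<close> costs little in norm, and clamping the continuous
  functions at the same height makes all differences bounded by \<open>2 * B\<close>, so dominated
  convergence applies.\<close>

lemma continuous_approx:
  fixes f :: "real ^ 'd \<Rightarrow> real"
  assumes f: "square_integrable Omega_measure f" and e: "0 < e"
  obtains h where "continuous_on UNIV h" "L2_norm Omega_measure (\<lambda>x. f x - h x) < e"
proof -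
  have fm[measurable]: "f \<in> borel_measurable Omega_measure"
    using f by (simp add: square_integrable_def)
  define clamp where "clamp B t = max (- B) (min B t)" for B t :: real
  have clamp_cont: "continuous_on UNIV (clamp B)" for B
    unfolding clamp_def by (intro continuous_intros)
  have clamp_meas: "(\<lambda>x. clamp B (g x)) \<in> borel_measurable Omega_measure" if "g \<in> borel_measurable Omega_measure" for B and g :: "real ^ 'd \<Rightarrow> real"
    using that unfolding clamp_def by simp
  have "(\<lambda>m. L2_norm Omega_measure (\<lambda>x. clamp (real m) (f x) - f x)) \<longlonglongrightarrow> 0"
  proof (rule L2_dominated_convergence[OF clamp_meas[OF fm] fm f])
    have "(\<lambda>m. clamp (real m) t) \<longlonglongrightarrow> t" for t
    proof (rule tendsto_eventually)
      obtain n where "\<bar>t\<bar> \<le> real n"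
        using real_arch_simple by blast
      then show "\<forall>\<^sub>F m in sequentially. clamp (real m) t = t"
        by (intro eventually_sequentiallyI[of n]) (auto simp: clamp_def)
    qed
    then show "AE x in Omega_measure. (\<lambda>m. clamp (real m) (f x)) \<longlonglongrightarrow> f x"
      by simp
    show "AE x in Omega_measure. \<bar>clamp (real m) (f x) - f x\<bar> \<le> \<bar>f x\<bar>" for m
      by (intro AE_I2) (auto simp: clamp_def max_def min_def)
  qed
  then obtain B :: nat where B: "L2_norm Omega_measure (\<lambda>x. clamp (real B) (f x) - f x) < e / 2"
    using e by (auto dest!: LIMSEQ_D[of _ _ "e / 2"] simp: L2_norm_nonneg)
  have "f measurable_on Omega"
    using fm by (subst measurable_on_iff_borel_measurable) auto
  then obtain N g where N: "negligible N" and g: "\<And>n. continuous_on UNIV (g n)"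
    "\<And>x. x \<notin> N \<Longrightarrow> (\<lambda>n. g n x) \<longlonglongrightarrow> (if x \<in> Omega then f x else 0)"
    unfolding measurable_on_def by blast
  have gm: "g n \<in> borel_measurable Omega_measure" for n
    by (intro borel_measurable_Omega borel_measurable_continuous_onI g)
  have "(\<lambda>m. L2_norm Omega_measure (\<lambda>x. clamp B (g m x) - clamp B (f x))) \<longlonglongrightarrow> 0"
  proof (rule L2_dominated_convergence[OF clamp_meas[OF gm] clamp_meas[OF fm] Omega.square_integrable_const[of "2 * real B"]])
    have "AE x in lebesgue. x \<notin> N"
      using N by (intro AE_not_in) (simp add: negligible_iff_null_sets)
    then have "AE x in Omega_measure. x \<notin> N"
      by (subst AE_restrict_space_iff) auto
    then show "AE x in Omega_measure. (\<lambda>m. clamp B (g m x)) \<longlonglongrightarrow> clamp B (f x)"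
      using AE_space
    proof eventually_elim
      case (elim x)
      then have "(\<lambda>n. g n x) \<longlonglongrightarrow> f x"
        using g(2)[of x] by (simp add: space_restrict_space)
      then show ?case
        by (rule isCont_tendsto_compose[rotated]) (use clamp_cont in \<open>simp add: continuous_on_eq_continuous_at\<close>)
    qed
    show "AE x in Omega_measure. \<bar>clamp B (g m x) - clamp B (f x)\<bar> \<le> \<bar>2 * real B\<bar>" for m
      by (intro AE_I2) (auto simp: clamp_def max_def min_def)
  qed
  then obtain m where m: "L2_norm Omega_measure (\<lambda>x. clamp B (g m x) - clamp B (f x)) < e / 2"
    using e by (auto dest!: LIMSEQ_D[of _ _ "e / 2"] simp: L2_norm_nonneg)
  have h: "continuous_on UNIV (\<lambda>x. clamp B (g m x))"
    by (rule continuous_on_compose2[OF clamp_cont g(1)]) auto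
  have cf: "square_integrable Omega_measure (\<lambda>x. clamp B (f x))"
    by (rule Omega.square_integrable_bounded[OF clamp_meas[OF fm], where K = B]) (auto simp: clamp_def max_def min_def)
  have "L2_norm Omega_measure (\<lambda>x. f x - clamp B (g m x))
      \<le> L2_norm Omega_measure (\<lambda>x. f x - clamp B (f x)) + L2_norm Omega_measure (\<lambda>x. clamp B (f x) - clamp B (g m x))"
    by (intro L2_norm_triangle_diff f cf square_integrable_continuous_Omega h)
  also have "\<dots> < e"
    using m B L2_norm_minus_commute[of Omega_measure f "\<lambda>x. clamp B (f x)"]
      L2_norm_minus_commute[of Omega_measure "\<lambda>x. clamp B (f x)" "\<lambda>x. clamp B (g m x)"] by linarith
  finally show thesis
    by (rule that[OF h])
qed

lemma smooth_square_integrable_Omega: "smooth f \<Longrightarrow> square_integrable Omega_measure f"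
  by (intro square_integrable_continuous_Omega smooth_continuous)

lemma smooth_square_integrable_boundary: "smooth f \<Longrightarrow> square_integrable boundary_measure f"
  by (intro square_integrable_continuous_boundary smooth_continuous)

lemma test_function_smooth: "test_function \<psi> \<Longrightarrow> smooth \<psi>"
  by (simp add: test_function_def)

lemma test_function_outside: "test_function \<psi> \<Longrightarrow> x \<notin> interior Omega \<Longrightarrow> \<psi> x = 0"
  by (auto simp: test_function_def simp del: interior_cbox)

lemma cos_span_dense:
  assumes f: "square_integrable Omega_measure f" and e: "0 < e"
  obtains p where "p \<in> cos_span" "L2_norm Omega_measure (\<lambda>x. f x - p x) < e"
proof -
  obtain h where h: "continuous_on UNIV h" "L2_norm Omega_measure (\<lambda>x. f x - h x) < e / 2"
    using continuous_approx[OF f, of "e / 2"] e by auto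
  obtain p where p: "p \<in> cos_span" "L2_norm Omega_measure (\<lambda>x. h x - p x) < e / 2"
    using continuous_approx_cos_span[OF h(1), of "e / 2"] e by auto
  have "L2_norm Omega_measure (\<lambda>x. f x - p x)
      \<le> L2_norm Omega_measure (\<lambda>x. f x - h x) + L2_norm Omega_measure (\<lambda>x. h x - p x)"
    by (intro L2_norm_triangle_diff f square_integrable_continuous_Omega[OF h(1)] smooth_square_integrable_Omega cos_span_smooth p)
  then show thesis
    using that[OF p(1)] h p by linarith
qed

text \<open>A cosine polynomial close to \<open>f\<close> is multiplied by \<open>cutoff m\<close>;
  the error is at most the polynomial itself and tends to 0 in the open cube.\<close>

lemma test_function_dense:
  assumes f: "square_integrable Omega_measure f" and e: "0 < e"
  obtains \<psi> where "test_function \<psi>" "L2_norm Omega_measure (\<lambda>x. f x - \<psi> x) < e"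
proof -
  obtain p where p: "p \<in> cos_span" "L2_norm Omega_measure (\<lambda>x. f x - p x) < e / 2"
    using cos_span_dense[OF f, of "e / 2"] e by auto
  note sp = cos_span_smooth[OF p(1)]
  have "(\<lambda>m. L2_norm Omega_measure (\<lambda>x. p x * cutoff m x - p x)) \<longlonglongrightarrow> 0"
  proof (rule L2_dominated_convergence[OF _ _ smooth_square_integrable_Omega[OF sp]])
    show "AE x in Omega_measure. (\<lambda>m. p x * cutoff m x) \<longlonglongrightarrow> p x"
      using AE_interior_Omega
    proof eventually_elim
      case (elim x)
      from tendsto_mult[OF tendsto_const[of "p x"] cutoff_tendsto[OF elim]] show ?case by simp
    qed
    show "AE x in Omega_measure. \<bar>p x * cutoff m x - p x\<bar> \<le> \<bar>p x\<bar>" for m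
    proof (intro AE_I2)
      fix x
      have "p x * cutoff m x - p x = p x * (cutoff m x - 1)"
        by (simp add: algebra_simps)
      then show "\<bar>p x * cutoff m x - p x\<bar> \<le> \<bar>p x\<bar>"
        using cutoff_bounds[of m x] by (simp add: abs_mult mult_left_le)
    qed
  qed (auto intro!: square_integrable_measurable[OF smooth_square_integrable_Omega] smooth_mult sp smooth_cutoff)
  then obtain m where m: "L2_norm Omega_measure (\<lambda>x. p x * cutoff m x - p x) < e / 2"
    using e by (auto dest!: LIMSEQ_D[of _ _ "e / 2"] simp: L2_norm_nonneg)
  have "L2_norm Omega_measure (\<lambda>x. f x - p x * cutoff m x)
      \<le> L2_norm Omega_measure (\<lambda>x. f x - p x) + L2_norm Omega_measure (\<lambda>x. p x - p x * cutoff m x)"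
    by (intro L2_norm_triangle_diff f smooth_square_integrable_Omega smooth_mult sp smooth_cutoff)
  then have "L2_norm Omega_measure (\<lambda>x. f x - p x * cutoff m x) < e"
    using p m L2_norm_minus_commute[of Omega_measure p "\<lambda>x. p x * cutoff m x"] by linarith
  then show thesis
    by (rule that[OF test_function_mult_cutoff[OF sp]])
qed

text \<open>Density of test functions allows \<open>d\<close> to be tested against itself, through
  the weak limit criterion for the constant sequence \<open>d\<close>; hence the integral of its
  square is 0.\<close>

lemma fundamental_lemma:
  assumes d: "square_integrable Omega_measure d"
    and zero: "\<And>\<psi>. test_function \<psi> \<Longrightarrow> (\<integral>x. d x * \<psi> x \<partial>Omega_measure) = 0"
  shows "AE x in Omega_measure. d x = 0"
proof -
  have "(\<lambda>m::nat. \<integral>x. d x \<bullet> d x \<partial>Omega_measure) \<longlonglongrightarrow> 0"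
  proof (rule L2_bounded_weak_limit[where B = "L2_norm Omega_measure d"])
    fix e :: real assume "0 < e"
    from test_function_dense[OF d this] obtain \<psi> where \<psi>: "test_function \<psi>" "L2_norm Omega_measure (\<lambda>x. d x - \<psi> x) < e" .
    then show "\<exists>g. square_integrable Omega_measure g \<and> L2_norm Omega_measure (\<lambda>x. d x - g x) < e
        \<and> (\<lambda>m::nat. \<integral>x. d x \<bullet> g x \<partial>Omega_measure) \<longlonglongrightarrow> 0"
      using zero[OF \<psi>(1)] by (auto intro!: exI[of _ \<psi>] smooth_square_integrable_Omega test_function_smooth)
  qed (auto simp: d)
  then have "(\<integral>x. (d x)\<^sup>2 \<partial>Omega_measure) = 0"
    by (simp add: LIMSEQ_const_iff power2_eq_square)
  moreover have "integrable Omega_measure (\<lambda>x. (d x)\<^sup>2)"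
    using d by (simp add: square_integrable_def)
  ultimately show ?thesis
    by (subst (asm) integral_nonneg_eq_0_iff_AE) auto
qed

subsection \<open>Weak derivatives\<close>

lemma has_weak_partialD:
  fixes u g \<psi> :: "real ^ 'd \<Rightarrow> real"
  assumes "has_weak_partial i u g"
  shows "square_integrable Omega_measure u" "square_integrable Omega_measure g"
    "test_function \<psi> \<Longrightarrow> (\<integral>x. u x * partial_deriv i \<psi> x \<partial>Omega_measure) = - (\<integral>x. g x * \<psi> x \<partial>Omega_measure)"
  using assms by (auto simp: has_weak_partial_def)

lemma has_weak_partial_unique:
  fixes u g h :: "real ^ 'd \<Rightarrow> real"
  assumes g: "has_weak_partial i u g" and h: "has_weak_partial i u h"
  shows "AE x in Omega_measure. g x = h x"
proof -
  note d = square_integrable_diff[OF has_weak_partialD(2)[OF g] has_weak_partialD(2)[OF h]]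
  have "AE x in Omega_measure. g x - h x = 0"
  proof (rule fundamental_lemma[OF d])
    fix \<psi> :: "real ^ 'd \<Rightarrow> real" assume \<psi>: "test_function \<psi>"
    have s: "square_integrable Omega_measure \<psi>"
      by (intro smooth_square_integrable_Omega test_function_smooth \<psi>)
    have "(\<integral>x. (g x - h x) * \<psi> x \<partial>Omega_measure) = (\<integral>x. g x * \<psi> x \<partial>Omega_measure) - (\<integral>x. h x * \<psi> x \<partial>Omega_measure)"
      unfolding left_diff_distrib
      by (intro Bochner_Integration.integral_diff square_integrable_mult
          has_weak_partialD(2)[OF g] has_weak_partialD(2)[OF h] s)
    then show "(\<integral>x. (g x - h x) * \<psi> x \<partial>Omega_measure) = 0"
      using has_weak_partialD(3)[OF g \<psi>] has_weak_partialD(3)[OF h \<psi>] by simp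
  qed
  then show ?thesis by simp
qed

lemma has_weak_partial_diff:
  fixes u v g h :: "real ^ 'd \<Rightarrow> real"
  assumes "has_weak_partial i u g" "has_weak_partial i v h"
  shows "has_weak_partial i (\<lambda>x. u x - v x) (\<lambda>x. g x - h x)"
proof -
  note a = has_weak_partialD[OF assms(1)] and b = has_weak_partialD[OF assms(2)]
  have "(\<integral>x. (u x - v x) * partial_deriv i \<psi> x \<partial>Omega_measure) = - (\<integral>x. (g x - h x) * \<psi> x \<partial>Omega_measure)"
    if \<psi>: "test_function \<psi>" for \<psi>
  proof -
    have s: "square_integrable Omega_measure \<psi>" "square_integrable Omega_measure (partial_deriv i \<psi>)"
      by (intro smooth_square_integrable_Omega smooth_partial_deriv test_function_smooth \<psi>)+
    have "(\<integral>x. (u x - v x) * partial_deriv i \<psi> x \<partial>Omega_measure)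
        = (\<integral>x. u x * partial_deriv i \<psi> x \<partial>Omega_measure) - (\<integral>x. v x * partial_deriv i \<psi> x \<partial>Omega_measure)"
      unfolding left_diff_distrib by (intro Bochner_Integration.integral_diff square_integrable_mult a b s)
    moreover have "(\<integral>x. (g x - h x) * \<psi> x \<partial>Omega_measure)
        = (\<integral>x. g x * \<psi> x \<partial>Omega_measure) - (\<integral>x. h x * \<psi> x \<partial>Omega_measure)"
      unfolding left_diff_distrib by (intro Bochner_Integration.integral_diff square_integrable_mult a b s)
    ultimately show ?thesis
      using a(3)[OF \<psi>] b(3)[OF \<psi>] by simp
  qed
  then show ?thesis
    using a b by (simp add: has_weak_partial_def square_integrable_diff)
qed

lemma integration_by_parts_smooth:
  assumes "smooth U" "smooth V"
  shows "(\<integral>x. partial_deriv i U x * V x \<partial>Omega_measure) + (\<integral>x. U x * partial_deriv i V x \<partial>Omega_measure)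
    = (\<integral>x. U x * V x * outer_normal x $ i \<partial>boundary_measure)"
proof -
  have UV: "smooth (\<lambda>x. U x * V x)"
    by (intro smooth_mult assms)
  have "(\<integral>x. U x * V x * outer_normal x $ i \<partial>boundary_measure) = (\<integral>x. partial_deriv i (\<lambda>x. U x * V x) x \<partial>Omega_measure)"
    by (intro divergence_theorem_cube[symmetric] smooth_differentiable smooth_continuous smooth_partial_deriv UV)
  also have "\<dots> = (\<integral>x. partial_deriv i U x * V x \<partial>Omega_measure) + (\<integral>x. U x * partial_deriv i V x \<partial>Omega_measure)"
    unfolding partial_deriv_smooth_mult[OF assms]
    by (intro Bochner_Integration.integral_add square_integrable_mult smooth_square_integrable_Omega smooth_partial_deriv assms)
  finally show ?thesis ..
qed

lemma smooth_has_weak_partial: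
  assumes "smooth U"
  shows "has_weak_partial i U (partial_deriv i U)"
proof -
  have "(\<integral>x. U x * partial_deriv i \<psi> x \<partial>Omega_measure) = - (\<integral>x. partial_deriv i U x * \<psi> x \<partial>Omega_measure)"
    if \<psi>: "test_function \<psi>" for \<psi>
  proof -
    have "AE x in boundary_measure. U x * \<psi> x * outer_normal x $ i = 0"
      using AE_boundary_not_interior by eventually_elim (simp add: test_function_outside[OF \<psi>] del: interior_cbox)
    then have "(\<integral>x. U x * \<psi> x * outer_normal x $ i \<partial>boundary_measure) = 0"
      by (rule integral_eq_zero_AE)
    then show ?thesis
      using integration_by_parts_smooth[OF assms test_function_smooth[OF \<psi>], of i] by simp
  qed
  then show ?thesis
    using assms by (simp add: has_weak_partial_def smooth_square_integrable_Omega smooth_partial_deriv)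
qed

text \<open>Extends the defining identity beyond test functions. It is applied to
  \<open>w * cutoff m\<close>; the extra term with \<open>w * partial_deriv i (cutoff m)\<close> is
  bounded by \<open>6 * K * |u|\<close> and tends to 0 in the open cube, so dominated convergence
  removes it. Decay at the two faces orthogonal to axis \<open>i\<close> suffices, because only the
  \<open>i\<close>-th factor of the cut-off is differentiated.\<close>

lemma weak_integration_by_parts:
  assumes u: "has_weak_partial i u g" and w: "smooth w"
    and K: "\<And>x. x \<in> Omega \<Longrightarrow> \<bar>w x\<bar> \<le> K * x $ i" "\<And>x. x \<in> Omega \<Longrightarrow> \<bar>w x\<bar> \<le> K * (1 - x $ i)"
  shows "(\<integral>x. u x * partial_deriv i w x \<partial>Omega_measure) = - (\<integral>x. g x * w x \<partial>Omega_measure)"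
proof -
  note si = has_weak_partialD(1,2)[OF u]
  have um[measurable]: "u \<in> borel_measurable Omega_measure" "g \<in> borel_measurable Omega_measure"
    using si by (auto simp: square_integrable_def)
  have sm: "\<And>f. smooth f \<Longrightarrow> f \<in> borel_measurable Omega_measure"
    by (intro square_integrable_measurable smooth_square_integrable_Omega)
  note meas = sm[OF w] sm[OF smooth_partial_deriv[OF w]] sm[OF smooth_cutoff] sm[OF smooth_partial_deriv[OF smooth_cutoff]]
  obtain L where L: "\<And>x. x \<in> Omega \<Longrightarrow> norm (partial_deriv i w x) \<le> L"
    using continuous_on_Omega_bounded[OF smooth_continuous[OF smooth_partial_deriv[OF w]]] by blast
  obtain W where W: "\<And>x. x \<in> Omega \<Longrightarrow> norm (w x) \<le> W"
    using continuous_on_Omega_bounded[OF smooth_continuous[OF w]] by blast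
  have ui: "integrable Omega_measure (\<lambda>x. (L + 6 * K) * \<bar>u x\<bar>)" "integrable Omega_measure (\<lambda>x. W * \<bar>g x\<bar>)"
    using Omega.square_integrable_imp_integrable_L1[OF si(1)] Omega.square_integrable_imp_integrable_L1[OF si(2)] by auto
  have lim1: "(\<lambda>m. \<integral>x. u x * (partial_deriv i w x * cutoff m x + w x * partial_deriv i (cutoff m) x) \<partial>Omega_measure)
      \<longlonglongrightarrow> (\<integral>x. u x * (partial_deriv i w x * 1 + 0) \<partial>Omega_measure)"
  proof (rule integral_dominated_convergence[OF _ _ ui(1)])
    show "AE x in Omega_measure. (\<lambda>m. u x * (partial_deriv i w x * cutoff m x + w x * partial_deriv i (cutoff m) x))
        \<longlonglongrightarrow> u x * (partial_deriv i w x * 1 + 0)"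
      using AE_interior_Omega
    proof eventually_elim
      case (elim x)
      have "x \<in> Omega"
        using elim interior_subset by blast
      moreover have "0 < x $ i" "x $ i < 1"
        using elim unfolding interior_Omega by blast+
      ultimately show ?case
        by (intro tendsto_intros cutoff_tendsto elim distance_times_partial_deriv_cutoff_tendsto[of x i _ K] K)
    qed
    show "AE x in Omega_measure. norm (u x * (partial_deriv i w x * cutoff m x + w x * partial_deriv i (cutoff m) x))
        \<le> (L + 6 * K) * \<bar>u x\<bar>" for m
    proof (rule AE_I2)
      fix x assume "x \<in> space (Omega_measure :: (real ^ 'a) measure)"
      then have x: "x \<in> Omega" "0 \<le> x $ i" "x $ i \<le> 1"
        by (auto simp: space_restrict_space mem_box_cart)
      have "\<bar>partial_deriv i w x * cutoff m x\<bar> \<le> L * 1"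
        unfolding abs_mult using L[OF x(1)] cutoff_bounds[of m x] by (intro mult_mono) auto
      moreover have "\<bar>w x * partial_deriv i (cutoff m) x\<bar> \<le> 6 * K"
        by (intro distance_times_partial_deriv_cutoff_bound x K)
      ultimately have "\<bar>partial_deriv i w x * cutoff m x + w x * partial_deriv i (cutoff m) x\<bar> \<le> L + 6 * K"
        by linarith
      then show "norm (u x * (partial_deriv i w x * cutoff m x + w x * partial_deriv i (cutoff m) x)) \<le> (L + 6 * K) * \<bar>u x\<bar>"
        by (simp add: abs_mult mult.commute mult_left_mono)
    qed
  qed (use meas in \<open>auto intro!: borel_measurable_times borel_measurable_add\<close>)
  have lim2: "(\<lambda>m. \<integral>x. g x * (w x * cutoff m x) \<partial>Omega_measure) \<longlonglongrightarrow> (\<integral>x. g x * (w x * 1) \<partial>Omega_measure)"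
  proof (rule integral_dominated_convergence[OF _ _ ui(2)])
    show "AE x in Omega_measure. (\<lambda>m. g x * (w x * cutoff m x)) \<longlonglongrightarrow> g x * (w x * 1)"
      using AE_interior_Omega by eventually_elim (intro tendsto_intros cutoff_tendsto)
    show "AE x in Omega_measure. norm (g x * (w x * cutoff m x)) \<le> W * \<bar>g x\<bar>" for m
    proof (rule AE_I2)
      fix x assume "x \<in> space (Omega_measure :: (real ^ 'a) measure)"
      then have x: "x \<in> Omega"
        by (auto simp: space_restrict_space)
      have "\<bar>w x * cutoff m x\<bar> \<le> W * 1"
        unfolding abs_mult using W[OF x(1)] cutoff_bounds[of m x] by (intro mult_mono) auto
      then show "norm (g x * (w x * cutoff m x)) \<le> W * \<bar>g x\<bar>"
        using mult_left_mono[of "\<bar>w x * cutoff m x\<bar>" W "\<bar>g x\<bar>"]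
        unfolding real_norm_def abs_mult[of "g x"] mult.commute[of W] by simp
    qed
  qed (use meas in \<open>auto intro!: borel_measurable_times\<close>)
  have eq: "(\<integral>x. u x * (partial_deriv i w x * cutoff m x + w x * partial_deriv i (cutoff m) x) \<partial>Omega_measure)
      = - (\<integral>x. g x * (w x * cutoff m x) \<partial>Omega_measure)" for m
    using has_weak_partialD(3)[OF u test_function_mult_cutoff[OF w], of m]
    by (simp add: partial_deriv_smooth_mult[OF w smooth_cutoff])
  show ?thesis
    using LIMSEQ_unique[OF lim1[unfolded eq] tendsto_minus[OF lim2]] by simp
qed

section \<open>Representatives of weak derivatives and the H1 norm\<close>

lemma has_weak_partial_weak_partial: "has_weak_partial i u g \<Longrightarrow> has_weak_partial i u (weak_partial i u)"
  unfolding weak_partial_def by (rule someI[of "has_weak_partial i u"])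

lemma H1_has_weak_partial: "u \<in> H1 \<Longrightarrow> has_weak_partial i u (weak_partial i u)"
  using has_weak_partial_weak_partial by (fastforce simp: H1_def)

lemma H1_I: "(\<And>i. has_weak_partial i u (g i)) \<Longrightarrow> u \<in> H1"
  by (auto simp: H1_def has_weak_partial_def)

lemma H1_square_integrable:
  assumes "u \<in> H1"
  shows "square_integrable Omega_measure u" "square_integrable Omega_measure (weak_partial i u)"
  using H1_has_weak_partial[OF assms, of i] by (simp_all add: has_weak_partial_def)

text \<open>The chosen representative agrees almost everywhere with any weak derivative, so norms
  may be computed from an explicit one.\<close>

lemma L2_norm_weak_partial:
  assumes "has_weak_partial i u g"
  shows "L2_norm Omega_measure (weak_partial i u) = L2_norm Omega_measure g"
proof (rule L2_norm_cong_AE)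
  note w = has_weak_partial_weak_partial[OF assms]
  show "weak_partial i u \<in> borel_measurable Omega_measure" "g \<in> borel_measurable Omega_measure"
    using w assms by (auto simp: has_weak_partial_def square_integrable_def)
  show "AE x in Omega_measure. weak_partial i u x = g x"
    by (rule has_weak_partial_unique[OF w assms])
qed

lemma square_integrable_weak_grad:
  assumes "u \<in> H1"
  shows "square_integrable Omega_measure (weak_grad u)"
  using H1_square_integrable(2)[OF assms] by (simp add: square_integrable_vec weak_grad_def)

lemma L2_norm_weak_grad_power2:
  assumes "u \<in> H1"
  shows "(L2_norm Omega_measure (weak_grad u))\<^sup>2 = (\<Sum>i\<in>UNIV. (L2_norm Omega_measure (weak_partial i u))\<^sup>2)"
  using L2_norm_vec_power2[OF square_integrable_weak_grad[OF assms]] by (simp add: weak_grad_def)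

lemma H1_norm_power2: "(H1_norm u)\<^sup>2 = (L2_norm Omega_measure u)\<^sup>2 + (L2_norm Omega_measure (weak_grad u))\<^sup>2"
  by (simp add: H1_norm_def)

lemma H1_norm_power2_sum:
  assumes "\<And>i. has_weak_partial i u (g i)"
  shows "(H1_norm u)\<^sup>2 = (L2_norm Omega_measure u)\<^sup>2 + (\<Sum>i\<in>UNIV. (L2_norm Omega_measure (g i))\<^sup>2)"
  using L2_norm_weak_grad_power2[OF H1_I[of u g, OF assms]] L2_norm_weak_partial[OF assms]
  by (simp add: H1_norm_power2)

lemma has_weak_partial_smooth_diff:
  assumes "smooth U" "u \<in> H1"
  shows "has_weak_partial i (\<lambda>x. U x - u x) (\<lambda>x. partial_deriv i U x - weak_partial i u x)"
  by (intro has_weak_partial_diff smooth_has_weak_partial H1_has_weak_partial assms)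

lemma L2_norm_le_H1_norm:
  assumes "\<And>i. has_weak_partial i u (g i)"
  shows "L2_norm Omega_measure u \<le> H1_norm u" "L2_norm Omega_measure (g i) \<le> H1_norm u"
proof -
  have nn: "0 \<le> H1_norm u"
    by (simp add: H1_norm_def)
  note eq = H1_norm_power2_sum[of u g, OF assms]
  show "L2_norm Omega_measure u \<le> H1_norm u"
    by (rule power2_le_imp_le[OF _ nn]) (simp add: eq sum_nonneg)
  have "(L2_norm Omega_measure (g i))\<^sup>2 \<le> (\<Sum>i\<in>UNIV. (L2_norm Omega_measure (g i))\<^sup>2)"
    by (rule member_le_sum) auto
  then show "L2_norm Omega_measure (g i) \<le> H1_norm u"
    by (intro power2_le_imp_le[OF _ nn]) (simp add: eq add_increasing)
qed

lemma H1_tendstoD: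
  assumes "\<And>m. smooth (U m)" "u \<in> H1" "(\<lambda>m. H1_norm (\<lambda>x. U m x - u x)) \<longlonglongrightarrow> 0"
  shows "(\<lambda>m. L2_norm Omega_measure (\<lambda>x. U m x - u x)) \<longlonglongrightarrow> 0"
    "(\<lambda>m. L2_norm Omega_measure (\<lambda>x. partial_deriv i (U m) x - weak_partial i u x)) \<longlonglongrightarrow> 0"
proof -
  note le = L2_norm_le_H1_norm[OF has_weak_partial_smooth_diff[OF assms(1,2)]]
  show "(\<lambda>m. L2_norm Omega_measure (\<lambda>x. U m x - u x)) \<longlonglongrightarrow> 0"
    by (rule tendsto_sandwich[OF _ _ tendsto_const assms(3)]) (auto simp: L2_norm_nonneg le)
  show "(\<lambda>m. L2_norm Omega_measure (\<lambda>x. partial_deriv i (U m) x - weak_partial i u x)) \<longlonglongrightarrow> 0"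
    by (rule tendsto_sandwich[OF _ _ tendsto_const assms(3)]) (auto simp: L2_norm_nonneg le)
qed

subsection \<open>Density of cosine polynomials\<close>

lemma L2_norm_Pair_power2:
  fixes a :: "'a \<Rightarrow> 'b::euclidean_space" and b :: "'a \<Rightarrow> 'c::euclidean_space"
  assumes "square_integrable M a" "square_integrable M b"
  shows "square_integrable M (\<lambda>x. (a x, b x))"
    "(L2_norm M (\<lambda>x. (a x, b x)))\<^sup>2 = (L2_norm M a)\<^sup>2 + (L2_norm M b)\<^sup>2"
proof -
  have "(norm (a x, b x))\<^sup>2 = (norm (a x))\<^sup>2 + (norm (b x))\<^sup>2" for x
    by (simp add: norm_Pair)
  moreover have "(\<lambda>x. (a x, b x)) \<in> borel_measurable M"
    using assms by (intro borel_measurable_Pair) (auto simp: square_integrable_def)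
  ultimately show "square_integrable M (\<lambda>x. (a x, b x))"
    "(L2_norm M (\<lambda>x. (a x, b x)))\<^sup>2 = (L2_norm M a)\<^sup>2 + (L2_norm M b)\<^sup>2"
    using assms by (auto simp: square_integrable_def L2_norm_power2)
qed

text \<open>A minimising sequence \<open>U m\<close> of cosine polynomials leaves residuals \<open>u - U m\<close> that become
  orthogonal in \<open>H\<^sup>1\<close> to every cosine tensor. As these are Neumann eigenfunctions of the Laplacian,
  integration by parts turns this into weak convergence of \<open>u - U m\<close> to zero in \<open>L\<^sup>2\<close>; the weak
  gradients then converge weakly as well, and hence the residuals tend to zero in norm.\<close>

theorem cos_span_dense_H1:
  fixes u :: "real ^ 'd \<Rightarrow> real"
  assumes u: "u \<in> H1"
  shows "\<exists>U. (\<forall>m. U m \<in> cos_span) \<and> (\<lambda>m. H1_norm (\<lambda>x. U m x - u x)) \<longlonglongrightarrow> 0"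
proof -
  let ?M = "Omega_measure :: (real ^ 'd) measure"
  \<comment> \<open>The \<open>H1_norm\<close> is the L2 norm of the pair of a function and its
    gradient. Approximation in H1 thus becomes an L2 minimisation over the graphs of cosine
    polynomials.\<close>
  define F where "F x = (u x, weak_grad u x)" for x
  define graph where "graph \<phi> x = (\<phi> x, \<chi> i. partial_deriv i \<phi> x)" for \<phi> and x :: "real ^ 'd"
  have siF: "square_integrable ?M F"
    unfolding F_def[abs_def] by (intro L2_norm_Pair_power2 H1_square_integrable square_integrable_weak_grad u)
  have si_grad: "square_integrable ?M (\<lambda>x. \<chi> i. partial_deriv i \<phi> x)" if "smooth \<phi>" for \<phi>
    using that by (simp add: square_integrable_vec smooth_square_integrable_Omega smooth_partial_deriv)
  have si_graph: "square_integrable ?M (graph \<phi>)" if "smooth \<phi>" for \<phi>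
    unfolding graph_def[abs_def] by (intro L2_norm_Pair_power2 smooth_square_integrable_Omega si_grad that)
  have V: "\<And>\<phi>. \<phi> \<in> graph ` cos_span \<Longrightarrow> square_integrable ?M \<phi>" "graph ` cos_span \<noteq> {}"
    using si_graph cos_span_smooth cos_span.zero by auto
  have add: "(\<lambda>x. \<phi>' x + t *\<^sub>R \<psi>' x) \<in> graph ` cos_span"
    if "\<phi>' \<in> graph ` cos_span" "\<psi>' \<in> graph ` cos_span" for \<phi>' \<psi>' t
  proof -
    obtain \<phi> \<psi> where *: "\<phi> \<in> cos_span" "\<psi> \<in> cos_span" "\<phi>' = graph \<phi>" "\<psi>' = graph \<psi>"
      using \<open>\<phi>' \<in> graph ` cos_span\<close> \<open>\<psi>' \<in> graph ` cos_span\<close> by blast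
    note s = cos_span_smooth[OF *(1)] cos_span_smooth[OF *(2)]
    have "(\<lambda>x. graph \<phi> x + t *\<^sub>R graph \<psi> x) = graph (\<lambda>x. \<phi> x + t * \<psi> x)"
      by (rule ext) (simp add: graph_def vec_eq_iff partial_deriv_smooth_add partial_deriv_smooth_cmult
          smooth_mult smooth_const s)
    then show ?thesis
      using * cos_span_add[OF cos_span_cmult[OF *(2)] *(1)] by auto
  qed
  from L2_minimizing_sequence[OF siF V add] obtain w B where w: "\<And>m. w m \<in> graph ` cos_span" "\<And>m. L2_norm ?M (\<lambda>x. F x - w m x) \<le> B"
    "\<And>\<phi>. \<phi> \<in> graph ` cos_span \<Longrightarrow> (\<lambda>m. \<integral>x. (F x - w m x) \<bullet> \<phi> x \<partial>?M) \<longlonglongrightarrow> 0"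
    "(\<lambda>m. \<integral>x. (F x - w m x) \<bullet> w m x \<partial>?M) \<longlonglongrightarrow> 0"
    by blast
  from w(1) have "\<forall>m. \<exists>U. U \<in> cos_span \<and> w m = graph U" by blast
  then obtain U where U: "\<And>m. U m \<in> cos_span" "\<And>m. w m = graph (U m)" by metis
  note sU = cos_span_smooth[OF U(1)]
  define \<rho> where "\<rho> m x = u x - U m x" for m x
  define r where "r m i x = weak_partial i u x - partial_deriv i (U m) x" for m i x
  have \<rho>r: "has_weak_partial i (\<rho> m) (r m i)" for m i
    unfolding \<rho>_def[abs_def] r_def[abs_def] by (intro has_weak_partial_diff smooth_has_weak_partial H1_has_weak_partial u sU)
  note si = has_weak_partialD(1,2)[OF \<rho>r]
  have si_r: "square_integrable ?M (\<lambda>x. \<chi> i. r m i x)" for m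
    by (simp add: square_integrable_vec si)
  have Fw: "F x - w m x = (\<rho> m x, \<chi> i. r m i x)" for m x
    by (simp add: F_def U graph_def \<rho>_def r_def weak_grad_def vec_eq_iff)
  have normFw: "(L2_norm ?M (\<lambda>x. F x - w m x))\<^sup>2 = (L2_norm ?M (\<rho> m))\<^sup>2 + (\<Sum>i\<in>UNIV. (L2_norm ?M (r m i))\<^sup>2)" for m
    unfolding Fw using L2_norm_Pair_power2(2)[OF si(1) si_r] L2_norm_vec_power2[OF si_r] by simp
  have B: "0 \<le> B"
    using w(2)[of 0] L2_norm_nonneg[of ?M "\<lambda>x. F x - w 0 x"] by simp
  have sq: "(L2_norm ?M (\<lambda>x. F x - w m x))\<^sup>2 \<le> B\<^sup>2" for m
    by (intro power_mono w L2_norm_nonneg)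
  have bound\<rho>: "L2_norm ?M (\<rho> m) \<le> B" for m
  proof (rule power2_le_imp_le[OF _ B])
    have "0 \<le> (\<Sum>i\<in>UNIV. (L2_norm ?M (r m i))\<^sup>2)"
      by (simp add: sum_nonneg)
    then show "(L2_norm ?M (\<rho> m))\<^sup>2 \<le> B\<^sup>2"
      using sq[of m] normFw[of m] by linarith
  qed
  have boundr: "L2_norm ?M (r m i) \<le> B" for m i
  proof (rule power2_le_imp_le[OF _ B])
    have "(L2_norm ?M (r m i))\<^sup>2 \<le> (\<Sum>i\<in>UNIV. (L2_norm ?M (r m i))\<^sup>2)"
      by (rule member_le_sum) auto
    moreover have "0 \<le> (L2_norm ?M (\<rho> m))\<^sup>2" by simp
    ultimately show "(L2_norm ?M (r m i))\<^sup>2 \<le> B\<^sup>2"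
      using sq[of m] normFw[of m] by linarith
  qed
  have inner: "(\<integral>x. (F x - w m x) \<bullet> (\<phi> x, \<chi> i. g i x) \<partial>?M)
      = (\<integral>x. \<rho> m x * \<phi> x \<partial>?M) + (\<Sum>i\<in>UNIV. \<integral>x. r m i x * g i x \<partial>?M)"
    if "square_integrable ?M \<phi>" "\<And>i. square_integrable ?M (g i)" for \<phi> g m
    unfolding Fw inner_Pair inner_vec_def using that si
    by (simp add: square_integrable_mult mult.commute[of "\<rho> m _"] mult.commute[of "r m _ _"])
  have lim_tensor: "(\<lambda>m. \<integral>x. \<rho> m x * cos_tensor k x \<partial>?M) \<longlonglongrightarrow> 0" for k
  proof -
    \<comment> \<open>The eigenvalue of the identity minus the Laplacian on
      \<open>cos_tensor k\<close>; being positive, it can be divided out to recover the pairing with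
      \<open>\<rho> m\<close>.\<close>
    let ?c = "1 + (\<Sum>i\<in>UNIV. (pi * real_of_int (k i))\<^sup>2)"
    have c: "0 < ?c"
      by (intro add_pos_nonneg sum_nonneg) auto
    have part: "(\<integral>x. r m i x * partial_deriv i (cos_tensor k) x \<partial>?M) = (pi * k i)\<^sup>2 * (\<integral>x. \<rho> m x * cos_tensor k x \<partial>?M)" for m i
    proof -
      have "(\<integral>x. \<rho> m x * partial_deriv i (sin_tensor i k) x \<partial>?M) = - (\<integral>x. r m i x * sin_tensor i k x \<partial>?M)"
        by (rule weak_integration_by_parts[OF \<rho>r smooth_sin_tensor abs_sin_tensor_le])
      then have "(\<integral>x. r m i x * sin_tensor i k x \<partial>?M) = - (pi * k i) * (\<integral>x. \<rho> m x * cos_tensor k x \<partial>?M)"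
        by (simp add: partial_deriv_sin_tensor mult.left_commute[of "\<rho> m _"])
      then show ?thesis
        by (simp add: partial_deriv_cos_tensor mult.left_commute[of "r m i _"] power2_eq_square)
    qed
    have "(\<integral>x. (F x - w m x) \<bullet> graph (cos_tensor k) x \<partial>?M) = ?c * (\<integral>x. \<rho> m x * cos_tensor k x \<partial>?M)" for m
      unfolding graph_def
      by (subst inner) (auto simp: part smooth_square_integrable_Omega smooth_cos_tensor smooth_partial_deriv
          distrib_right sum_distrib_right)
    moreover have "graph (cos_tensor k) \<in> graph ` cos_span"
      using cos_span_tensor[of 1 k] by simp
    ultimately have "(\<lambda>m. ?c * (\<integral>x. \<rho> m x * cos_tensor k x \<partial>?M)) \<longlonglongrightarrow> 0"
      using w(3) by fastforce
    from tendsto_mult[OF tendsto_const[of "1 / ?c"] this] show ?thesis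
      using c by simp
  qed
  have lim_span: "(\<lambda>m. \<integral>x. \<rho> m x * f x \<partial>?M) \<longlonglongrightarrow> 0" if "f \<in> cos_span" for f
    using that
  proof (induction rule: cos_span.induct)
    case (step f c k)
    have "(\<integral>x. \<rho> m x * (f x + c * cos_tensor k x) \<partial>?M) = (\<integral>x. \<rho> m x * f x \<partial>?M) + c * (\<integral>x. \<rho> m x * cos_tensor k x \<partial>?M)" for m
    proof -
      have "integrable ?M (\<lambda>x. \<rho> m x * f x)" "integrable ?M (\<lambda>x. \<rho> m x * cos_tensor k x)"
        by (intro square_integrable_mult si smooth_square_integrable_Omega cos_span_smooth step.hyps smooth_cos_tensor)+
      then show ?thesis
        by (simp add: distrib_left mult.left_commute[of "\<rho> m _"])
    qed
    then show ?case
      using tendsto_add[OF step.IH tendsto_mult[OF tendsto_const lim_tensor], of c k] by simp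
  qed simp
  have lim\<rho>: "(\<lambda>m. \<integral>x. \<rho> m x * f x \<partial>?M) \<longlonglongrightarrow> 0" if f: "square_integrable ?M f" for f :: "real ^ 'd \<Rightarrow> real"
  proof -
    have "(\<lambda>m. \<integral>x. \<rho> m x \<bullet> f x \<partial>?M) \<longlonglongrightarrow> 0"
    proof (rule L2_bounded_weak_limit[OF si(1) bound\<rho> f])
      fix e :: real assume "0 < e"
      from cos_span_dense[OF f this] obtain p where "p \<in> cos_span" "L2_norm ?M (\<lambda>x. f x - p x) < e" .
      then show "\<exists>g. square_integrable ?M g \<and> L2_norm ?M (\<lambda>x. f x - g x) < e \<and> (\<lambda>m. \<integral>x. \<rho> m x \<bullet> g x \<partial>?M) \<longlonglongrightarrow> 0"
        using lim_span by (auto intro!: exI[of _ p] smooth_square_integrable_Omega cos_span_smooth simp: mult.commute)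
    qed
    then show ?thesis by (simp add: mult.commute)
  qed
  have limr: "(\<lambda>m. \<integral>x. r m i x * f x \<partial>?M) \<longlonglongrightarrow> 0" if f: "square_integrable ?M f" for i and f :: "real ^ 'd \<Rightarrow> real"
  proof -
    have "(\<lambda>m. \<integral>x. r m i x \<bullet> f x \<partial>?M) \<longlonglongrightarrow> 0"
    proof (rule L2_bounded_weak_limit[OF si(2) boundr f])
      fix e :: real assume "0 < e"
      from test_function_dense[OF f this] obtain \<psi> where \<psi>: "test_function \<psi>" "L2_norm ?M (\<lambda>x. f x - \<psi> x) < e" .
      \<comment> \<open>A test function takes over the derivative, which reduces the gradient
        residual to the weak limit of \<open>\<rho> m\<close> already known.\<close>
      have "(\<lambda>m. - (\<integral>x. \<rho> m x * partial_deriv i \<psi> x \<partial>?M)) \<longlonglongrightarrow> - 0"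
        by (intro tendsto_minus lim\<rho> smooth_square_integrable_Omega smooth_partial_deriv test_function_smooth \<psi>)
      then have "(\<lambda>m. \<integral>x. r m i x * \<psi> x \<partial>?M) \<longlonglongrightarrow> 0"
        using has_weak_partialD(3)[OF \<rho>r \<psi>(1)] by simp
      then show "\<exists>g. square_integrable ?M g \<and> L2_norm ?M (\<lambda>x. f x - g x) < e \<and> (\<lambda>m. \<integral>x. r m i x \<bullet> g x \<partial>?M) \<longlonglongrightarrow> 0"
        using \<psi> by (intro exI[of _ \<psi>]) (auto intro!: smooth_square_integrable_Omega test_function_smooth simp: mult.commute)
    qed
    then show ?thesis by (simp add: mult.commute)
  qed
  have "(\<lambda>m. (\<integral>x. \<rho> m x * u x \<partial>?M) + (\<Sum>i\<in>UNIV. \<integral>x. r m i x * weak_partial i u x \<partial>?M)) \<longlonglongrightarrow> 0 + (\<Sum>i\<in>(UNIV::'d set). 0)"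
    by (intro tendsto_add tendsto_sum lim\<rho> limr H1_square_integrable u)
  then have "(\<lambda>m. (\<integral>x. (F x - w m x) \<bullet> F x \<partial>?M)) \<longlonglongrightarrow> 0"
    unfolding inner[OF H1_square_integrable[OF u], symmetric] by (simp add: F_def weak_grad_def)
  from tendsto_diff[OF this w(4)]
  have "(\<lambda>m. (L2_norm ?M (\<lambda>x. F x - w m x))\<^sup>2) \<longlonglongrightarrow> 0"
  proof -
    \<comment> \<open>Both pairings tend to 0: the one with the fixed \<open>F\<close> by weak
      convergence, the one with the moving \<open>w m\<close> by minimality. This upgrades weak to
      strong convergence.\<close>
    have "(L2_norm ?M (\<lambda>x. F x - w m x))\<^sup>2 = (\<integral>x. (F x - w m x) \<bullet> F x \<partial>?M) - (\<integral>x. (F x - w m x) \<bullet> w m x \<partial>?M)" for m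
    proof -
      have "square_integrable ?M (w m)"
        using si_graph[OF sU] U by simp
      from square_integrable_inner[OF square_integrable_diff[OF siF this] siF]
        square_integrable_inner[OF square_integrable_diff[OF siF this] this]
      show ?thesis
        unfolding L2_norm_power2 power2_norm_eq_inner
        by (subst Bochner_Integration.integral_diff[symmetric]) (auto simp: inner_diff_right)
    qed
    with \<open>(\<lambda>m. (\<integral>x. (F x - w m x) \<bullet> F x \<partial>?M) - (\<integral>x. (F x - w m x) \<bullet> w m x \<partial>?M)) \<longlonglongrightarrow> 0 - 0\<close>
    show ?thesis by simp
  qed
  moreover have "(L2_norm ?M (\<lambda>x. F x - w m x))\<^sup>2 = (H1_norm (\<lambda>x. U m x - u x))\<^sup>2" for m
    unfolding normFw H1_norm_power2_sum[OF has_weak_partial_smooth_diff[OF sU u]] \<rho>_def[abs_def] r_def[abs_def]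
    by (simp add: L2_norm_minus_commute[of _ u] L2_norm_minus_commute[of _ "weak_partial _ u"])
  ultimately have "(\<lambda>m. (H1_norm (\<lambda>x. U m x - u x))\<^sup>2) \<longlonglongrightarrow> 0"
    by simp
  from tendsto_real_sqrt[OF this] have "(\<lambda>m. H1_norm (\<lambda>x. U m x - u x)) \<longlonglongrightarrow> 0"
    by (simp add: H1_norm_def)
  then show ?thesis
    using U(1) by blast
qed

subsection \<open>The Poincare inequality\<close>

definition dirichlet_form :: "(real ^ 'd \<Rightarrow> real) \<Rightarrow> (real ^ 'd \<Rightarrow> real) \<Rightarrow> real" where
  "dirichlet_form f g = (\<Sum>i\<in>UNIV. \<integral>x. partial_deriv i f x * partial_deriv i g x \<partial>Omega_measure)"

text \<open>Weak form: \<open>g\<close> ranges over all smooth functions and need not vanish at the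
  boundary, which encodes the Neumann condition. The zero function counts for every
  \<open>l\<close>.\<close>

definition neumann_eigenfunction :: "real \<Rightarrow> (real ^ 'd \<Rightarrow> real) \<Rightarrow> bool" where
  "neumann_eigenfunction l f \<longleftrightarrow> smooth f \<and>
    (\<forall>g. smooth g \<longrightarrow> dirichlet_form f g = l * (\<integral>x. f x * g x \<partial>Omega_measure))"

lemma integrable_smooth_mult:
  "smooth f \<Longrightarrow> smooth g \<Longrightarrow> integrable Omega_measure (\<lambda>x. f x * g x)"
  by (intro square_integrable_mult smooth_square_integrable_Omega)

lemma dirichlet_form_commute: "dirichlet_form f g = dirichlet_form g f"
  by (simp add: dirichlet_form_def mult.commute)

lemma dirichlet_form_add:
  assumes "smooth f" "smooth g" "smooth h"
  shows "dirichlet_form (\<lambda>x. f x + g x) h = dirichlet_form f h + dirichlet_form g h"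
  unfolding dirichlet_form_def
  by (simp add: partial_deriv_smooth_add distrib_right integrable_smooth_mult smooth_partial_deriv assms sum.distrib)

lemma dirichlet_form_cmult:
  "smooth f \<Longrightarrow> dirichlet_form (\<lambda>x. c * f x) h = c * dirichlet_form f h"
  by (simp add: dirichlet_form_def partial_deriv_smooth_cmult mult.assoc sum_distrib_left)

lemma dirichlet_form_zero: "dirichlet_form (\<lambda>x. 0) h = 0"
  by (simp add: dirichlet_form_def partial_deriv_const)

lemma dirichlet_form_sum:
  assumes "\<And>i. i \<in> I \<Longrightarrow> smooth (f i)" "smooth h"
  shows "dirichlet_form (\<lambda>x. \<Sum>i\<in>I. f i x) h = (\<Sum>i\<in>I. dirichlet_form (f i) h)"
  using assms(1)
  by (induction I rule: infinite_finite_induct)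
    (auto simp: dirichlet_form_zero dirichlet_form_add smooth_sum assms(2))

lemma neumann_eigenfunction_add:
  assumes "neumann_eigenfunction l f" "neumann_eigenfunction l g"
  shows "neumann_eigenfunction l (\<lambda>x. f x + g x)"
proof -
  have "smooth f" "smooth g"
    using assms by (auto simp: neumann_eigenfunction_def)
  then show ?thesis
    using assms by (auto simp: neumann_eigenfunction_def smooth_add dirichlet_form_add distrib_right
        integrable_smooth_mult distrib_left)
qed

text \<open>Integration by parts in direction \<open>i\<close> leaves no boundary term, because the
  derivative of the tensor is a multiple of \<open>sin_tensor i k\<close>.\<close>

lemma neumann_eigenfunction_cos_tensor:
  "neumann_eigenfunction (\<Sum>i\<in>UNIV. (pi * real_of_int (k i))\<^sup>2) (\<lambda>x. c * cos_tensor k x)"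
  unfolding neumann_eigenfunction_def
proof (intro conjI allI impI)
  show "smooth (\<lambda>x. c * cos_tensor k x)"
    by (intro smooth_mult smooth_const smooth_cos_tensor)
  fix g :: "real ^ 'a \<Rightarrow> real" assume g: "smooth g"
  have "(\<integral>x. partial_deriv i (cos_tensor k) x * partial_deriv i g x \<partial>Omega_measure)
      = (pi * real_of_int (k i))\<^sup>2 * (\<integral>x. cos_tensor k x * g x \<partial>Omega_measure)" for i
  proof -
    have "(\<integral>x. g x * partial_deriv i (sin_tensor i k) x \<partial>Omega_measure)
        = - (\<integral>x. partial_deriv i g x * sin_tensor i k x \<partial>Omega_measure)"
      by (rule weak_integration_by_parts[OF smooth_has_weak_partial[OF g] smooth_sin_tensor abs_sin_tensor_le])
    moreover have "g x * partial_deriv i (sin_tensor i k) x = (pi * k i) * (cos_tensor k x * g x)" for x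
      by (simp add: partial_deriv_sin_tensor)
    ultimately have "(\<integral>x. sin_tensor i k x * partial_deriv i g x \<partial>Omega_measure)
        = - (pi * k i) * (\<integral>x. cos_tensor k x * g x \<partial>Omega_measure)"
      by (simp add: mult.commute[of _ "sin_tensor i k _"])
    then show ?thesis
      by (simp add: partial_deriv_cos_tensor mult.assoc power2_eq_square)
  qed
  then have "dirichlet_form (cos_tensor k) g = (\<Sum>i\<in>UNIV. (pi * real_of_int (k i))\<^sup>2) * (\<integral>x. cos_tensor k x * g x \<partial>Omega_measure)"
    by (simp add: dirichlet_form_def sum_distrib_right)
  then show "dirichlet_form (\<lambda>x. c * cos_tensor k x) g
      = (\<Sum>i\<in>UNIV. (pi * real_of_int (k i))\<^sup>2) * (\<integral>x. c * cos_tensor k x * g x \<partial>Omega_measure)"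
    by (simp add: dirichlet_form_cmult smooth_cos_tensor mult.assoc)
qed

text \<open>Tensors with equal eigenvalue are merged into one summand, so that distinct summands
  have distinct eigenvalues and orthogonality follows without computing integrals of cosines. The
  gap of 1 is a crude form of pi^2.\<close>

lemma cos_span_eigen_decomposition:
  assumes "f \<in> cos_span"
  obtains L v c where "finite L" "0 \<in> L" "\<And>l. l \<in> L \<Longrightarrow> l = 0 \<or> 1 \<le> l"
    "\<And>l. neumann_eigenfunction l (v l)" "v 0 = (\<lambda>_. c)" "f = (\<lambda>x. \<Sum>l\<in>L. v l x)"
proof -
  \<comment> \<open>The induction also carries that \<open>v\<close> is zero outside
    \<open>L\<close>; then adding a tensor to \<open>v q\<close> is correct whether or not
    \<open>q\<close> already belongs to \<open>L\<close>.\<close>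
  have "\<exists>L v c. finite L \<and> 0 \<in> L \<and> (\<forall>l\<in>L. l = 0 \<or> 1 \<le> l) \<and> (\<forall>l. l \<notin> L \<longrightarrow> v l = (\<lambda>x. 0)) \<and>
      (\<forall>l. neumann_eigenfunction l (v l)) \<and> v 0 = (\<lambda>_. c) \<and> f = (\<lambda>x. \<Sum>l\<in>L. v l x)"
    using assms
  proof (induction rule: cos_span.induct)
    case zero
    show ?case
      by (rule exI[of _ "{0}"], rule exI[of _ "\<lambda>_ _. 0"], rule exI[of _ 0])
        (auto simp: neumann_eigenfunction_def smooth_const dirichlet_form_zero)
  next
    case (step f a k)
    then obtain L v c where *: "finite L" "0 \<in> L" "\<forall>l\<in>L. l = 0 \<or> 1 \<le> l" "\<forall>l. l \<notin> L \<longrightarrow> v l = (\<lambda>x. 0)"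
      "\<forall>l. neumann_eigenfunction l (v l)" "v 0 = (\<lambda>_. c)" "f = (\<lambda>x. \<Sum>l\<in>L. v l x)" by blast
    define q where "q = (\<Sum>i\<in>UNIV. (pi * real_of_int (k i))\<^sup>2)"
    define w where "w = v(q := (\<lambda>x. v q x + a * cos_tensor k x))"
    \<comment> \<open>A non-zero frequency has an integer entry of modulus at least 1, and pi
      exceeds 1. Conversely \<open>q = 0\<close> forces the constant tensor, which keeps
      \<open>v 0\<close> constant.\<close>
    have q: "(q = 0 \<and> k = (\<lambda>_. 0)) \<or> 1 \<le> q"
    proof (cases "k = (\<lambda>_. 0)")
      case False
      then obtain j where "k j \<noteq> 0" by auto
      then have "1 \<le> \<bar>k j\<bar>" by linarith
      then have "1 \<le> \<bar>real_of_int (k j)\<bar>" by linarith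
      then have "1 * 1 \<le> pi * \<bar>real_of_int (k j)\<bar>"
        using pi_gt3 by (intro mult_mono) auto
      then have "1 \<le> (pi * real_of_int (k j))\<^sup>2"
        by (simp add: abs_mult flip: abs_le_square_iff[of 1, simplified])
      also have "\<dots> \<le> q"
        unfolding q_def by (rule member_le_sum) auto
      finally show ?thesis by simp
    qed (simp add: q_def)
    have eig: "neumann_eigenfunction l (w l)" for l
      using * neumann_eigenfunction_add[OF _ neumann_eigenfunction_cos_tensor, of k "v q" a]
      by (auto simp: w_def q_def)
    have const: "w 0 = (\<lambda>_. if q = 0 then c + a else c)"
      using q * by (auto simp: w_def cos_tensor_def)
    have "(\<Sum>l\<in>insert q L. w l x) = f x + a * cos_tensor k x" for x
    proof -
      have "(\<Sum>l\<in>insert q L. w l x) = (\<Sum>l\<in>insert q L. v l x + (if l = q then a * cos_tensor k x else 0))"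
        by (intro sum.cong) (auto simp: w_def)
      also have "\<dots> = (\<Sum>l\<in>insert q L. v l x) + a * cos_tensor k x"
        using *(1) by (simp add: sum.distrib)
      also have "(\<Sum>l\<in>insert q L. v l x) = f x"
        using * by (cases "q \<in> L") (auto simp: insert_absorb)
      finally show ?thesis .
    qed
    then show ?case
      using * q eig const
      by (intro exI[of _ "insert q L"] exI[of _ w] exI[of _ "if q = 0 then c + a else c"])
        (auto simp: w_def)
  qed
  then show thesis
    using that by blast
qed

text \<open>Parseval for the eigenvalue decomposition: the summand with \<open>l = 0\<close>
  contributes the squared mean, and every other one is at most \<open>l\<close> times itself, which
  is its share of the Dirichlet form.\<close>

lemma poincare_cos_span:
  assumes "f \<in> cos_span"
  shows "(\<integral>x. f x * f x \<partial>Omega_measure) \<le> (\<integral>x. f x \<partial>Omega_measure)\<^sup>2 + dirichlet_form f f"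
proof -
  obtain L v c where L: "finite L" "0 \<in> L" "\<And>l. l \<in> L \<Longrightarrow> l = 0 \<or> 1 \<le> l"
    and v: "\<And>l. neumann_eigenfunction l (v l)" "v 0 = (\<lambda>_. c)" "f = (\<lambda>x. \<Sum>l\<in>L. v l x)"
    using cos_span_eigen_decomposition[OF assms] by blast
  define ip where "ip g h = (\<integral>x. g x * h x \<partial>Omega_measure)" for g h :: "real ^ 'a \<Rightarrow> real"
  have sv: "smooth (v l)" for l
    using v(1) by (simp add: neumann_eigenfunction_def)
  have D: "dirichlet_form (v l) g = l * ip (v l) g" if "smooth g" for l g
    using v(1) that by (simp add: neumann_eigenfunction_def ip_def)
  have sf: "smooth f"
    by (rule cos_span_smooth[OF assms])
  have ip_commute: "ip g h = ip h g" for g h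
    by (simp add: ip_def mult.commute)
  \<comment> \<open>By symmetry of the Dirichlet form both eigenvalues multiply the same inner
    product, so it vanishes when they differ.\<close>
  have orth: "ip (v l) (v l') = 0" if "l \<noteq> l'" for l l'
  proof -
    have "l * ip (v l) (v l') = l' * ip (v l) (v l')"
      using D[OF sv, of l l'] D[OF sv, of l' l] dirichlet_form_commute[of "v l" "v l'"]
        ip_commute[of "v l" "v l'"]
      by auto
    then show ?thesis
      using that by simp
  qed
  have ip_sum: "ip (\<lambda>x. \<Sum>l\<in>L. v l x) g = (\<Sum>l\<in>L. ip (v l) g)" if "smooth g" for g
    unfolding ip_def using sv that by (simp add: sum_distrib_right integrable_smooth_mult)
  have ip_vf: "ip (v l) f = ip (v l) (v l)" if "l \<in> L" for l
  proof -
    have "ip (v l) f = ip f (v l)"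
      by (rule ip_commute)
    also have "\<dots> = (\<Sum>l'\<in>L. ip (v l') (v l))"
      using ip_sum[OF sv] v(3) by simp
    also have "\<dots> = (\<Sum>l'\<in>L. if l' = l then ip (v l) (v l) else 0)"
      by (intro sum.cong) (auto simp: orth)
    finally show ?thesis
      using L that by simp
  qed
  have ff: "ip f f = (\<Sum>l\<in>L. ip (v l) (v l))"
    using ip_sum[OF sf] v(3) ip_vf by simp
  have Dff: "dirichlet_form f f = (\<Sum>l\<in>L. l * ip (v l) (v l))"
  proof -
    have "dirichlet_form f f = dirichlet_form (\<lambda>x. \<Sum>l\<in>L. v l x) f"
      using v(3) by simp
    also have "\<dots> = (\<Sum>l\<in>L. l * ip (v l) f)"
      by (subst dirichlet_form_sum) (auto simp: sv sf D)
    finally show ?thesis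
      using ip_vf by simp
  qed
  have mean: "(\<integral>x. f x \<partial>Omega_measure) = c"
  proof -
    \<comment> \<open>The constant 1 has Dirichlet form 0 with everything, so it is orthogonal to
      the summands with non-zero eigenvalue.\<close>
    have "ip (v l) (\<lambda>x. 1) = (if l = 0 then c else 0)" for l
    proof -
      have "l * ip (v l) (\<lambda>x. 1) = 0"
        using D[OF smooth_const[of 1], of l] dirichlet_form_commute[of "v l" "\<lambda>x. 1"]
        by (simp add: dirichlet_form_def partial_deriv_const)
      moreover have "ip (v 0) (\<lambda>x. 1) = c"
        by (simp add: v(2) ip_def space_restrict_space measure_Omega)
      ultimately show ?thesis by auto
    qed
    then have "ip f (\<lambda>x. 1) = c"
      using ip_sum[OF smooth_const[of 1]] v(3) L by simp
    then show ?thesis by (simp add: ip_def)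
  qed
  have "ip (v 0) (v 0) = c\<^sup>2"
    by (simp add: v(2) ip_def power2_eq_square space_restrict_space measure_Omega)
  moreover have "ip f f = ip (v 0) (v 0) + (\<Sum>l\<in>L - {0}. ip (v l) (v l))"
    unfolding ff using L by (simp add: sum.remove)
  moreover have "(\<Sum>l\<in>L - {0}. ip (v l) (v l)) \<le> (\<Sum>l\<in>L - {0}. l * ip (v l) (v l))"
  proof (rule sum_mono)
    fix l assume "l \<in> L - {0}"
    then have "1 \<le> l" using L by blast
    moreover have "0 \<le> ip (v l) (v l)"
      by (simp add: ip_def)
    ultimately show "ip (v l) (v l) \<le> l * ip (v l) (v l)"
      using mult_right_mono by fastforce
  qed
  moreover have "dirichlet_form f f = (\<Sum>l\<in>L - {0}. l * ip (v l) (v l))"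
    unfolding Dff using L by (simp add: sum.remove)
  ultimately show ?thesis
    using mean by (simp add: ip_def)
qed

lemma poincare_inequality:
  assumes "u \<in> H1"
  shows "(L2_norm Omega_measure u)\<^sup>2 \<le> (\<integral>x. u x \<partial>Omega_measure)\<^sup>2 + (L2_norm Omega_measure (weak_grad u))\<^sup>2"
proof -
  obtain U where U: "\<And>m. U m \<in> cos_span" "(\<lambda>m. H1_norm (\<lambda>x. U m x - u x)) \<longlonglongrightarrow> 0"
    using cos_span_dense_H1[OF assms] by blast
  note sU = cos_span_smooth[OF U(1)]
  note lim = H1_tendstoD[OF sU assms U(2)]
  note si = smooth_square_integrable_Omega[OF sU] smooth_square_integrable_Omega[OF smooth_partial_deriv[OF sU]]
    H1_square_integrable[OF assms]
  \<comment> \<open>The factor 1 turns the mean into an L2 pairing, to which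
    \<open>L2_tendsto_mult\<close> applies.\<close>
  have "(\<lambda>m. (\<integral>x. U m x * 1 \<partial>Omega_measure)\<^sup>2 + dirichlet_form (U m) (U m))
      \<longlonglongrightarrow> (\<integral>x. u x * 1 \<partial>Omega_measure)\<^sup>2 + (\<Sum>i\<in>UNIV. \<integral>x. weak_partial i u x * weak_partial i u x \<partial>Omega_measure)"
    unfolding dirichlet_form_def
    by (intro tendsto_intros L2_tendsto_mult si lim smooth_square_integrable_Omega smooth_const)
      (simp add: L2_norm_def)
  then have "(\<integral>x. u x * u x \<partial>Omega_measure)
      \<le> (\<integral>x. u x * 1 \<partial>Omega_measure)\<^sup>2 + (\<Sum>i\<in>UNIV. \<integral>x. weak_partial i u x * weak_partial i u x \<partial>Omega_measure)"
  proof (rule LIMSEQ_le[rotated])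
    show "(\<lambda>m. \<integral>x. U m x * U m x \<partial>Omega_measure) \<longlonglongrightarrow> (\<integral>x. u x * u x \<partial>Omega_measure)"
      by (intro L2_tendsto_mult si lim)
  qed (use poincare_cos_span[OF U(1)] in auto)
  then show ?thesis
    unfolding L2_norm_weak_grad_power2[OF assms] unfolding L2_norm_power2
    by (simp flip: power2_eq_square)
qed

subsection \<open>Completeness of \<open>L\<^sup>2\<close>\<close>

text \<open>Riesz-Fischer. A subsequence with geometrically small differences converges almost
  everywhere, and Fatou's lemma bounds the distance of \<open>F m\<close> to the limit by
  \<open>\<bar>e m\<bar>\<close>. A Cauchy bound of the form \<open>e m + e l\<close> is what
  approximation errors towards a common target produce.\<close>

lemma L2_complete:
  fixes F :: "nat \<Rightarrow> 'a \<Rightarrow> real"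
  assumes si: "\<And>m. square_integrable M (F m)" and e: "e \<longlonglongrightarrow> 0"
    and cauchy: "\<And>m l. L2_norm M (\<lambda>x. F m x - F l x) \<le> e m + e l"
  shows "\<exists>g. square_integrable M g \<and> (\<lambda>m. L2_norm M (\<lambda>x. F m x - g x)) \<longlonglongrightarrow> 0"
proof -
  have [measurable]: "F m \<in> borel_measurable M" for m
    using si by (simp add: square_integrable_def)
  have "\<exists>n\<ge>k. \<forall>m\<ge>n. e m \<le> (1 / 2) ^ k" for k
  proof -
    obtain N where "\<And>m. m \<ge> N \<Longrightarrow> \<bar>e m\<bar> < (1 / 2) ^ k"
      using LIMSEQ_D[OF e, of "(1 / 2) ^ k"] by auto
    then show ?thesis
      by (intro exI[of _ "max k N"]) (auto dest: order.strict_implies_order abs_le_D1)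
  qed
  then obtain r where r: "\<And>k. k \<le> r k" "\<And>k m. r k \<le> m \<Longrightarrow> e m \<le> (1 / 2) ^ k"
    by metis
  define s where "s k = Max (r ` {..k})" for k
  have s: "k \<le> s k" "e (s k) \<le> (1 / 2) ^ k" for k
  proof -
    have "r k \<le> s k"
      unfolding s_def by (intro Max_ge) auto
    then show "k \<le> s k" "e (s k) \<le> (1 / 2) ^ k"
      using r by (auto intro: order.trans)
  qed
  define d where "d k x = F (s (Suc k)) x - F (s k) x" for k x
  have [measurable]: "d k \<in> borel_measurable M" for k
    unfolding d_def by measurable
  have sid: "square_integrable M (d k)" for k
    unfolding d_def[abs_def] by (intro square_integrable_diff si)
  have dle: "(L2_norm M (d k))\<^sup>2 \<le> 4 * (1 / 4) ^ k" for k
  proof -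
    have "e (s (Suc k)) \<le> (1 / 2) ^ k"
      by (rule order.trans[OF s(2)[of "Suc k"] power_decreasing]) auto
    then have "L2_norm M (d k) \<le> 2 * (1 / 2) ^ k"
      unfolding d_def[abs_def] using cauchy[of "s (Suc k)" "s k"] s(2)[of k] by linarith
    then have "(L2_norm M (d k))\<^sup>2 \<le> (2 * (1 / 2) ^ k)\<^sup>2"
      by (intro power_mono L2_norm_nonneg)
    also have "(2 * (1 / 2 :: real) ^ k)\<^sup>2 = 4 * ((1 / 2) ^ k * (1 / 2) ^ k)"
      by (simp add: power2_eq_square)
    also have "(1 / 2 :: real) ^ k * (1 / 2) ^ k = (1 / 4) ^ k"
      by (simp flip: power_mult_distrib)
    finally show ?thesis .
  qed
  \<comment> \<open>The weight \<open>2 ^ k\<close> still leaves a convergent series, as the squared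
    norms are at most \<open>4 * (1 / 4) ^ k\<close>. Where the weighted sum \<open>S\<close> is
    finite, \<open>\<bar>d k x\<bar> \<le> sqrt S * (1 / sqrt 2) ^ k\<close>, which is
    summable.\<close>
  have "(\<integral>\<^sup>+x. (\<Sum>k. ennreal (2 ^ k * (d k x)\<^sup>2)) \<partial>M) = (\<Sum>k. \<integral>\<^sup>+x. ennreal (2 ^ k * (d k x)\<^sup>2) \<partial>M)"
    by (rule nn_integral_suminf) measurable
  also have "\<dots> \<le> (\<Sum>k. ennreal (4 * (1 / 2) ^ k))"
  proof (rule suminf_le)
    fix k
    have "(\<integral>\<^sup>+x. ennreal (2 ^ k * (d k x)\<^sup>2) \<partial>M) = ennreal (2 ^ k) * (\<integral>\<^sup>+x. ennreal ((norm (d k x))\<^sup>2) \<partial>M)"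
      by (subst nn_integral_cmult[symmetric]) (auto simp: ennreal_mult)
    also have "\<dots> = ennreal (2 ^ k * (L2_norm M (d k))\<^sup>2)"
      unfolding nn_integral_eq_L2_norm[OF sid] by (simp add: ennreal_mult)
    also have "\<dots> \<le> ennreal (2 ^ k * (4 * (1 / 4) ^ k))"
      by (intro ennreal_leI mult_left_mono dle) auto
    also have "2 ^ k * (4 * (1 / 4) ^ k) = 4 * (2 ^ k * (1 / 4 :: real) ^ k)"
      by simp
    also have "2 ^ k * (1 / 4 :: real) ^ k = (1 / 2) ^ k"
      by (simp flip: power_mult_distrib)
    finally show "(\<integral>\<^sup>+x. ennreal (2 ^ k * (d k x)\<^sup>2) \<partial>M) \<le> ennreal (4 * (1 / 2) ^ k)" .
  qed auto
  also have "\<dots> = ennreal (\<Sum>k. 4 * (1 / 2) ^ k)"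
    by (rule suminf_ennreal2) (auto intro!: summable_mult summable_geometric)
  finally have "(\<integral>\<^sup>+x. (\<Sum>k. ennreal (2 ^ k * (d k x)\<^sup>2)) \<partial>M) \<noteq> \<infinity>"
    by (metis ennreal_less_top infinity_ennreal_def leD)
  then have fin: "AE x in M. (\<Sum>k. ennreal (2 ^ k * (d k x)\<^sup>2)) \<noteq> \<infinity>"
    by (intro nn_integral_PInf_AE) auto
  have conv: "AE x in M. convergent (\<lambda>k. F (s k) x)"
    using fin
  proof eventually_elim
    case (elim x)
    define S where "S = enn2real (\<Sum>k. ennreal (2 ^ k * (d k x)\<^sup>2))"
    have S: "ennreal S = (\<Sum>k. ennreal (2 ^ k * (d k x)\<^sup>2))"
      unfolding S_def by (rule ennreal_enn2real) (use elim in \<open>simp only: less_top infinity_ennreal_def\<close>)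
    have "norm (d k x) \<le> sqrt S * (1 / sqrt 2) ^ k" for k
    proof -
      have "ennreal (2 ^ k * (d k x)\<^sup>2) \<le> ennreal S"
        unfolding S using sum_le_suminf[OF summableI, of "{k}" "\<lambda>k. ennreal (2 ^ k * (d k x)\<^sup>2)"]
        by (simp only: sum.insert sum.empty finite.emptyI finite.insertI empty_iff add_0_right zero_le simp_thms)
      then have "2 ^ k * (d k x)\<^sup>2 \<le> S"
        by (subst (asm) ennreal_le_iff) (auto simp: S_def)
      then have "(d k x)\<^sup>2 \<le> S * (1 / 2) ^ k"
        by (simp add: power_divide field_simps)
      then have "\<bar>d k x\<bar> \<le> sqrt (S * (1 / 2) ^ k)"
        using real_sqrt_le_mono by fastforce
      then show ?thesis
        by (simp add: real_sqrt_mult real_sqrt_power real_sqrt_divide)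
    qed
    moreover have geom: "summable (\<lambda>k. sqrt S * (1 / sqrt 2) ^ k)"
      by (intro summable_mult summable_geometric) simp
    ultimately have "summable (\<lambda>k. d k x)"
      by (intro summable_comparison_test'[OF geom, where N = 0])
    then have "summable (\<lambda>k. F (s (Suc k)) x - F (s k) x)"
      unfolding d_def .
    then obtain a where "(\<lambda>n. \<Sum>k<n. F (s (Suc k)) x - F (s k) x) \<longlonglongrightarrow> a"
      by (auto simp: summable_def sums_def)
    then have "(\<lambda>n. F (s n) x - F (s 0) x + F (s 0) x) \<longlonglongrightarrow> a + F (s 0) x"
      unfolding sum_lessThan_telescope[of "\<lambda>k. F (s k) x"] by (intro tendsto_add tendsto_const)
    then show ?case
      by (auto simp: convergent_def)
  qed
  define g where "g x = lim (\<lambda>k. F (s k) x)" for x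
  have [measurable]: "g \<in> borel_measurable M"
    unfolding g_def by measurable
  have e_s: "(\<lambda>k. e (s k)) \<longlonglongrightarrow> 0"
  proof -
    have "filterlim s sequentially sequentially"
      using s(1) by (intro filterlim_at_top_mono[OF filterlim_ident]) auto
    then show ?thesis
      by (rule filterlim_compose[OF e])
  qed
  \<comment> \<open>Fatou's lemma along the subsequence; \<open>e (s k)\<close> disappears in the
    limit and only \<open>e m\<close> remains.\<close>
  have le: "(\<integral>\<^sup>+x. ennreal ((F m x - g x)\<^sup>2) \<partial>M) \<le> ennreal ((e m)\<^sup>2)" for m
  proof -
    have "(\<integral>\<^sup>+x. ennreal ((F m x - g x)\<^sup>2) \<partial>M) \<le> (\<integral>\<^sup>+x. liminf (\<lambda>k. ennreal ((F m x - F (s k) x)\<^sup>2)) \<partial>M)"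
    proof (rule nn_integral_mono_AE)
      show "AE x in M. ennreal ((F m x - g x)\<^sup>2) \<le> liminf (\<lambda>k. ennreal ((F m x - F (s k) x)\<^sup>2))"
        using conv
      proof eventually_elim
        case (elim x)
        then have "(\<lambda>k. F (s k) x) \<longlonglongrightarrow> g x"
          by (simp add: g_def convergent_LIMSEQ_iff)
        then have "(\<lambda>k. ennreal ((F m x - F (s k) x)\<^sup>2)) \<longlonglongrightarrow> ennreal ((F m x - g x)\<^sup>2)"
          by (intro tendsto_ennrealI tendsto_intros)
        from lim_imp_Liminf[OF _ this] show ?case
          by simp
      qed
    qed
    also have "\<dots> \<le> liminf (\<lambda>k. \<integral>\<^sup>+x. ennreal ((F m x - F (s k) x)\<^sup>2) \<partial>M)"
      by (rule nn_integral_liminf) measurable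
    also have "\<dots> \<le> liminf (\<lambda>k. ennreal ((e m + e (s k))\<^sup>2))"
    proof (intro Liminf_mono always_eventually allI)
      fix k
      have "(\<integral>\<^sup>+x. ennreal ((F m x - F (s k) x)\<^sup>2) \<partial>M) = ennreal ((L2_norm M (\<lambda>x. F m x - F (s k) x))\<^sup>2)"
        using nn_integral_eq_L2_norm[OF square_integrable_diff[OF si si], of m "s k"] by simp
      also have "\<dots> \<le> ennreal ((e m + e (s k))\<^sup>2)"
        by (intro ennreal_leI power_mono cauchy L2_norm_nonneg)
      finally show "(\<integral>\<^sup>+x. ennreal ((F m x - F (s k) x)\<^sup>2) \<partial>M) \<le> ennreal ((e m + e (s k))\<^sup>2)" .
    qed
    also have "\<dots> = ennreal ((e m + 0)\<^sup>2)"
      by (intro lim_imp_Liminf tendsto_ennrealI tendsto_intros e_s) simp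
    finally show ?thesis by simp
  qed
  have sim: "square_integrable M (\<lambda>x. F m x - g x)" for m
  proof -
    have "integrable M (\<lambda>x. (F m x - g x)\<^sup>2)"
      using le[of m] by (intro integrableI_nonneg) (auto simp: le_less_trans)
    then show ?thesis
      by (simp add: square_integrable_def)
  qed
  have "square_integrable M g"
    using square_integrable_diff[OF si[of 0] sim[of 0]] by simp
  moreover have "(\<lambda>m. L2_norm M (\<lambda>x. F m x - g x)) \<longlonglongrightarrow> 0"
  proof (rule tendsto_sandwich[OF _ _ tendsto_const])
    have "L2_norm M (\<lambda>x. F m x - g x) \<le> \<bar>e m\<bar>" for m
    proof -
      have "ennreal ((L2_norm M (\<lambda>x. F m x - g x))\<^sup>2) \<le> ennreal ((e m)\<^sup>2)"
        using le[of m] nn_integral_eq_L2_norm[OF sim, of m] by simp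
      then have "(L2_norm M (\<lambda>x. F m x - g x))\<^sup>2 \<le> (e m)\<^sup>2"
        by simp
      then show ?thesis
        using L2_norm_nonneg[of M "\<lambda>x. F m x - g x"] by (simp flip: abs_le_square_iff)
    qed
    then show "\<forall>\<^sub>F m in sequentially. L2_norm M (\<lambda>x. F m x - g x) \<le> \<bar>e m\<bar>"
      by simp
    show "(\<lambda>m. \<bar>e m\<bar>) \<longlonglongrightarrow> 0"
      using tendsto_rabs[OF e] by simp
  qed (simp add: L2_norm_nonneg)
  ultimately show ?thesis by blast
qed

subsection \<open>Traces\<close>

lemma outer_normal_bound: "\<bar>outer_normal x $ i\<bar> \<le> 1"
  by (simp add: outer_normal_def)

lemma measurable_outer_normal: "(\<lambda>x. outer_normal x $ i) \<in> borel_measurable boundary_measure"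
  unfolding measurable_boundary_measure outer_normal_def by simp

lemma square_integrable_mult_normal:
  fixes f :: "real ^ 'd \<Rightarrow> real"
  assumes "square_integrable boundary_measure f"
  shows "square_integrable boundary_measure (\<lambda>x. f x * outer_normal x $ i)"
proof (rule square_integrable_bound[OF assms, where K = 1])
  show "(\<lambda>x. f x * outer_normal x $ i) \<in> borel_measurable boundary_measure"
    by (intro borel_measurable_times square_integrable_measurable assms measurable_outer_normal)
  show "AE x in boundary_measure. norm (f x * outer_normal x $ i) \<le> 1 * norm (f x)"
    by (intro AE_I2) (simp add: abs_mult outer_normal_bound mult_left_le)
qed

lemma integrable_smooth_mult_boundary:
  assumes "smooth f" "smooth g"
  shows "integrable boundary_measure (\<lambda>x. f x * g x * outer_normal x $ i)"
  by (intro boundary.square_integrable_imp_integrable_L1 square_integrable_mult_normal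
      smooth_square_integrable_boundary smooth_mult assms)

text \<open>The divergence theorem for an affine weight times \<open>U^2\<close>. The weight
  \<open>2 * x_i - 1\<close> leads to the trace inequality and the weight \<open>x_i\<close> to the
  Friedrichs inequality.\<close>

lemma integral_weighted_square:
  assumes U: "smooth U"
  shows "(\<integral>x. (a * x $ i + b) * (U x)\<^sup>2 * outer_normal x $ i \<partial>boundary_measure)
    = (\<integral>x. a * (U x)\<^sup>2 + 2 * (a * x $ i + b) * (U x * partial_deriv i U x) \<partial>Omega_measure)"
proof -
  have w: "smooth (\<lambda>x. a * x $ i + b)"
    by (intro smooth_add smooth_mult smooth_const smooth_component)
  have wU: "smooth (\<lambda>x. (a * x $ i + b) * U x)"
    by (intro smooth_mult w U)
  have dw: "partial_deriv i (\<lambda>x. a * x $ i + b) x = a" for x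
    by (simp add: partial_deriv_smooth_add smooth_mult smooth_const smooth_component
        partial_deriv_smooth_cmult partial_deriv_component partial_deriv_const)
  have "(\<integral>x. (a * x $ i + b) * U x * U x * outer_normal x $ i \<partial>boundary_measure)
      = (\<integral>x. partial_deriv i (\<lambda>x. (a * x $ i + b) * U x) x * U x \<partial>Omega_measure)
        + (\<integral>x. (a * x $ i + b) * U x * partial_deriv i U x \<partial>Omega_measure)"
    by (rule integration_by_parts_smooth[OF wU U, symmetric])
  also have "\<dots> = (\<integral>x. partial_deriv i (\<lambda>x. (a * x $ i + b) * U x) x * U x
      + (a * x $ i + b) * U x * partial_deriv i U x \<partial>Omega_measure)"
    by (intro Bochner_Integration.integral_add[symmetric] integrable_smooth_mult smooth_partial_deriv wU U)
  finally show ?thesis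
    unfolding partial_deriv_smooth_mult[OF w U] dw by (simp add: power2_eq_square algebra_simps)
qed

lemma L2_norm_smooth_power2:
  assumes "smooth U"
  shows "integrable Omega_measure (\<lambda>x. (U x)\<^sup>2)" "(\<integral>x. (U x)\<^sup>2 \<partial>Omega_measure) = (L2_norm Omega_measure U)\<^sup>2"
  using smooth_square_integrable_Omega[OF assms] by (simp_all add: square_integrable_def L2_norm_power2)

text \<open>The weight \<open>2 x\<^sub>i - 1\<close> equals the \<open>i\<close>-th component of the normal on both faces orthogonal
  to the \<open>i\<close>-th axis.\<close>

lemma trace_inequality_smooth:
  fixes U :: "real ^ 'd \<Rightarrow> real"
  assumes U: "smooth U"
  shows "(L2_norm boundary_measure U)\<^sup>2
    \<le> (\<Sum>i\<in>UNIV. 3 * (L2_norm Omega_measure U)\<^sup>2 + (L2_norm Omega_measure (partial_deriv i U))\<^sup>2)"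
proof -
  let ?w = "\<lambda>i (x :: real ^ 'd). (2 * x $ i + - 1) * (U x)\<^sup>2 * outer_normal x $ i"
  have int: "integrable boundary_measure (?w i)" for i
    using integrable_smooth_mult_boundary[OF smooth_mult[OF smooth_add[OF smooth_mult[OF smooth_const smooth_component]
            smooth_const] U] U, of 2 i "- 1" i]
    by (simp add: power2_eq_square mult.assoc)
  have "(L2_norm boundary_measure U)\<^sup>2 = (\<integral>x. (U x)\<^sup>2 \<partial>boundary_measure)"
    by (simp add: L2_norm_power2)
  also have "\<dots> \<le> (\<integral>x. (\<Sum>i\<in>UNIV. ?w i x) \<partial>boundary_measure)"
  proof (rule integral_mono_AE)
    show "integrable boundary_measure (\<lambda>x. (U x)\<^sup>2)"
      using smooth_square_integrable_boundary[OF U] by (simp add: square_integrable_def)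
    show "AE x in boundary_measure. (U x)\<^sup>2 \<le> (\<Sum>i\<in>UNIV. ?w i x)"
      using AE_boundary_not_interior AE_boundary_Omega
    proof eventually_elim
      case (elim x)
      then obtain j where "\<not> (0 < x $ j \<and> x $ j < 1)"
        unfolding interior_Omega by blast
      moreover have "0 \<le> x $ j \<and> x $ j \<le> 1"
        using elim(2) by (simp add: mem_box_cart)
      ultimately have j: "x $ j = 0 \<or> x $ j = 1"
        by linarith
      then have "(U x)\<^sup>2 = ?w j x"
        by (auto simp: outer_normal_def)
      also have "\<dots> \<le> (\<Sum>i\<in>UNIV. ?w i x)"
        by (rule member_le_sum) (auto simp: outer_normal_def)
      finally show ?case .
    qed
  qed (intro Bochner_Integration.integrable_sum int)
  also have "\<dots> = (\<Sum>i\<in>UNIV. \<integral>x. ?w i x \<partial>boundary_measure)"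
    by (intro Bochner_Integration.integral_sum int)
  also have "\<dots> \<le> (\<Sum>i\<in>UNIV. 3 * (L2_norm Omega_measure U)\<^sup>2 + (L2_norm Omega_measure (partial_deriv i U))\<^sup>2)"
  proof (rule sum_mono)
    fix i
    note s = smooth_partial_deriv[OF U, of i]
    have si: "integrable Omega_measure (\<lambda>x. 2 * (U x)\<^sup>2 + 2 * (2 * x $ i + - 1) * (U x * partial_deriv i U x))"
      by (intro Omega.square_integrable_imp_integrable_L1 smooth_square_integrable_Omega)
        (simp add: power2_eq_square, intro smooth_diff smooth_add smooth_mult smooth_const smooth_component U s)
    have "(\<integral>x. ?w i x \<partial>boundary_measure) = (\<integral>x. 2 * (U x)\<^sup>2 + 2 * (2 * x $ i + - 1) * (U x * partial_deriv i U x) \<partial>Omega_measure)"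
      by (rule integral_weighted_square[OF U])
    also have "\<dots> \<le> (\<integral>x. 3 * (U x)\<^sup>2 + (partial_deriv i U x)\<^sup>2 \<partial>Omega_measure)"
    proof (rule integral_mono_AE[OF si])
      show "integrable Omega_measure (\<lambda>x. 3 * (U x)\<^sup>2 + (partial_deriv i U x)\<^sup>2)"
        using L2_norm_smooth_power2[OF U] L2_norm_smooth_power2[OF s] by simp
      show "AE x in Omega_measure. 2 * (U x)\<^sup>2 + 2 * (2 * x $ i + - 1) * (U x * partial_deriv i U x)
          \<le> 3 * (U x)\<^sup>2 + (partial_deriv i U x)\<^sup>2"
      proof (rule AE_I2)
        fix x assume "x \<in> space (Omega_measure :: (real ^ 'd) measure)"
        then have "\<bar>2 * x $ i + - 1\<bar> \<le> 1"
          by (auto simp: space_restrict_space mem_box_cart abs_le_iff)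
        then have "\<bar>(2 * x $ i + - 1) * (U x * partial_deriv i U x)\<bar> \<le> 1 * \<bar>U x * partial_deriv i U x\<bar>"
          unfolding abs_mult[of "2 * x $ i + - 1"] by (intro mult_right_mono) auto
        \<comment> \<open>The 3 in the bound is the 2 from differentiating the weight plus the 1
          that this inequality adds.\<close>
        moreover have "2 * \<bar>U x * partial_deriv i U x\<bar> \<le> (U x)\<^sup>2 + (partial_deriv i U x)\<^sup>2"
          using sum_squares_bound[of "\<bar>U x\<bar>" "\<bar>partial_deriv i U x\<bar>"] by (simp add: abs_mult)
        ultimately show "2 * (U x)\<^sup>2 + 2 * (2 * x $ i + - 1) * (U x * partial_deriv i U x)
            \<le> 3 * (U x)\<^sup>2 + (partial_deriv i U x)\<^sup>2"
          by (simp only: mult.assoc)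
      qed
    qed
    also have "\<dots> = 3 * (L2_norm Omega_measure U)\<^sup>2 + (L2_norm Omega_measure (partial_deriv i U))\<^sup>2"
      using L2_norm_smooth_power2[OF U] L2_norm_smooth_power2[OF s] by simp
    finally show "(\<integral>x. ?w i x \<partial>boundary_measure) \<le> 3 * (L2_norm Omega_measure U)\<^sup>2 + (L2_norm Omega_measure (partial_deriv i U))\<^sup>2" .
  qed
  finally show ?thesis .
qed

text \<open>The weight \<open>x_i\<close> has derivative 1 and vanishes on the face
  \<open>x_i = 0\<close>. Hence the volume integral of \<open>U^2\<close> is a boundary integral
  over the opposite face, up to a cross term that is absorbed.\<close>

lemma friedrichs_inequality_smooth:
  fixes U :: "real ^ 'd \<Rightarrow> real"
  assumes U: "smooth U"
  shows "(L2_norm Omega_measure U)\<^sup>2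
    \<le> 2 * (L2_norm boundary_measure U)\<^sup>2 + 4 * (L2_norm Omega_measure (partial_deriv i U))\<^sup>2"
proof -
  note s = smooth_partial_deriv[OF U, of i]
  let ?w = "\<lambda>(x :: real ^ 'd). (1 * x $ i + 0) * (U x)\<^sup>2 * outer_normal x $ i"
  have int: "integrable boundary_measure ?w"
    using integrable_smooth_mult_boundary[OF smooth_mult[OF smooth_component U] U, of i i]
    by (simp add: power2_eq_square mult.assoc)
  have si: "integrable Omega_measure (\<lambda>x. 1 * (U x)\<^sup>2 + 2 * (1 * x $ i + 0) * (U x * partial_deriv i U x))"
    by (intro Omega.square_integrable_imp_integrable_L1 smooth_square_integrable_Omega)
      (simp add: power2_eq_square, intro smooth_diff smooth_add smooth_mult smooth_const smooth_component U s)
  have "(L2_norm Omega_measure U)\<^sup>2 = (\<integral>x. (U x)\<^sup>2 \<partial>Omega_measure)"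
    by (simp add: L2_norm_power2)
  also have "\<dots> \<le> (\<integral>x. 2 * (1 * (U x)\<^sup>2 + 2 * (1 * x $ i + 0) * (U x * partial_deriv i U x)) + 4 * (partial_deriv i U x)\<^sup>2 \<partial>Omega_measure)"
  proof (rule integral_mono_AE)
    show "AE x in Omega_measure. (U x)\<^sup>2
        \<le> 2 * (1 * (U x)\<^sup>2 + 2 * (1 * x $ i + 0) * (U x * partial_deriv i U x)) + 4 * (partial_deriv i U x)\<^sup>2"
    proof (rule AE_I2)
      fix x assume "x \<in> space (Omega_measure :: (real ^ 'd) measure)"
      then have "\<bar>x $ i\<bar> \<le> 1"
        by (auto simp: space_restrict_space mem_box_cart abs_le_iff intro: order.trans[of _ 0])
      then have "\<bar>x $ i * (U x * partial_deriv i U x)\<bar> \<le> 1 * \<bar>U x * partial_deriv i U x\<bar>"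
        unfolding abs_mult[of "x $ i"] by (intro mult_right_mono) auto
      \<comment> \<open>The identity is doubled so that one of the two copies of \<open>U^2\<close>
        can absorb the cross term.\<close>
      moreover have "4 * \<bar>U x * partial_deriv i U x\<bar> \<le> (U x)\<^sup>2 + 4 * (partial_deriv i U x)\<^sup>2"
        using sum_squares_bound[of "\<bar>U x\<bar>" "2 * \<bar>partial_deriv i U x\<bar>"] by (simp add: abs_mult power_mult_distrib)
      ultimately show "(U x)\<^sup>2
          \<le> 2 * (1 * (U x)\<^sup>2 + 2 * (1 * x $ i + 0) * (U x * partial_deriv i U x)) + 4 * (partial_deriv i U x)\<^sup>2"
        by (simp add: mult.assoc)
    qed
  qed (intro Bochner_Integration.integrable_add Bochner_Integration.integrable_mult_right si
      L2_norm_smooth_power2(1) U s)+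
  also have "\<dots> = 2 * (\<integral>x. ?w x \<partial>boundary_measure) + 4 * (L2_norm Omega_measure (partial_deriv i U))\<^sup>2"
    unfolding integral_weighted_square[OF U] using si L2_norm_smooth_power2[OF s]
    by (simp only: Bochner_Integration.integral_add Bochner_Integration.integrable_mult_right
        Bochner_Integration.integral_mult_right_zero)
  also have "(\<integral>x. ?w x \<partial>boundary_measure) \<le> (\<integral>x. (U x)\<^sup>2 \<partial>boundary_measure)"
  proof (rule integral_mono_AE[OF int])
    show "integrable boundary_measure (\<lambda>x. (U x)\<^sup>2)"
      using smooth_square_integrable_boundary[OF U] by (simp add: square_integrable_def)
    show "AE x in boundary_measure. ?w x \<le> (U x)\<^sup>2"
      using AE_boundary_Omega by eventually_elim (auto simp: outer_normal_def)
  qed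
  finally show ?thesis
    by (simp add: L2_norm_power2)
qed

text \<open>The trace inequality for the differences \<open>U m - U l\<close> makes the boundary
  values of an approximating sequence Cauchy, and completeness of L2 on the boundary gives the
  limit.\<close>

lemma has_trace_exists:
  fixes u :: "real ^ 'd \<Rightarrow> real"
  assumes u: "u \<in> H1"
  shows "\<exists>g. has_trace u g"
proof -
  obtain U where U: "\<And>m. U m \<in> cos_span" and conv: "(\<lambda>m. H1_norm (\<lambda>x. U m x - u x)) \<longlonglongrightarrow> 0"
    using cos_span_dense_H1[OF u] by blast
  note sU = cos_span_smooth[OF U]
  note lim = H1_tendstoD[OF sU u conv]
  define a where "a m = L2_norm Omega_measure (\<lambda>x. U m x - u x)" for m
  define b where "b m i = L2_norm Omega_measure (\<lambda>x. partial_deriv i (U m) x - weak_partial i u x)" for m i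
  \<comment> \<open>The coefficients fit
    \<open>3 * X\<^sup>2 + Y\<^sup>2 \<le> (2 * X + Y)\<^sup>2\<close> for
    \<open>0 \<le> X * Y\<close>; as a sum of squares of non-negative numbers is at most the square
    of their sum, the trace inequality becomes a bound by
    \<open>(e m + e l)\<^sup>2\<close>.\<close>
  define e where "e m = (\<Sum>i\<in>(UNIV :: 'd set). 2 * a m + b m i)" for m
  have e: "e \<longlonglongrightarrow> 0"
  proof -
    have "e \<longlonglongrightarrow> (\<Sum>i\<in>(UNIV :: 'd set). 2 * 0 + 0)"
      unfolding e_def[abs_def] a_def b_def by (intro tendsto_intros lim)
    then show ?thesis by simp
  qed
  note si = smooth_square_integrable_Omega[OF sU] smooth_square_integrable_Omega[OF smooth_partial_deriv[OF sU]]
    H1_square_integrable[OF u]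
  have cauchy: "L2_norm boundary_measure (\<lambda>x. U m x - U l x) \<le> e m + e l" for m l
  proof (rule power2_le_imp_le)
    have nn: "0 \<le> a m" "0 \<le> b m i" for m i
      by (auto simp: a_def b_def L2_norm_nonneg)
    have "L2_norm Omega_measure (\<lambda>x. U m x - U l x) \<le> a m + a l"
      using L2_norm_triangle_diff[OF si(1,3) si(1), of m l] unfolding a_def L2_norm_minus_commute[of _ "U l"] by simp
    then have A: "(L2_norm Omega_measure (\<lambda>x. U m x - U l x))\<^sup>2 \<le> (a m + a l)\<^sup>2"
      by (intro power_mono L2_norm_nonneg)
    have B: "(L2_norm Omega_measure (\<lambda>x. partial_deriv i (U m) x - partial_deriv i (U l) x))\<^sup>2 \<le> (b m i + b l i)\<^sup>2" for i
    proof -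
      have "L2_norm Omega_measure (\<lambda>x. partial_deriv i (U m) x - partial_deriv i (U l) x) \<le> b m i + b l i"
        using L2_norm_triangle_diff[OF smooth_square_integrable_Omega[OF smooth_partial_deriv[OF sU[of m]]]
            si(4)[of i] smooth_square_integrable_Omega[OF smooth_partial_deriv[OF sU[of l]]], of i i]
        unfolding b_def L2_norm_minus_commute[of _ "partial_deriv i (U l)"] by simp
      then show ?thesis
        by (intro power_mono L2_norm_nonneg)
    qed
    have "(L2_norm boundary_measure (\<lambda>x. U m x - U l x))\<^sup>2
        \<le> (\<Sum>i\<in>UNIV. 3 * (L2_norm Omega_measure (\<lambda>x. U m x - U l x))\<^sup>2
            + (L2_norm Omega_measure (\<lambda>x. partial_deriv i (U m) x - partial_deriv i (U l) x))\<^sup>2)"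
      using trace_inequality_smooth[OF smooth_diff[OF sU sU], of m l]
      unfolding partial_deriv_smooth_diff[OF sU sU, abs_def] .
    also have "\<dots> \<le> (\<Sum>i\<in>(UNIV :: 'd set). ((2 * a m + b m i) + (2 * a l + b l i))\<^sup>2)"
    proof (rule sum_mono)
      fix i :: 'd
      have "0 \<le> (a m + a l) * (b m i + b l i)"
        using nn by (intro mult_nonneg_nonneg add_nonneg_nonneg)
      moreover have "3 * X\<^sup>2 + Y\<^sup>2 \<le> (2 * X + Y)\<^sup>2" if "0 \<le> X * Y" for X Y :: real
      proof -
        have "(2 * X + Y)\<^sup>2 = 4 * X\<^sup>2 + 4 * (X * Y) + Y\<^sup>2"
          by (simp add: power2_eq_square algebra_simps)
        then show ?thesis
          using that zero_le_power2[of X] by linarith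
      qed
      ultimately have "3 * (a m + a l)\<^sup>2 + (b m i + b l i)\<^sup>2 \<le> (2 * (a m + a l) + (b m i + b l i))\<^sup>2"
        by blast
      also have "\<dots> = ((2 * a m + b m i) + (2 * a l + b l i))\<^sup>2"
        by (simp add: algebra_simps)
      finally show "3 * (L2_norm Omega_measure (\<lambda>x. U m x - U l x))\<^sup>2
          + (L2_norm Omega_measure (\<lambda>x. partial_deriv i (U m) x - partial_deriv i (U l) x))\<^sup>2
          \<le> ((2 * a m + b m i) + (2 * a l + b l i))\<^sup>2"
        using A B[of i] by linarith
    qed
    also have "\<dots> \<le> (\<Sum>i\<in>(UNIV :: 'd set). (2 * a m + b m i) + (2 * a l + b l i))\<^sup>2"
      unfolding power2_eq_square sum_distrib_right
      using nn by (intro sum_mono mult_left_mono member_le_sum) auto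
    finally show "(L2_norm boundary_measure (\<lambda>x. U m x - U l x))\<^sup>2 \<le> (e m + e l)\<^sup>2"
      by (simp add: e_def sum.distrib)
    show "0 \<le> e m + e l"
      unfolding e_def using nn by (intro add_nonneg_nonneg sum_nonneg) auto
  qed
  from L2_complete[OF smooth_square_integrable_boundary[OF sU] e cauchy]
  obtain g where "square_integrable boundary_measure g" "(\<lambda>m. L2_norm boundary_measure (\<lambda>x. U m x - g x)) \<longlonglongrightarrow> 0"
    by blast
  then show ?thesis
    unfolding has_trace_def using u sU conv by blast
qed

section \<open>Passage from smooth functions to H1\<close>

lemma has_trace_boundary_trace: "u \<in> H1 \<Longrightarrow> has_trace u (boundary_trace u)"
  unfolding boundary_trace_def using has_trace_exists by (rule someI_ex)

lemma has_traceE: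
  assumes "has_trace u g"
  obtains U where "u \<in> H1" "square_integrable boundary_measure g" "\<And>m. smooth (U m)"
    "(\<lambda>m. L2_norm Omega_measure (\<lambda>x. U m x - u x)) \<longlonglongrightarrow> 0"
    "\<And>i. (\<lambda>m. L2_norm Omega_measure (\<lambda>x. partial_deriv i (U m) x - weak_partial i u x)) \<longlonglongrightarrow> 0"
    "(\<lambda>m. L2_norm boundary_measure (\<lambda>x. U m x - g x)) \<longlonglongrightarrow> 0"
proof -
  from assms obtain U where *: "u \<in> H1" "square_integrable boundary_measure g" "\<forall>m. smooth (U m)"
    "(\<lambda>m. H1_norm (\<lambda>x. U m x - u x)) \<longlonglongrightarrow> 0" "(\<lambda>m. L2_norm boundary_measure (\<lambda>x. U m x - g x)) \<longlonglongrightarrow> 0"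
    unfolding has_trace_def by blast
  then have U: "\<And>m. smooth (U m)" by blast
  show thesis
    by (rule that[OF *(1,2) U H1_tendstoD[OF U *(1) *(4)] *(5)])
qed

lemma has_trace_smooth:
  assumes "smooth U"
  shows "has_trace U U"
proof -
  have "(H1_norm (\<lambda>x. U x - U x))\<^sup>2 = 0"
    by (subst H1_norm_power2_sum[OF has_weak_partial_diff[OF smooth_has_weak_partial smooth_has_weak_partial]])
      (auto simp: assms L2_norm_def)
  then have "H1_norm (\<lambda>x. U x - U x) = 0"
    by simp
  then show ?thesis
    unfolding has_trace_def using assms
    by (intro conjI H1_I[OF smooth_has_weak_partial] smooth_square_integrable_boundary exI[of _ "\<lambda>_. U"])
      (auto simp: L2_norm_def)
qed

lemma trace_inequality:
  fixes u :: "real ^ 'd \<Rightarrow> real"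
  assumes "has_trace u g"
  shows "(L2_norm boundary_measure g)\<^sup>2 \<le> 3 * CARD('d) * (H1_norm u)\<^sup>2"
proof -
  obtain U where u: "u \<in> H1" and g: "square_integrable boundary_measure g" and U: "\<And>m. smooth (U m)"
    and lim: "(\<lambda>m. L2_norm Omega_measure (\<lambda>x. U m x - u x)) \<longlonglongrightarrow> 0"
      "\<And>i. (\<lambda>m. L2_norm Omega_measure (\<lambda>x. partial_deriv i (U m) x - weak_partial i u x)) \<longlonglongrightarrow> 0"
      "(\<lambda>m. L2_norm boundary_measure (\<lambda>x. U m x - g x)) \<longlonglongrightarrow> 0"
    using has_traceE[OF assms] by blast
  note si = smooth_square_integrable_Omega[OF U] smooth_square_integrable_Omega[OF smooth_partial_deriv[OF U]]
    smooth_square_integrable_boundary[OF U] H1_square_integrable[OF u] g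
  have "(L2_norm boundary_measure g)\<^sup>2
      \<le> (\<Sum>i\<in>UNIV. 3 * (L2_norm Omega_measure u)\<^sup>2 + (L2_norm Omega_measure (weak_partial i u))\<^sup>2)"
  proof (rule LIMSEQ_le)
    show "(\<lambda>m. (L2_norm boundary_measure (U m))\<^sup>2) \<longlonglongrightarrow> (L2_norm boundary_measure g)\<^sup>2"
      by (intro tendsto_intros L2_tendsto_norm si lim)
    show "(\<lambda>m. \<Sum>i\<in>UNIV. 3 * (L2_norm Omega_measure (U m))\<^sup>2 + (L2_norm Omega_measure (partial_deriv i (U m)))\<^sup>2)
        \<longlonglongrightarrow> (\<Sum>i\<in>UNIV. 3 * (L2_norm Omega_measure u)\<^sup>2 + (L2_norm Omega_measure (weak_partial i u))\<^sup>2)"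
      by (intro tendsto_intros L2_tendsto_norm si lim)
  qed (use trace_inequality_smooth[OF U] in auto)
  also have "\<dots> = 3 * CARD('d) * (L2_norm Omega_measure u)\<^sup>2 + (L2_norm Omega_measure (weak_grad u))\<^sup>2"
    by (simp add: sum.distrib L2_norm_weak_grad_power2[OF u])
  also have "\<dots> \<le> 3 * CARD('d) * (H1_norm u)\<^sup>2"
  proof -
    have "1 * (L2_norm Omega_measure (weak_grad u))\<^sup>2 \<le> (3 * CARD('d)) * (L2_norm Omega_measure (weak_grad u))\<^sup>2"
      using zero_less_card_finite[where 'a = 'd] by (intro mult_right_mono zero_le_power2) linarith
    then show ?thesis
      by (simp add: H1_norm_power2 distrib_left)
  qed
  finally show ?thesis .
qed

lemma friedrichs_inequality:
  fixes u :: "real ^ 'd \<Rightarrow> real"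
  assumes "has_trace u g"
  shows "(L2_norm Omega_measure u)\<^sup>2 \<le> 2 * (L2_norm boundary_measure g)\<^sup>2 + 4 * (L2_norm Omega_measure (weak_grad u))\<^sup>2"
proof -
  obtain U where u: "u \<in> H1" and g: "square_integrable boundary_measure g" and U: "\<And>m. smooth (U m)"
    and lim: "(\<lambda>m. L2_norm Omega_measure (\<lambda>x. U m x - u x)) \<longlonglongrightarrow> 0"
      "\<And>i. (\<lambda>m. L2_norm Omega_measure (\<lambda>x. partial_deriv i (U m) x - weak_partial i u x)) \<longlonglongrightarrow> 0"
      "(\<lambda>m. L2_norm boundary_measure (\<lambda>x. U m x - g x)) \<longlonglongrightarrow> 0"
    using has_traceE[OF assms] by blast
  note si = smooth_square_integrable_Omega[OF U] smooth_square_integrable_Omega[OF smooth_partial_deriv[OF U]]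
    smooth_square_integrable_boundary[OF U] H1_square_integrable[OF u] g
  \<comment> \<open>A single direction suffices: the norm of one partial derivative is at most that
    of the gradient.\<close>
  fix i :: 'd
  have "(L2_norm Omega_measure u)\<^sup>2 \<le> 2 * (L2_norm boundary_measure g)\<^sup>2 + 4 * (L2_norm Omega_measure (weak_partial i u))\<^sup>2"
  proof (rule LIMSEQ_le)
    show "(\<lambda>m. (L2_norm Omega_measure (U m))\<^sup>2) \<longlonglongrightarrow> (L2_norm Omega_measure u)\<^sup>2"
      by (intro tendsto_intros L2_tendsto_norm si lim)
    show "(\<lambda>m. 2 * (L2_norm boundary_measure (U m))\<^sup>2 + 4 * (L2_norm Omega_measure (partial_deriv i (U m)))\<^sup>2)
        \<longlonglongrightarrow> 2 * (L2_norm boundary_measure g)\<^sup>2 + 4 * (L2_norm Omega_measure (weak_partial i u))\<^sup>2"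
      by (intro tendsto_intros L2_tendsto_norm si lim)
  qed (use friedrichs_inequality_smooth[OF U] in auto)
  moreover have "(L2_norm Omega_measure (weak_partial i u))\<^sup>2 \<le> (L2_norm Omega_measure (weak_grad u))\<^sup>2"
    unfolding L2_norm_weak_grad_power2[OF u] by (rule member_le_sum) auto
  ultimately show ?thesis by linarith
qed

text \<open>Both functions are replaced by the smooth sequences that witness their traces. Every
  term of the smooth identity is an L2 pairing and passes to the limit, the bounded normal component
  being attached to one factor.\<close>

lemma green_formula:
  fixes p w :: "real ^ 'd \<Rightarrow> real"
  assumes p: "has_trace p P" and w: "has_trace w W"
  shows "(\<integral>x. weak_partial i p x * w x \<partial>Omega_measure) + (\<integral>x. p x * weak_partial i w x \<partial>Omega_measure)
    = (\<integral>x. P x * (W x * outer_normal x $ i) \<partial>boundary_measure)"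
proof -
  obtain U where u: "p \<in> H1" and g: "square_integrable boundary_measure P" and U: "\<And>m. smooth (U m)"
    and lim: "(\<lambda>m. L2_norm Omega_measure (\<lambda>x. U m x - p x)) \<longlonglongrightarrow> 0"
      "\<And>i. (\<lambda>m. L2_norm Omega_measure (\<lambda>x. partial_deriv i (U m) x - weak_partial i p x)) \<longlonglongrightarrow> 0"
      "(\<lambda>m. L2_norm boundary_measure (\<lambda>x. U m x - P x)) \<longlonglongrightarrow> 0"
    using has_traceE[OF p] by blast
  obtain V where v: "w \<in> H1" and h: "square_integrable boundary_measure W" and V: "\<And>m. smooth (V m)"
    and lim': "(\<lambda>m. L2_norm Omega_measure (\<lambda>x. V m x - w x)) \<longlonglongrightarrow> 0"
      "\<And>i. (\<lambda>m. L2_norm Omega_measure (\<lambda>x. partial_deriv i (V m) x - weak_partial i w x)) \<longlonglongrightarrow> 0"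
      "(\<lambda>m. L2_norm boundary_measure (\<lambda>x. V m x - W x)) \<longlonglongrightarrow> 0"
    using has_traceE[OF w] by blast
  note si = smooth_square_integrable_Omega[OF U] smooth_square_integrable_Omega[OF smooth_partial_deriv[OF U]]
    smooth_square_integrable_boundary[OF U] H1_square_integrable[OF u] g
    smooth_square_integrable_Omega[OF V] smooth_square_integrable_Omega[OF smooth_partial_deriv[OF V]]
    smooth_square_integrable_boundary[OF V] H1_square_integrable[OF v] h
  have limn: "(\<lambda>m. L2_norm boundary_measure (\<lambda>x. V m x * outer_normal x $ i - W x * outer_normal x $ i)) \<longlonglongrightarrow> 0"
  proof (rule tendsto_sandwich[OF _ _ tendsto_const lim'(3)])
    have "L2_norm boundary_measure (\<lambda>x. (V m x - W x) * outer_normal x $ i)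
        \<le> 1 * L2_norm boundary_measure (\<lambda>x. V m x - W x)" for m
      by (rule L2_norm_mono) (auto intro!: square_integrable_mult_normal square_integrable_diff si AE_I2
          simp: abs_mult outer_normal_bound mult_left_le)
    then show "\<forall>\<^sub>F m in sequentially. L2_norm boundary_measure (\<lambda>x. V m x * outer_normal x $ i - W x * outer_normal x $ i)
        \<le> L2_norm boundary_measure (\<lambda>x. V m x - W x)"
      by (simp add: left_diff_distrib)
  qed (simp add: L2_norm_nonneg)
  have "(\<lambda>m. (\<integral>x. partial_deriv i (U m) x * V m x \<partial>Omega_measure) + (\<integral>x. U m x * partial_deriv i (V m) x \<partial>Omega_measure))
      \<longlonglongrightarrow> (\<integral>x. weak_partial i p x * w x \<partial>Omega_measure) + (\<integral>x. p x * weak_partial i w x \<partial>Omega_measure)"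
    by (intro tendsto_add L2_tendsto_mult si lim lim')
  moreover have "(\<lambda>m. \<integral>x. U m x * (V m x * outer_normal x $ i) \<partial>boundary_measure)
      \<longlonglongrightarrow> (\<integral>x. P x * (W x * outer_normal x $ i) \<partial>boundary_measure)"
    by (intro L2_tendsto_mult si lim limn square_integrable_mult_normal)
  ultimately show ?thesis
    unfolding integration_by_parts_smooth[OF U V] mult.assoc by (rule LIMSEQ_unique)
qed

subsection \<open>Energy estimates for a single function\<close>

lemma H2_H1: "u \<in> H2 \<Longrightarrow> u \<in> H1" "u \<in> H2 \<Longrightarrow> weak_partial i u \<in> H1"
  by (simp_all add: H2_def)

lemma square_integrable_weak_laplacian:
  "u \<in> H2 \<Longrightarrow> square_integrable Omega_measure (weak_laplacian u)"
  unfolding weak_laplacian_def[abs_def]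
  by (rule square_integrable_sum, rule H1_square_integrable(2), erule H2_H1(2))

lemma has_weak_div_unique:
  fixes q :: "real ^ 'd \<Rightarrow> real ^ 'd"
  assumes g: "has_weak_div q g" and h: "has_weak_div q h"
  shows "AE x in Omega_measure. g x = h x"
proof -
  have si: "square_integrable Omega_measure g" "square_integrable Omega_measure h"
    using g h unfolding has_weak_div_def by blast+
  have "AE x in Omega_measure. g x - h x = 0"
  proof (rule fundamental_lemma[OF square_integrable_diff[OF si]])
    fix \<psi> :: "real ^ 'd \<Rightarrow> real" assume \<psi>: "test_function \<psi>"
    note s = smooth_square_integrable_Omega[OF test_function_smooth[OF \<psi>]]
    have "(\<integral>x. (g x - h x) * \<psi> x \<partial>Omega_measure) = (\<integral>x. g x * \<psi> x \<partial>Omega_measure) - (\<integral>x. h x * \<psi> x \<partial>Omega_measure)"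
      unfolding left_diff_distrib by (intro Bochner_Integration.integral_diff square_integrable_mult si s)
    also have "\<dots> = 0"
    proof -
      have "(\<integral>x. q x \<bullet> (\<chi> i. partial_deriv i \<psi> x) \<partial>Omega_measure) = - (\<integral>x. g x * \<psi> x \<partial>Omega_measure)"
        using g \<psi> unfolding has_weak_div_def by blast
      moreover have "(\<integral>x. q x \<bullet> (\<chi> i. partial_deriv i \<psi> x) \<partial>Omega_measure) = - (\<integral>x. h x * \<psi> x \<partial>Omega_measure)"
        using h \<psi> unfolding has_weak_div_def by blast
      ultimately show ?thesis by simp
    qed
    finally show "(\<integral>x. (g x - h x) * \<psi> x \<partial>Omega_measure) = 0" .
  qed
  then show ?thesis by simp
qed

lemma has_weak_div_weak_grad:
  fixes u :: "real ^ 'd \<Rightarrow> real"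
  assumes u: "u \<in> H2"
  shows "has_weak_div (weak_grad u) (weak_laplacian u)"
  unfolding has_weak_div_def
proof (intro conjI allI impI)
  show "square_integrable Omega_measure (weak_grad u)"
    by (rule square_integrable_weak_grad[OF H2_H1(1)[OF u]])
  show "square_integrable Omega_measure (weak_laplacian u)"
    by (rule square_integrable_weak_laplacian[OF u])
  fix \<psi> :: "real ^ 'd \<Rightarrow> real" assume \<psi>: "test_function \<psi>"
  note s = test_function_smooth[OF \<psi>]
  have int: "integrable Omega_measure (\<lambda>x. weak_partial i u x * partial_deriv i \<psi> x)"
    "integrable Omega_measure (\<lambda>x. weak_partial i (weak_partial i u) x * \<psi> x)" for i
    by (rule square_integrable_mult[OF H1_square_integrable(2)[OF H2_H1(1)[OF u]]
          smooth_square_integrable_Omega[OF smooth_partial_deriv[OF s]]],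
        rule square_integrable_mult[OF H1_square_integrable(2)[OF H2_H1(2)[OF u]] smooth_square_integrable_Omega[OF s]])
  have "(\<integral>x. weak_grad u x \<bullet> (\<chi> i. partial_deriv i \<psi> x) \<partial>Omega_measure)
      = (\<Sum>i\<in>UNIV. \<integral>x. weak_partial i u x * partial_deriv i \<psi> x \<partial>Omega_measure)"
    unfolding weak_grad_def inner_vec_def vec_lambda_beta inner_real_def
    by (intro Bochner_Integration.integral_sum int)
  also have "\<dots> = (\<Sum>i\<in>UNIV. - (\<integral>x. weak_partial i (weak_partial i u) x * \<psi> x \<partial>Omega_measure))"
    by (intro sum.cong refl has_weak_partialD(3)[OF H1_has_weak_partial[OF H2_H1(2)[OF u]] \<psi>])
  also have "\<dots> = - (\<integral>x. weak_laplacian u x * \<psi> x \<partial>Omega_measure)"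
    unfolding sum_negf weak_laplacian_def sum_distrib_right
    by (simp add: int)
  finally show "(\<integral>x. weak_grad u x \<bullet> (\<chi> i. partial_deriv i \<psi> x) \<partial>Omega_measure)
      = - (\<integral>x. weak_laplacian u x * \<psi> x \<partial>Omega_measure)" .
qed

lemma Hdiv_norm_weak_grad_power2:
  assumes u: "u \<in> H2"
  shows "(Hdiv_norm (weak_grad u))\<^sup>2 = (L2_norm Omega_measure (weak_grad u))\<^sup>2 + (L2_norm Omega_measure (weak_laplacian u))\<^sup>2"
proof -
  note d = has_weak_div_weak_grad[OF u]
  have d': "has_weak_div (weak_grad u) (weak_div (weak_grad u))"
    unfolding weak_div_def by (rule someI[of "has_weak_div (weak_grad u)", OF d])
  have meas: "g \<in> borel_measurable Omega_measure" if "has_weak_div (weak_grad u) g" for g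
    using that unfolding has_weak_div_def square_integrable_def by blast
  have "L2_norm Omega_measure (weak_div (weak_grad u)) = L2_norm Omega_measure (weak_laplacian u)"
    by (rule L2_norm_cong_AE[OF meas[OF d'] meas[OF d] has_weak_div_unique[OF d' d]])
  then show ?thesis
    by (simp add: Hdiv_norm_def)
qed

lemma square_integrable_boundary_trace: "u \<in> H1 \<Longrightarrow> square_integrable boundary_measure (boundary_trace u)"
  by (drule has_trace_boundary_trace) (simp add: has_trace_def)

lemma square_integrable_grad_trace: "u \<in> H2 \<Longrightarrow> square_integrable boundary_measure (grad_trace u)"
  unfolding square_integrable_vec grad_trace_def by (simp add: square_integrable_boundary_trace H2_H1(2))

lemma normal_deriv_sum:
  "normal_deriv u x = (\<Sum>i\<in>UNIV. boundary_trace (weak_partial i u) x * outer_normal x $ i)"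
  by (simp add: normal_deriv_def grad_trace_def inner_vec_def)

lemma square_integrable_normal_deriv: "u \<in> H2 \<Longrightarrow> square_integrable boundary_measure (normal_deriv u)"
  unfolding normal_deriv_sum[abs_def]
  by (intro square_integrable_sum square_integrable_mult_normal square_integrable_boundary_trace H2_H1(2))

text \<open>Where several faces meet, \<open>outer_normal\<close> has several non-zero entries and
  its length exceeds 1; the bound by the dimension holds at every point.\<close>

lemma L2_norm_normal_deriv_le:
  fixes u :: "real ^ 'd \<Rightarrow> real"
  assumes "u \<in> H2"
  shows "L2_norm boundary_measure (normal_deriv u) \<le> CARD('d) * L2_norm boundary_measure (grad_trace u)"
proof (rule L2_norm_mono[OF square_integrable_normal_deriv[OF assms] square_integrable_grad_trace[OF assms]])
  have "norm (normal_deriv u x) \<le> CARD('d) * norm (grad_trace u x)" for x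
  proof -
    have "norm (outer_normal x) \<le> (\<Sum>i\<in>(UNIV :: 'd set). \<bar>outer_normal x $ i\<bar>)"
      by (rule norm_le_l1_cart)
    also have "\<dots> \<le> (\<Sum>i\<in>(UNIV :: 'd set). 1)"
      by (intro sum_mono outer_normal_bound)
    finally have "norm (outer_normal x) \<le> CARD('d)" by simp
    then have "norm (grad_trace u x) * norm (outer_normal x) \<le> norm (grad_trace u x) * CARD('d)"
      by (intro mult_left_mono) auto
    then show ?thesis
      using Cauchy_Schwarz_ineq2[of "grad_trace u x" "outer_normal x"]
      by (simp add: normal_deriv_def mult.commute)
  qed
  then show "AE x in boundary_measure. norm (normal_deriv u x) \<le> CARD('d) * norm (grad_trace u x)"
    by simp
qed simp

lemma green_formula_laplacian:
  fixes u w :: "real ^ 'd \<Rightarrow> real"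
  assumes u: "u \<in> H2" and w: "has_trace w W"
  shows "(\<integral>x. weak_laplacian u x * w x \<partial>Omega_measure) + (\<integral>x. weak_grad u x \<bullet> weak_grad w x \<partial>Omega_measure)
    = (\<integral>x. normal_deriv u x * W x \<partial>boundary_measure)"
proof -
  have w': "w \<in> H1" "square_integrable boundary_measure W"
    using w unfolding has_trace_def by blast+
  note si = H1_square_integrable[OF w'(1)] H1_square_integrable[OF H2_H1(1)[OF u]]
    H1_square_integrable[OF H2_H1(2)[OF u]]
  have "(\<integral>x. weak_laplacian u x * w x \<partial>Omega_measure)
      = (\<Sum>i\<in>UNIV. \<integral>x. weak_partial i (weak_partial i u) x * w x \<partial>Omega_measure)"
    unfolding weak_laplacian_def sum_distrib_right
    by (intro Bochner_Integration.integral_sum square_integrable_mult si)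
  moreover have "(\<integral>x. weak_grad u x \<bullet> weak_grad w x \<partial>Omega_measure)
      = (\<Sum>i\<in>UNIV. \<integral>x. weak_partial i u x * weak_partial i w x \<partial>Omega_measure)"
    unfolding weak_grad_def inner_vec_def vec_lambda_beta inner_real_def
    by (intro Bochner_Integration.integral_sum square_integrable_mult si)
  moreover have "(\<integral>x. normal_deriv u x * W x \<partial>boundary_measure)
      = (\<Sum>i\<in>UNIV. \<integral>x. boundary_trace (weak_partial i u) x * (W x * outer_normal x $ i) \<partial>boundary_measure)"
    unfolding normal_deriv_sum sum_distrib_right mult.assoc mult.commute[of "outer_normal _ $ _"]
    by (intro Bochner_Integration.integral_sum square_integrable_mult square_integrable_mult_normal
        square_integrable_boundary_trace H2_H1(2) u w')
  moreover have "(\<integral>x. weak_partial i (weak_partial i u) x * w x \<partial>Omega_measure)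
        + (\<integral>x. weak_partial i u x * weak_partial i w x \<partial>Omega_measure)
      = (\<integral>x. boundary_trace (weak_partial i u) x * (W x * outer_normal x $ i) \<partial>boundary_measure)" for i
    by (intro green_formula has_trace_boundary_trace H2_H1(2) u w)
  ultimately show ?thesis
    by (simp flip: sum.distrib)
qed

lemma energy_identity:
  assumes u: "u \<in> H2"
  shows "(L2_norm Omega_measure (weak_grad u))\<^sup>2
    = (\<integral>x. normal_deriv u x * boundary_trace u x \<partial>boundary_measure) - (\<integral>x. weak_laplacian u x * u x \<partial>Omega_measure)"
  using green_formula_laplacian[OF u has_trace_boundary_trace[OF H2_H1(1)[OF u]]]
  by (simp add: L2_norm_power2 power2_norm_eq_inner)

lemma laplacian_mult_le:
  assumes u: "u \<in> H2"
  shows "\<bar>\<integral>x. weak_laplacian u x * u x \<partial>Omega_measure\<bar> \<le> L2_norm Omega_measure (weak_laplacian u) * H1_norm u"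
proof -
  note h = H2_H1(1)[OF u]
  have "\<bar>\<integral>x. weak_laplacian u x * u x \<partial>Omega_measure\<bar>
      \<le> L2_norm Omega_measure (weak_laplacian u) * L2_norm Omega_measure u"
    by (intro L2_Cauchy_Schwarz_real square_integrable_weak_laplacian u H1_square_integrable h)
  also have "\<dots> \<le> L2_norm Omega_measure (weak_laplacian u) * H1_norm u"
    by (intro mult_left_mono L2_norm_le_H1_norm[OF H1_has_weak_partial[OF h]] L2_norm_nonneg)
  finally show ?thesis .
qed

lemma trace_le:
  fixes u :: "real ^ 'd \<Rightarrow> real"
  assumes "u \<in> H1"
  shows "L2_norm boundary_measure (boundary_trace u) \<le> sqrt (3 * CARD('d)) * H1_norm u"
proof (rule power2_le_imp_le)
  show "(L2_norm boundary_measure (boundary_trace u))\<^sup>2 \<le> (sqrt (3 * CARD('d)) * H1_norm u)\<^sup>2"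
    using trace_inequality[OF has_trace_boundary_trace[OF assms]] by (simp add: power_mult_distrib)
qed (simp add: H1_norm_def)

lemma trace_mult_le:
  fixes u :: "real ^ 'd \<Rightarrow> real"
  assumes "u \<in> H1" "square_integrable boundary_measure g"
  shows "\<bar>\<integral>x. g x * boundary_trace u x \<partial>boundary_measure\<bar>
    \<le> L2_norm boundary_measure g * (sqrt (3 * CARD('d)) * H1_norm u)"
proof -
  have "\<bar>\<integral>x. g x * boundary_trace u x \<partial>boundary_measure\<bar>
      \<le> L2_norm boundary_measure g * L2_norm boundary_measure (boundary_trace u)"
    by (intro L2_Cauchy_Schwarz_real square_integrable_boundary_trace assms)
  also have "\<dots> \<le> L2_norm boundary_measure g * (sqrt (3 * CARD('d)) * H1_norm u)"
    by (intro mult_left_mono trace_le assms L2_norm_nonneg)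
  finally show ?thesis .
qed

text \<open>Absorbs the linear term: \<open>2 * a * x\<close> is at most half of \<open>x^2\<close>
  plus \<open>2 * a^2\<close>. In the energy estimates \<open>x\<close> is the
  \<open>H1_norm\<close> that occurs on both sides.\<close>

lemma square_le_linear_imp:
  fixes a b x :: real
  assumes "x\<^sup>2 \<le> 2 * a * x + b"
  shows "x\<^sup>2 \<le> 4 * a\<^sup>2 + 2 * b"
proof -
  have "0 \<le> (x - 2 * a)\<^sup>2" by simp
  then have "4 * a * x \<le> x\<^sup>2 + 4 * a\<^sup>2"
    by (simp add: power2_diff power_mult_distrib mult_ac)
  then show ?thesis using assms by linarith
qed

lemma square_sum_sqrt_le:
  fixes s l c :: real
  assumes "0 \<le> c"
  shows "(sqrt c * s + l)\<^sup>2 \<le> 2 * (c * s\<^sup>2 + l\<^sup>2)"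
proof -
  have "0 \<le> (sqrt c * s - l)\<^sup>2" by simp
  then show ?thesis
    using assms by (simp add: power2_sum power2_diff power_mult_distrib)
qed

text \<open>On the boundary the normal derivative is the Robin datum minus the trace. The boundary
  pairing of \<open>energy_identity\<close> thus contains the negative squared norm of the trace;
  moved to the left, it controls, together with the gradient, the full norm by Friedrichs.\<close>

lemma robin_estimate:
  fixes u :: "real ^ 'd \<Rightarrow> real"
  assumes u: "u \<in> H2"
  shows "(H1_norm u)\<^sup>2 \<le> 150 * CARD('d) * ((L2_norm Omega_measure (weak_laplacian u))\<^sup>2
    + (L2_norm boundary_measure (\<lambda>x. boundary_trace u x + normal_deriv u x))\<^sup>2)"
proof -
  note h = H2_H1(1)[OF u]
  note sit = square_integrable_boundary_trace[OF h] and sin = square_integrable_normal_deriv[OF u]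
  note sis = square_integrable_add[OF sit sin]
  let ?N = "H1_norm u" and ?G = "L2_norm Omega_measure (weak_grad u)" and ?t = "L2_norm boundary_measure (boundary_trace u)"
    and ?l = "L2_norm Omega_measure (weak_laplacian u)"
    and ?s = "L2_norm boundary_measure (\<lambda>x. boundary_trace u x + normal_deriv u x)"
  have "(\<integral>x. normal_deriv u x * boundary_trace u x \<partial>boundary_measure)
      = (\<integral>x. (boundary_trace u x + normal_deriv u x) * boundary_trace u x - boundary_trace u x * boundary_trace u x \<partial>boundary_measure)"
    by (simp add: distrib_right)
  also have "\<dots> = (\<integral>x. (boundary_trace u x + normal_deriv u x) * boundary_trace u x \<partial>boundary_measure) - ?t\<^sup>2"
    by (subst Bochner_Integration.integral_diff)
      (auto intro!: square_integrable_mult sit sis simp: L2_norm_power2_real)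
  finally have "?G\<^sup>2 + ?t\<^sup>2 \<le> ?s * (sqrt (3 * CARD('d)) * ?N) + ?l * ?N"
    using energy_identity[OF u] laplacian_mult_le[OF u] trace_mult_le[OF h sis] by linarith
  \<comment> \<open>Friedrichs gives twice \<open>?t\<^sup>2\<close> plus four times
    \<open>?G\<^sup>2\<close>, and the \<open>H1_norm\<close> adds \<open>?G\<^sup>2\<close> once
    more.\<close>
  moreover have "?N\<^sup>2 \<le> 5 * (?G\<^sup>2 + ?t\<^sup>2)"
    using friedrichs_inequality[OF has_trace_boundary_trace[OF h]]
    unfolding H1_norm_power2 by (rule order.trans[OF add_right_mono]) simp
  ultimately have "?N\<^sup>2 \<le> 2 * (5 / 2 * (sqrt (3 * CARD('d)) * ?s + ?l)) * ?N + 0"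
    by (simp add: algebra_simps)
  then have "?N\<^sup>2 \<le> 4 * (5 / 2 * (sqrt (3 * CARD('d)) * ?s + ?l))\<^sup>2 + 2 * 0"
    by (rule square_le_linear_imp)
  also have "\<dots> = 25 * (sqrt (3 * CARD('d)) * ?s + ?l)\<^sup>2"
    unfolding power_mult_distrib[of "5 / 2"] by (simp add: power_divide)
  also have "\<dots> \<le> 25 * (2 * ((3 * CARD('d)) * ?s\<^sup>2 + ?l\<^sup>2))"
    by (intro mult_left_mono square_sum_sqrt_le) auto
  \<comment> \<open>150 = 25 * 2 * 3: the 25 is 4 * (5/2)^2, the 2 comes from squaring a sum and the
    3 from the trace constant. The other two boundary conditions are weakened to the same constant,
    so that one hypothesis of \<open>system_estimate\<close> fits all.\<close>
  also have "\<dots> \<le> 150 * CARD('d) * (?l\<^sup>2 + ?s\<^sup>2)"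
  proof -
    have "1 * ?l\<^sup>2 \<le> CARD('d) * ?l\<^sup>2"
      by (intro mult_right_mono) (auto simp: Suc_le_eq)
    moreover have "0 \<le> ?l\<^sup>2" by simp
    ultimately show ?thesis
      by (simp only: distrib_left mult.assoc)
  qed
  finally show ?thesis .
qed

text \<open>The normal derivative is itself the datum, so the energy identity bounds the gradient
  directly; constants escape it, and Poincare controls them through the mean.\<close>

lemma neumann_estimate:
  fixes u :: "real ^ 'd \<Rightarrow> real"
  assumes u: "u \<in> H2"
  shows "(H1_norm u)\<^sup>2 \<le> 150 * CARD('d) * ((L2_norm Omega_measure (weak_laplacian u))\<^sup>2
    + ((L2_norm boundary_measure (normal_deriv u))\<^sup>2 + (\<integral>x. u x \<partial>Omega_measure)\<^sup>2))"
proof -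
  note h = H2_H1(1)[OF u]
  let ?N = "H1_norm u" and ?G = "L2_norm Omega_measure (weak_grad u)" and ?m = "\<integral>x. u x \<partial>Omega_measure"
    and ?l = "L2_norm Omega_measure (weak_laplacian u)" and ?s = "L2_norm boundary_measure (normal_deriv u)"
  have "?G\<^sup>2 \<le> ?s * (sqrt (3 * CARD('d)) * ?N) + ?l * ?N"
    using energy_identity[OF u] laplacian_mult_le[OF u] trace_mult_le[OF h square_integrable_normal_deriv[OF u]]
    by linarith
  moreover have "?N\<^sup>2 \<le> 2 * ?G\<^sup>2 + ?m\<^sup>2"
    using poincare_inequality[OF h] unfolding H1_norm_power2 by linarith
  ultimately have "?N\<^sup>2 \<le> 2 * (sqrt (3 * CARD('d)) * ?s + ?l) * ?N + ?m\<^sup>2"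
    by (simp add: algebra_simps)
  then have "?N\<^sup>2 \<le> 4 * (sqrt (3 * CARD('d)) * ?s + ?l)\<^sup>2 + 2 * ?m\<^sup>2"
    by (rule square_le_linear_imp)
  also have "\<dots> \<le> 4 * (2 * ((3 * CARD('d)) * ?s\<^sup>2 + ?l\<^sup>2)) + 2 * ?m\<^sup>2"
    by (intro add_right_mono mult_left_mono square_sum_sqrt_le) auto
  also have "\<dots> \<le> 150 * CARD('d) * (?l\<^sup>2 + (?s\<^sup>2 + ?m\<^sup>2))"
  proof -
    have "1 * ?l\<^sup>2 \<le> CARD('d) * ?l\<^sup>2" "1 * ?m\<^sup>2 \<le> CARD('d) * ?m\<^sup>2"
      by (intro mult_right_mono; simp add: Suc_le_eq)+
    moreover have "0 \<le> ?l\<^sup>2" "0 \<le> ?m\<^sup>2" "0 \<le> CARD('d) * ?s\<^sup>2" by auto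
    ultimately show ?thesis
      by (simp only: distrib_left mult.assoc)
  qed
  finally show ?thesis .
qed

text \<open>Only the trace is a datum. The normal derivative is bounded by the gradient trace and
  stays as a factor of the product with the trace; Friedrichs recovers the norm of
  \<open>u\<close>.\<close>

lemma dirichlet_estimate:
  fixes u :: "real ^ 'd \<Rightarrow> real"
  assumes u: "u \<in> H2"
  shows "(H1_norm u)\<^sup>2 \<le> 150 * CARD('d) * ((L2_norm Omega_measure (weak_laplacian u))\<^sup>2
    + ((L2_norm boundary_measure (boundary_trace u))\<^sup>2
      + L2_norm boundary_measure (grad_trace u) * L2_norm boundary_measure (boundary_trace u)))"
proof -
  note h = H2_H1(1)[OF u]
  let ?N = "H1_norm u" and ?G = "L2_norm Omega_measure (weak_grad u)" and ?t = "L2_norm boundary_measure (boundary_trace u)"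
    and ?l = "L2_norm Omega_measure (weak_laplacian u)" and ?g = "L2_norm boundary_measure (grad_trace u)"
  have "\<bar>\<integral>x. normal_deriv u x * boundary_trace u x \<partial>boundary_measure\<bar>
      \<le> L2_norm boundary_measure (normal_deriv u) * ?t"
    by (intro L2_Cauchy_Schwarz_real square_integrable_boundary_trace square_integrable_normal_deriv h u)
  also have "\<dots> \<le> (CARD('d) * ?g) * ?t"
    by (intro mult_right_mono L2_norm_normal_deriv_le u L2_norm_nonneg)
  finally have "?G\<^sup>2 \<le> CARD('d) * (?g * ?t) + ?l * ?N"
    using energy_identity[OF u] laplacian_mult_le[OF u] by linarith
  moreover have "?N\<^sup>2 \<le> 5 * ?G\<^sup>2 + 2 * ?t\<^sup>2"
    using friedrichs_inequality[OF has_trace_boundary_trace[OF h]] unfolding H1_norm_power2 by linarith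
  ultimately have "?N\<^sup>2 \<le> 2 * (5 / 2 * ?l) * ?N + (5 * (CARD('d) * (?g * ?t)) + 2 * ?t\<^sup>2)"
    by (simp add: algebra_simps)
  then have "?N\<^sup>2 \<le> 4 * (5 / 2 * ?l)\<^sup>2 + 2 * (5 * (CARD('d) * (?g * ?t)) + 2 * ?t\<^sup>2)"
    by (rule square_le_linear_imp)
  also have "\<dots> = 25 * ?l\<^sup>2 + 10 * (CARD('d) * (?g * ?t)) + 4 * ?t\<^sup>2"
    by (simp add: power_mult_distrib power_divide)
  also have "\<dots> \<le> 150 * CARD('d) * (?l\<^sup>2 + (?t\<^sup>2 + ?g * ?t))"
  proof -
    have "1 * ?l\<^sup>2 \<le> CARD('d) * ?l\<^sup>2" "1 * ?t\<^sup>2 \<le> CARD('d) * ?t\<^sup>2"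
      by (intro mult_right_mono; simp add: Suc_le_eq)+
    moreover have "0 \<le> ?l\<^sup>2" "0 \<le> ?t\<^sup>2" "0 \<le> CARD('d) * (?g * ?t)" by (auto simp: L2_norm_nonneg)
    ultimately show ?thesis
      by (simp only: distrib_left mult.assoc)
  qed
  finally show ?thesis .
qed

subsection \<open>The system\<close>

text \<open>Applied with \<open>l\<close> the squared norms of the Laplacians and \<open>a\<close>
  the squared \<open>H1_norm\<close>. One level down, \<open>l k\<close> is bounded by
  \<open>a (Suc k)\<close> and then \<open>a k\<close> by \<open>l k\<close>, at the price of a
  factor \<open>5 * (K + 1)\<close>; the factor \<open>n\<close> comes from summing over the
  levels.\<close>

lemma downward_recursion_bound:
  fixes a l :: "nat \<Rightarrow> real"
  assumes n: "n \<ge> 1" and K: "0 \<le> K" and X: "0 \<le> X"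
    and a: "\<And>k. k < n \<Longrightarrow> a k \<le> K * (l k + X)"
    and l: "\<And>k. Suc k < n \<Longrightarrow> l k \<le> 2 * X + 2 * a (Suc k)" and last: "l (n - 1) \<le> X"
    and nonneg: "\<And>k. 0 \<le> l k"
  shows "(\<Sum>k<n. l k + a k) \<le> real n * (5 * (K + 1)) ^ n * X"
proof -
  let ?D = "5 * (K + 1)"
  have D: "1 \<le> ?D" using K by simp
  \<comment> \<open>\<open>j\<close> counts levels from the last index downwards;
    \<open>j < n\<close> keeps the truncated subtraction exact.\<close>
  have step: "l (n - Suc j) + a (n - Suc j) \<le> ?D ^ Suc j * X" if "j < n" for j
    using that
  proof (induction j)
    case 0
    have "a (n - 1) \<le> K * (X + X)"
      using a[of "n - 1"] n last K by (intro order.trans[OF a[of "n - 1"]] mult_left_mono add_right_mono) auto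
    then have "l (n - 1) + a (n - 1) \<le> X + K * (X + X)"
      using last by linarith
    also have "\<dots> \<le> ?D * X"
      using K X by (simp add: algebra_simps)
    finally show ?case by simp
  next
    case (Suc j)
    let ?k = "n - Suc (Suc j)"
    have k: "Suc ?k = n - Suc j" "Suc ?k < n" "?k < n"
      using Suc.prems by auto
    define E where "E = ?D ^ Suc j * X"
    have XE: "X \<le> E"
      using mult_right_mono[OF one_le_power[OF D, of "Suc j"] X] by (simp only: E_def mult_1_left)
    have "l ?k \<le> 2 * X + 2 * a (Suc ?k)"
      by (rule l[OF k(2)])
    also have "a (Suc ?k) \<le> E"
      using Suc.IH[OF Suc_lessD[OF Suc.prems]] nonneg[of "n - Suc j"] unfolding k(1) E_def by linarith
    finally have lk: "l ?k \<le> 4 * E"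
      using XE by linarith
    have "a ?k \<le> K * (l ?k + X)"
      by (rule a[OF k(3)])
    also have "\<dots> \<le> K * (4 * E + E)"
      using K lk XE by (intro mult_left_mono add_mono)
    finally have "l ?k + a ?k \<le> 4 * E + K * (5 * E)"
      using lk by simp
    also have "\<dots> \<le> ?D * E"
      using X XE by (simp add: algebra_simps)
    finally show ?case
      by (simp add: E_def mult.assoc)
  qed
  have "(\<Sum>k<n. l k + a k) \<le> (\<Sum>k<n. ?D ^ n * X)"
  proof (rule sum_mono)
    fix k assume "k \<in> {..<n}"
    then have k: "n - k - 1 < n" "n - Suc (n - k - 1) = k" "Suc (n - k - 1) \<le> n"
      by auto
    have "l k + a k \<le> ?D ^ Suc (n - k - 1) * X"
      using step[OF k(1)] k(2) by simp
    also have "\<dots> \<le> ?D ^ n * X"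
      using k(3) D X by (intro mult_right_mono power_increasing)
    finally show "l k + a k \<le> ?D ^ n * X" .
  qed
  then show ?thesis by simp
qed

lemma S_star_eq:
  "S_star Dirichlet v k = boundary_trace (v k)"
  "S_star Neumann v k = normal_deriv (v k)"
  "S_star Robin v k = (\<lambda>x. boundary_trace (v k) x + normal_deriv (v k) x)"
  by (rule ext, simp)+

lemma L2_inner_tuple_self: "L2_inner_tuple M n f f = (\<Sum>k<n. (L2_norm M (f k))\<^sup>2)"
  by (simp add: L2_inner_tuple_def L2_norm_power2_real)

lemma bilinear_form_self:
  "bilinear_form lam mu n \<alpha> v v = (\<Sum>k<n. (L2_norm Omega_measure (P_star n v k))\<^sup>2)
    + lam * (\<Sum>k<n. (L2_norm boundary_measure (S_star \<alpha> v k))\<^sup>2)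
    + (if \<alpha> = Neumann then mu * (\<integral>x. v 0 x \<partial>Omega_measure)\<^sup>2 else 0)"
  by (simp add: bilinear_form_def L2_inner_tuple_self power2_eq_square)

lemma bilinear_form_self_bounds:
  assumes "0 < lam" "0 < mu"
  shows "0 \<le> bilinear_form lam mu n \<alpha> v v"
    "k < n \<Longrightarrow> (L2_norm Omega_measure (P_star n v k))\<^sup>2 \<le> bilinear_form lam mu n \<alpha> v v"
    "k < n \<Longrightarrow> (L2_norm boundary_measure (S_star \<alpha> v k))\<^sup>2 \<le> bilinear_form lam mu n \<alpha> v v / lam"
    "\<alpha> = Neumann \<Longrightarrow> (\<integral>x. v 0 x \<partial>Omega_measure)\<^sup>2 \<le> bilinear_form lam mu n \<alpha> v v / mu"
proof -
  let ?f = "\<Sum>k<n. (L2_norm Omega_measure (P_star n v k))\<^sup>2"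
  let ?s = "\<Sum>k<n. (L2_norm boundary_measure (S_star \<alpha> v k))\<^sup>2"
  let ?m = "if \<alpha> = Neumann then mu * (\<integral>x. v 0 x \<partial>Omega_measure)\<^sup>2 else 0"
  have nn: "0 \<le> ?f" "0 \<le> lam * ?s" "0 \<le> ?m"
    using assms by (auto intro!: sum_nonneg mult_nonneg_nonneg)
  note eq = bilinear_form_self[of lam mu n \<alpha> v]
  show "0 \<le> bilinear_form lam mu n \<alpha> v v"
    unfolding eq using nn by linarith
  show "(L2_norm Omega_measure (P_star n v k))\<^sup>2 \<le> bilinear_form lam mu n \<alpha> v v" if "k < n"
  proof -
    have "(L2_norm Omega_measure (P_star n v k))\<^sup>2 \<le> ?f"
      using that by (intro member_le_sum) auto
    then show ?thesis unfolding eq using nn by linarith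
  qed
  show "(L2_norm boundary_measure (S_star \<alpha> v k))\<^sup>2 \<le> bilinear_form lam mu n \<alpha> v v / lam" if "k < n"
  proof -
    have "(L2_norm boundary_measure (S_star \<alpha> v k))\<^sup>2 \<le> ?s"
      using that by (intro member_le_sum) auto
    then have "lam * (L2_norm boundary_measure (S_star \<alpha> v k))\<^sup>2 \<le> lam * ?s"
      using assms by (intro mult_left_mono) auto
    also have "\<dots> \<le> bilinear_form lam mu n \<alpha> v v"
      unfolding eq using nn by linarith
    finally show ?thesis
      using assms by (simp add: field_simps)
  qed
  show "(\<integral>x. v 0 x \<partial>Omega_measure)\<^sup>2 \<le> bilinear_form lam mu n \<alpha> v v / mu" if "\<alpha> = Neumann"
  proof -
    have "mu * (\<integral>x. v 0 x \<partial>Omega_measure)\<^sup>2 \<le> bilinear_form lam mu n \<alpha> v v"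
      unfolding eq using nn that by simp
    then show ?thesis
      using assms by (simp add: field_simps)
  qed
qed

lemma square_integrable_P_star:
  assumes "\<And>k. k < n \<Longrightarrow> v k \<in> H2" "k < n"
  shows "square_integrable Omega_measure (P_star n v k)"
  by (cases "Suc k < n") (simp_all add: P_star_def[abs_def] square_integrable_diff
      square_integrable_weak_laplacian H1_square_integrable(1)[OF H2_H1(1)] assms)

lemma laplacian_le_P_star:
  assumes v: "\<And>k. k < n \<Longrightarrow> v k \<in> H2" and k: "Suc k < n"
  shows "(L2_norm Omega_measure (weak_laplacian (v k)))\<^sup>2
    \<le> 2 * (L2_norm Omega_measure (P_star n v k))\<^sup>2 + 2 * (H1_norm (v (Suc k)))\<^sup>2"
proof -
  have h: "v (Suc k) \<in> H1" by (intro H2_H1(1) v k)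
  have "weak_laplacian (v k) = (\<lambda>x. P_star n v k x + v (Suc k) x)"
    using k by (simp add: P_star_def)
  then have "L2_norm Omega_measure (weak_laplacian (v k))
      \<le> L2_norm Omega_measure (P_star n v k) + L2_norm Omega_measure (v (Suc k))"
    using k by (simp add: L2_norm_triangle square_integrable_P_star v H1_square_integrable[OF h])
  also have "\<dots> \<le> L2_norm Omega_measure (P_star n v k) + H1_norm (v (Suc k))"
    by (intro add_left_mono L2_norm_le_H1_norm[OF H1_has_weak_partial[OF h]])
  finally have "(L2_norm Omega_measure (weak_laplacian (v k)))\<^sup>2
      \<le> (L2_norm Omega_measure (P_star n v k) + H1_norm (v (Suc k)))\<^sup>2"
    by (intro power_mono L2_norm_nonneg)
  also have "\<dots> \<le> 2 * (L2_norm Omega_measure (P_star n v k))\<^sup>2 + 2 * (H1_norm (v (Suc k)))\<^sup>2"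
    using square_sum_sqrt_le[of 1 "L2_norm Omega_measure (P_star n v k)" "H1_norm (v (Suc k))"] by simp
  finally show ?thesis .
qed

text \<open>The mean value of \<open>v (k + 1) = \<Delta> v k - P_star n v k\<close> is a boundary integral up to the residual.\<close>

lemma mean_Suc_le:
  fixes v :: "nat \<Rightarrow> real ^ 'd \<Rightarrow> real"
  assumes v: "\<And>k. k < n \<Longrightarrow> v k \<in> H2" and k: "Suc k < n"
  shows "(\<integral>x. v (Suc k) x \<partial>Omega_measure)\<^sup>2
    \<le> 2 * measure boundary_measure (UNIV :: (real ^ 'd) set) * (L2_norm boundary_measure (normal_deriv (v k)))\<^sup>2
      + 2 * (L2_norm Omega_measure (P_star n v k))\<^sup>2"
proof -
  have vk: "v k \<in> H2" "square_integrable Omega_measure (P_star n v k)"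
    using v k by (auto intro: square_integrable_P_star)
  let ?b = "\<integral>x. normal_deriv (v k) x * 1 \<partial>boundary_measure" and ?c = "\<integral>x. P_star n v k x * 1 \<partial>Omega_measure"
  \<comment> \<open>\<open>weak_grad\<close> of the constant 1 is an arbitrary representative, zero
    only almost everywhere. Its norm is 0, so Cauchy-Schwarz removes the gradient term from Green's
    formula.\<close>
  have "weak_grad (\<lambda>x :: real ^ 'd. 1) \<in> borel_measurable Omega_measure \<and>
      L2_norm Omega_measure (weak_grad (\<lambda>x :: real ^ 'd. 1)) = 0"
  proof
    have c: "(\<lambda>x :: real ^ 'd. 1) \<in> H1"
      by (rule H1_I[OF smooth_has_weak_partial[OF smooth_const]])
    show "weak_grad (\<lambda>x :: real ^ 'd. 1) \<in> borel_measurable Omega_measure"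
      by (intro square_integrable_measurable square_integrable_weak_grad c)
    have "L2_norm Omega_measure (weak_partial i (\<lambda>x :: real ^ 'd. 1)) = 0" for i
      unfolding L2_norm_weak_partial[OF smooth_has_weak_partial[OF smooth_const]] partial_deriv_const
      by (simp add: L2_norm_def)
    then show "L2_norm Omega_measure (weak_grad (\<lambda>x :: real ^ 'd. 1)) = 0"
      using L2_norm_weak_grad_power2[OF c] by simp
  qed
  moreover have "\<bar>\<integral>x. weak_grad (v k) x \<bullet> weak_grad (\<lambda>x. 1) x \<partial>Omega_measure\<bar>
      \<le> L2_norm Omega_measure (weak_grad (v k)) * L2_norm Omega_measure (weak_grad (\<lambda>x :: real ^ 'd. 1))"
    by (intro L2_Cauchy_Schwarz square_integrable_weak_grad H2_H1(1)[OF vk(1)]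
        H1_I[OF smooth_has_weak_partial[OF smooth_const]])
  ultimately have "(\<integral>x. weak_laplacian (v k) x * 1 \<partial>Omega_measure) = ?b"
    using green_formula_laplacian[OF vk(1) has_trace_smooth[OF smooth_const[of 1]]] by simp
  moreover have "(\<integral>x. v (Suc k) x \<partial>Omega_measure) = (\<integral>x. weak_laplacian (v k) x * 1 - P_star n v k x * 1 \<partial>Omega_measure)"
    using k by (simp add: P_star_def)
  moreover have "\<dots> = (\<integral>x. weak_laplacian (v k) x * 1 \<partial>Omega_measure) - ?c"
    by (intro Bochner_Integration.integral_diff square_integrable_mult vk square_integrable_weak_laplacian
        Omega.square_integrable_const)
  ultimately have "(\<integral>x. v (Suc k) x \<partial>Omega_measure)\<^sup>2 = (?b - ?c)\<^sup>2"
    by simp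
  also have "\<dots> \<le> 2 * ?b\<^sup>2 + 2 * ?c\<^sup>2"
    using square_sum_sqrt_le[of 1 ?b "- ?c"] by simp
  also have "?b\<^sup>2 \<le> measure boundary_measure (UNIV :: (real ^ 'd) set) * (L2_norm boundary_measure (normal_deriv (v k)))\<^sup>2"
  proof -
    have "\<bar>?b\<bar> \<le> L2_norm boundary_measure (normal_deriv (v k)) * L2_norm boundary_measure (\<lambda>x :: real ^ 'd. 1 :: real)"
      by (intro L2_Cauchy_Schwarz_real square_integrable_normal_deriv vk boundary.square_integrable_const)
    from power_mono[OF this, of 2] show ?thesis
      by (simp add: power_mult_distrib L2_norm_power2[of _ "\<lambda>x. 1"] space_boundary_measure mult.commute)
  qed
  also have "?c\<^sup>2 \<le> (L2_norm Omega_measure (P_star n v k))\<^sup>2"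
  proof -
    have "\<bar>?c\<bar> \<le> L2_norm Omega_measure (P_star n v k) * L2_norm Omega_measure (\<lambda>x :: real ^ 'd. 1 :: real)"
      by (intro L2_Cauchy_Schwarz_real vk Omega.square_integrable_const)
    from power_mono[OF this, of 2] show ?thesis
      by (simp add: power_mult_distrib L2_norm_power2[of _ "\<lambda>x. 1"] space_restrict_space measure_Omega)
  qed
  finally show ?thesis
    by simp
qed

text \<open>Everything specific to a boundary condition sits in the hypothesis on
  \<open>H1_norm\<close>; \<open>X\<close> becomes a multiple of the left-hand side of the theorem.
  The leading 2 is due to the gradient being counted in both norms.\<close>

lemma system_estimate:
  fixes v :: "nat \<Rightarrow> real ^ 'd \<Rightarrow> real"
  assumes n: "n \<ge> 1" and v: "\<And>k. k < n \<Longrightarrow> v k \<in> H2" and X: "0 \<le> X"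
    and f: "\<And>k. k < n \<Longrightarrow> (L2_norm Omega_measure (P_star n v k))\<^sup>2 \<le> X"
    and a: "\<And>k. k < n \<Longrightarrow> (H1_norm (v k))\<^sup>2 \<le> 150 * CARD('d) * ((L2_norm Omega_measure (weak_laplacian (v k)))\<^sup>2 + X)"
  shows "(\<Sum>k<n. (Hdiv_norm (weak_grad (v k)))\<^sup>2 + (H1_norm (v k))\<^sup>2)
    \<le> 2 * (real n * (5 * (150 * real CARD('d) + 1)) ^ n) * X"
proof -
  let ?l = "\<lambda>k. (L2_norm Omega_measure (weak_laplacian (v k)))\<^sup>2" and ?a = "\<lambda>k. (H1_norm (v k))\<^sup>2"
  have "(Hdiv_norm (weak_grad (v k)))\<^sup>2 + ?a k \<le> 2 * (?l k + ?a k)" if "k < n" for k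
    using Hdiv_norm_weak_grad_power2[OF v[OF that]] H1_norm_power2[of "v k"]
      zero_le_power2[of "L2_norm Omega_measure (v k)"] zero_le_power2[of "L2_norm Omega_measure (weak_laplacian (v k))"]
    by simp
  then have "(\<Sum>k<n. (Hdiv_norm (weak_grad (v k)))\<^sup>2 + ?a k) \<le> 2 * (\<Sum>k<n. ?l k + ?a k)"
    unfolding sum_distrib_left by (intro sum_mono) auto
  also have "(\<Sum>k<n. ?l k + ?a k) \<le> real n * (5 * (150 * real CARD('d) + 1)) ^ n * X"
  proof (rule downward_recursion_bound[OF n _ X])
    show "?l k \<le> 2 * X + 2 * ?a (Suc k)" if "Suc k < n" for k
      using laplacian_le_P_star[of n v k] v that f[of k] by fastforce
    have "weak_laplacian (v (n - 1)) = P_star n v (n - 1)"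
      using n by (auto simp: P_star_def)
    then show "?l (n - 1) \<le> X"
      using f[of "n - 1"] n by simp
  qed (use a in auto)
  finally show ?thesis by simp
qed

theorem lemma5p1:
  fixes lam mu :: real and n :: nat
  assumes "lam > 0" and "mu > 0" and "n \<ge> 1"
  shows "(\<forall>\<alpha>\<in>{Neumann, Robin}. \<exists>C>0. \<forall>v :: nat \<Rightarrow> real ^ 'd \<Rightarrow> real.
            (\<forall>k<n. v k \<in> H2) \<longrightarrow>
            bilinear_form lam mu n \<alpha> v v
              \<ge> C * (\<Sum>k<n. (Hdiv_norm (weak_grad (v k)))\<^sup>2 + (H1_norm (v k))\<^sup>2))
       \<and> (\<exists>C>0. \<forall>v :: nat \<Rightarrow> real ^ 'd \<Rightarrow> real.
            (\<forall>k<n. v k \<in> H2) \<longrightarrow>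
            (sqrt (bilinear_form lam mu n Dirichlet v v)
               + (\<Sum>k<n. L2_norm boundary_measure (grad_trace (v k))))
              * sqrt (bilinear_form lam mu n Dirichlet v v)
              \<ge> C * (\<Sum>k<n. (Hdiv_norm (weak_grad (v k)))\<^sup>2 + (H1_norm (v k))\<^sup>2))"
proof -
  define D where "D = 2 * (real n * (5 * (150 * real CARD('d) + 1)) ^ n)"
  have D: "0 < D"
    using assms(3) by (auto simp: D_def intro!: mult_pos_pos zero_less_power add_nonneg_pos)
  define c where "c = measure boundary_measure (UNIV :: (real ^ 'd) set)"
  have c: "0 \<le> c" by (simp add: c_def)
  let ?\<Sigma> = "\<lambda>v :: nat \<Rightarrow> real ^ 'd \<Rightarrow> real. \<Sum>k<n. (Hdiv_norm (weak_grad (v k)))\<^sup>2 + (H1_norm (v k))\<^sup>2"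
  \<comment> \<open>\<open>A\<close> collects the constants in \<open>lam\<close> and
    \<open>mu\<close> specific to a boundary condition; the final constant is
    \<open>1 / (D * A)\<close>.\<close>
  have conclude: "1 / (D * A) * S \<le> B" if "S \<le> D * (A * B)" "0 < A" for S A B :: real
    using that D by (simp add: field_simps)
  note bounds = bilinear_form_self_bounds[OF assms(1,2)]

  \<comment> \<open>The 1 covers the residuals \<open>P_star\<close>, and \<open>1 / lam\<close>
    undoes the weight of the boundary term.\<close>
  have robin: "?\<Sigma> v \<le> D * ((1 + 1 / lam) * bilinear_form lam mu n Robin v v)"
    if v: "\<forall>k<n. v k \<in> H2" for v :: "nat \<Rightarrow> real ^ 'd \<Rightarrow> real"
    unfolding D_def
  proof (rule system_estimate[OF assms(3)])
    let ?B = "bilinear_form lam mu n Robin v v"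
    have X: "(1 + 1 / lam) * ?B = ?B + ?B / lam"
      by (simp add: algebra_simps)
    have B: "0 \<le> ?B"
      by (rule bounds(1))
    then have nn: "0 \<le> ?B" "0 \<le> ?B / lam"
      using assms by simp_all
    show "0 \<le> (1 + 1 / lam) * ?B"
      unfolding X using nn by linarith
    fix k assume k: "k < n"
    show "(L2_norm Omega_measure (P_star n v k))\<^sup>2 \<le> (1 + 1 / lam) * ?B"
      unfolding X using bounds(2)[OF k, where \<alpha> = Robin and v = v] nn by linarith
    have "(L2_norm boundary_measure (\<lambda>x. boundary_trace (v k) x + normal_deriv (v k) x))\<^sup>2 \<le> (1 + 1 / lam) * ?B"
      unfolding X using bounds(3)[OF k, where \<alpha> = Robin and v = v] nn unfolding S_star_eq by simp
    then show "(H1_norm (v k))\<^sup>2 \<le> 150 * CARD('d) * ((L2_norm Omega_measure (weak_laplacian (v k)))\<^sup>2 + (1 + 1 / lam) * ?B)"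
      using v k by (intro order.trans[OF robin_estimate] mult_left_mono add_left_mono) auto
  qed (use v in auto)

  \<comment> \<open>\<open>1 / lam\<close> pays for the normal derivatives, \<open>1 / mu\<close>
    for the mean of \<open>v 0\<close>, and \<open>2 * c / lam + 2\<close> for the later means
    through \<open>mean_Suc_le\<close>; the 2 also covers the residuals.\<close>
  have neumann: "?\<Sigma> v \<le> D * ((1 / lam + 1 / mu + 2 * c / lam + 2) * bilinear_form lam mu n Neumann v v)"
    if v: "\<forall>k<n. v k \<in> H2" for v :: "nat \<Rightarrow> real ^ 'd \<Rightarrow> real"
    unfolding D_def
  proof (rule system_estimate[OF assms(3)])
    let ?B = "bilinear_form lam mu n Neumann v v"
    have X: "(1 / lam + 1 / mu + 2 * c / lam + 2) * ?B = ?B / lam + ?B / mu + 2 * c * (?B / lam) + 2 * ?B"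
      by (simp add: algebra_simps)
    have B: "0 \<le> ?B"
      by (rule bounds(1))
    then have nn: "0 \<le> ?B" "0 \<le> ?B / lam" "0 \<le> ?B / mu" "0 \<le> 2 * c * (?B / lam)"
      using assms c by simp_all
    show "0 \<le> (1 / lam + 1 / mu + 2 * c / lam + 2) * ?B"
      unfolding X using nn by linarith
    fix k assume k: "k < n"
    show "(L2_norm Omega_measure (P_star n v k))\<^sup>2 \<le> (1 / lam + 1 / mu + 2 * c / lam + 2) * ?B"
      unfolding X using bounds(2)[OF k, where \<alpha> = Neumann and v = v] nn by linarith
    have nd: "(L2_norm boundary_measure (normal_deriv (v k)))\<^sup>2 \<le> ?B / lam" if "k < n" for k
      using bounds(3)[OF that, where \<alpha> = Neumann and v = v] unfolding S_star_eq .
    have "(\<integral>x. v k x \<partial>Omega_measure)\<^sup>2 \<le> ?B / mu + 2 * c * (?B / lam) + 2 * ?B"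
    proof (cases k)
      case 0
      then show ?thesis
        using bounds(4)[of Neumann v n] nn by simp
    next
      case (Suc j)
      then have j: "Suc j < n" "j < n" using k by auto
      have "(\<integral>x. v (Suc j) x \<partial>Omega_measure)\<^sup>2
          \<le> 2 * c * (L2_norm boundary_measure (normal_deriv (v j)))\<^sup>2 + 2 * (L2_norm Omega_measure (P_star n v j))\<^sup>2"
        unfolding c_def using v j by (intro mean_Suc_le) auto
      also have "\<dots> \<le> 2 * c * (?B / lam) + 2 * ?B"
        using c by (intro add_mono mult_left_mono nd bounds(2) j) auto
      finally show ?thesis
        using nn Suc by simp
    qed
    then have "(L2_norm boundary_measure (normal_deriv (v k)))\<^sup>2 + (\<integral>x. v k x \<partial>Omega_measure)\<^sup>2
        \<le> (1 / lam + 1 / mu + 2 * c / lam + 2) * ?B"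
      unfolding X using nd[OF k] by linarith
    then show "(H1_norm (v k))\<^sup>2
        \<le> 150 * CARD('d) * ((L2_norm Omega_measure (weak_laplacian (v k)))\<^sup>2 + (1 / lam + 1 / mu + 2 * c / lam + 2) * ?B)"
      using v k by (intro order.trans[OF neumann_estimate] mult_left_mono add_left_mono) auto
  qed (use v in auto)

  \<comment> \<open>The 1 covers the residuals and \<open>1 / lam\<close> the squared traces.
    \<open>1 / sqrt lam\<close> covers the mixed term, in which a trace enters to the first power
    and is at most the square root of the form divided by \<open>sqrt lam\<close>.\<close>
  have dirichlet: "?\<Sigma> v \<le> D * ((1 + 1 / lam + 1 / sqrt lam)
      * ((sqrt (bilinear_form lam mu n Dirichlet v v) + (\<Sum>k<n. L2_norm boundary_measure (grad_trace (v k))))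
        * sqrt (bilinear_form lam mu n Dirichlet v v)))"
    if v: "\<forall>k<n. v k \<in> H2" for v :: "nat \<Rightarrow> real ^ 'd \<Rightarrow> real"
    unfolding D_def
  proof (rule system_estimate[OF assms(3)])
    let ?B = "bilinear_form lam mu n Dirichlet v v" and ?\<Gamma> = "\<Sum>k<n. L2_norm boundary_measure (grad_trace (v k))"
    let ?X = "(1 + 1 / lam + 1 / sqrt lam) * ((sqrt ?B + ?\<Gamma>) * sqrt ?B)"
    have B: "0 \<le> ?B" by (rule bounds(1))
    have \<Gamma>: "0 \<le> ?\<Gamma>" by (intro sum_nonneg L2_norm_nonneg)
    let ?Y = "?B + ?\<Gamma> * sqrt ?B"
    have X: "?X = ?Y + ?Y / lam + ?Y / sqrt lam"
      using B by (simp add: algebra_simps add_divide_distrib)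
    have nn: "0 \<le> ?\<Gamma> * sqrt ?B" "0 \<le> ?Y" "0 \<le> ?Y / lam" "0 \<le> ?Y / sqrt lam" "?B / lam \<le> ?Y / lam"
        "(?\<Gamma> * sqrt ?B) / sqrt lam \<le> ?Y / sqrt lam"
      using B \<Gamma> assms by (auto intro!: divide_right_mono)
    show "0 \<le> ?X"
      unfolding X using nn by linarith
    fix k assume k: "k < n"
    show "(L2_norm Omega_measure (P_star n v k))\<^sup>2 \<le> ?X"
      unfolding X using bounds(2)[OF k, where \<alpha> = Dirichlet and v = v] nn by linarith
    let ?t = "L2_norm boundary_measure (boundary_trace (v k))" and ?g = "L2_norm boundary_measure (grad_trace (v k))"
    have t: "?t\<^sup>2 \<le> ?B / lam"
      using bounds(3)[OF k, where \<alpha> = Dirichlet and v = v] unfolding S_star_eq .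
    then have "?t \<le> sqrt ?B / sqrt lam"
      by (simp add: real_le_rsqrt flip: real_sqrt_divide)
    moreover have "?g \<le> ?\<Gamma>"
      using k by (intro member_le_sum) (auto simp: L2_norm_nonneg)
    ultimately have "?g * ?t \<le> ?\<Gamma> * (sqrt ?B / sqrt lam)"
      using \<Gamma> by (intro mult_mono) (auto simp: L2_norm_nonneg)
    then have "?t\<^sup>2 + ?g * ?t \<le> ?X"
      unfolding X using t nn by simp
    then show "(H1_norm (v k))\<^sup>2 \<le> 150 * CARD('d) * ((L2_norm Omega_measure (weak_laplacian (v k)))\<^sup>2 + ?X)"
      using v k by (intro order.trans[OF dirichlet_estimate] mult_left_mono add_left_mono) auto
  qed (use v in auto)

  have A: "0 < 1 + 1 / lam" "0 < 1 / lam + 1 / mu + 2 * c / lam + 2" "0 < 1 + 1 / lam + 1 / sqrt lam"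
    using assms c by (auto intro!: add_pos_pos add_pos_nonneg add_nonneg_pos)
  show ?thesis
  proof (intro conjI ballI)
    fix \<alpha> assume "\<alpha> \<in> {Neumann, Robin}"
    then consider "\<alpha> = Neumann" | "\<alpha> = Robin" by blast
    then show "\<exists>C>0. \<forall>v :: nat \<Rightarrow> real ^ 'd \<Rightarrow> real. (\<forall>k<n. v k \<in> H2) \<longrightarrow> bilinear_form lam mu n \<alpha> v v \<ge> C * ?\<Sigma> v"
    proof cases
      case 1
      then show ?thesis
        using D A conclude[OF neumann A(2)]
        by (intro exI[of _ "1 / (D * (1 / lam + 1 / mu + 2 * c / lam + 2))"]) simp
    next
      case 2
      then show ?thesis
        using D A conclude[OF robin A(1)]
        by (intro exI[of _ "1 / (D * (1 + 1 / lam))"]) simp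
    qed
  next
    show "\<exists>C>0. \<forall>v :: nat \<Rightarrow> real ^ 'd \<Rightarrow> real. (\<forall>k<n. v k \<in> H2) \<longrightarrow>
        (sqrt (bilinear_form lam mu n Dirichlet v v) + (\<Sum>k<n. L2_norm boundary_measure (grad_trace (v k))))
          * sqrt (bilinear_form lam mu n Dirichlet v v) \<ge> C * ?\<Sigma> v"
      using D A conclude[OF dirichlet A(3)]
      by (intro exI[of _ "1 / (D * (1 + 1 / lam + 1 / sqrt lam))"]) simp
  qed
qed

end
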